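(* Let $H$ be a Hopf algebra over a field $K$. Let $A$ be a bialgebra and let $\sigma:H\to A$ be an injective morphism of bialgebras having a retraction $\pi:A\to H$ (i.e. $\pi\sigma=\mathrm{Id}_H$) that is an $H$-bilinear coalgebra map. Assume that $H$ is either finite-dimensional or cosemisimple and that the coalgebra $R$ in the pre-bialgebra in ${}_H^H\mathcal{YD}$ associated to $(A,\pi,\sigma)$ is $N$-dimensional and thin. Then there exist a primitive $N$-th root of unity $q$ and $g\in H$, $\chi\in H^*$, $\lambda(N)\in K$ such that $(H,g,\chi,\lambda(N))$ is a compatible datum for $q$ and there is a bialgebra isomorphism $\widehat\sigma:\mathcal O(H,g,\chi,\lambda(N))\to A$ such that $\widehat\sigma\circ\sigma_{\mathcal O}=\sigma$.
   Context: $K$ has characteristic $0$; everything is over $K$; $S$ is the antipode of $H$. Associated coalgebra. $A$ is an $H$-bimodule via $\sigma$. Put $\tau(a)=\sum a_{(1)}\sigma S\pi(a_{(2)})$ and $R=\{a\in A\mid \sum a_{(1)}\otimes\pi(a_{(2)})=a\otimes 1_H\}$; $R$ is a coalgebra with $\delta(r)=\sum\tau(r_{(1)})\otimes r_{(2)}$ and $\varepsilon=\varepsilon_A|_R$. This is the coalgebra underlying the pre-bialgebra in ${}_H^H\mathcal{YD}$ (the category of left-left Yetter-Drinfeld modules) associated to $(A,\pi,\sigma)$. Thin. A coalgebra $C$ is thin if its coradical is one-dimensional and its space $P(C)$ of primitive elements is one-dimensional. Compatible datum. Let $q$ be a primitive $N$-th root of unity. A Yetter-Drinfeld datum $(H,g,\chi)$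 for $q$ consists of a group-like $g\in G(H)$ and an algebra map $\chi:H\to K$ with $\chi(g)=q$ and $g\sum\chi(h_{(1)})h_{(2)}=\sum h_{(1)}\chi(h_{(2)})g$ for all $h\in H$. A compatible datum for $q$ is $(H,g,\chi,\lambda(N))$ with $(H,g,\chi)$ a Yetter-Drinfeld datum for $q$ and $\lambda(N)\in K$, where $\lambda(N)=0$ is required if $g^N=1_H$ or if $\chi^N(h)(1_H-g^N)\ne\sum h_{(1)}(1_H-g^N)S(h_{(2)})$ for some $h\in H$ ($\chi^N$ the convolution power), and $\lambda(N)$ is arbitrary otherwise. The Hopf algebra $\mathcal O$. For a compatible datum let $\varphi_H(h)=\sum\chi(h_{(1)})h_{(2)}$, an algebra automorphism of $H$. The Ore extension $H[X,\varphi_H,0]$ (generated by $H$ and $X$ with $hX=X\varphi_H(h)$) is a Hopf algebra with $H$ as Hopf subalgebra, $\Delta(X)=X\otimes 1+g\otimes X$, $\varepsilon(X)=0$, $S(X)=-g^{-1}X$. Then $\mathcal O(H,g,\chi,\lambda(N))$ is its quotient by the Hopf ideal generated by $X^N-\lambda(N)(1-g^N)$, and $\sigma_{\mathcal O}:H\to\mathcal O$ is the canonical map; it is injective, and with $y$ the class of $X$, $\mathcal O$ has basis $\{y^i\sigma_{\mathcal O}(h)\mid 0\le i\le N-1,\ h\in\mathcal B(H)\}$, $\mathcal B(H)$ a basis of $H$. *)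

theory Defs
  imports
    "HOL-Library.Multiset"
    "HOL-Algebra.QuotRing"
    "HOL-Algebra.Algebraic_Closure_Type"
    "HOL-Computational_Algebra.Polynomial"
begin

section \<open>Tensors\<close>

text \<open>
  An element of \<open>V \<otimes> W\<close> is represented by a finite formal sum of pure tensors, that is, by a
  multiset of pairs: \<open>{#(v\<^sub>1, w\<^sub>1), \<dots>, (v\<^sub>n, w\<^sub>n)#}\<close> stands for \<open>v\<^sub>1 \<otimes> w\<^sub>1 + \<dots> + v\<^sub>n \<otimes> w\<^sub>n\<close>, and
  addition is multiset union. Equality in \<open>V \<otimes> W\<close> is \<open>tensor_eq\<close>, the congruence on this free
  commutative monoid generated by the relations of the tensor product. (Scalars are absorbed into
  either factor; \<open>(-v, w)\<close> is an additive inverse of \<open>(v, w)\<close> by \<open>add_left\<close> and \<open>zero_left\<close>.)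
  A comultiplication selects for every \<open>a\<close> a representative of the tensor \<open>\<Sum> a\<^sub>(\<^sub>1\<^sub>) \<otimes> a\<^sub>(\<^sub>2\<^sub>)\<close>, and
  Sweedler sums are sums over that multiset; they do not depend on the representative because
  the summands are bilinear.
\<close>

inductive multiset_cong ::
    "('t multiset \<Rightarrow> 't multiset \<Rightarrow> bool) \<Rightarrow> 't multiset \<Rightarrow> 't multiset \<Rightarrow> bool"
  for rel where
  base: "rel t u \<Longrightarrow> multiset_cong rel t u"
| refl: "multiset_cong rel t t"
| sym: "multiset_cong rel t u \<Longrightarrow> multiset_cong rel u t"
| trans: "multiset_cong rel t u \<Longrightarrow> multiset_cong rel u v \<Longrightarrow> multiset_cong rel t v"
| add: "multiset_cong rel t u \<Longrightarrow> multiset_cong rel t' u' \<Longrightarrow> multiset_cong rel (t + t') (u + u')"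

inductive tensor_rel ::
    "('k::field \<Rightarrow> 'v::ab_group_add \<Rightarrow> 'v) \<Rightarrow> ('k \<Rightarrow> 'w::ab_group_add \<Rightarrow> 'w) \<Rightarrow>
      ('v \<times> 'w) multiset \<Rightarrow> ('v \<times> 'w) multiset \<Rightarrow> bool"
  for s1 s2 where
  add_left: "tensor_rel s1 s2 {#(x + x', y)#} {#(x, y), (x', y)#}"
| add_right: "tensor_rel s1 s2 {#(x, y + y')#} {#(x, y), (x, y')#}"
| zero_left: "tensor_rel s1 s2 {#(0, y)#} {#}"
| scale: "tensor_rel s1 s2 {#(s1 c x, y)#} {#(x, s2 c y)#}"

definition tensor_eq ::
    "('k::field \<Rightarrow> 'v::ab_group_add \<Rightarrow> 'v) \<Rightarrow> ('k \<Rightarrow> 'w::ab_group_add \<Rightarrow> 'w) \<Rightarrow>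
      ('v \<times> 'w) multiset \<Rightarrow> ('v \<times> 'w) multiset \<Rightarrow> bool"
  where "tensor_eq s1 s2 = multiset_cong (tensor_rel s1 s2)"

inductive tensor3_rel ::
    "('k::field \<Rightarrow> 'v::ab_group_add \<Rightarrow> 'v) \<Rightarrow>
      ('v \<times> 'v \<times> 'v) multiset \<Rightarrow> ('v \<times> 'v \<times> 'v) multiset \<Rightarrow> bool"
  for s where
  left: "tensor_rel s s t u \<Longrightarrow>
    tensor3_rel s (image_mset (\<lambda>(x, y). (x, y, z)) t) (image_mset (\<lambda>(x, y). (x, y, z)) u)"
| right: "tensor_rel s s t u \<Longrightarrow>
    tensor3_rel s (image_mset (\<lambda>(y, z). (x, y, z)) t) (image_mset (\<lambda>(y, z). (x, y, z)) u)"

text \<open>Equality in \<open>V \<otimes> V \<otimes> V\<close>.\<close>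

definition tensor3_eq ::
    "('k::field \<Rightarrow> 'v::ab_group_add \<Rightarrow> 'v) \<Rightarrow>
      ('v \<times> 'v \<times> 'v) multiset \<Rightarrow> ('v \<times> 'v \<times> 'v) multiset \<Rightarrow> bool"
  where "tensor3_eq s = multiset_cong (tensor3_rel s)"

text \<open>The product \<open>(x \<otimes> y)(x' \<otimes> y') = xx' \<otimes> yy'\<close>, for a multiplication \<open>m\<close>.\<close>

definition tensor_mult ::
    "('v \<Rightarrow> 'v \<Rightarrow> 'v) \<Rightarrow> ('v \<times> 'v) multiset \<Rightarrow> ('v \<times> 'v) multiset \<Rightarrow> ('v \<times> 'v) multiset"
  where "tensor_mult m t u =
    (\<Sum>(x, y)\<in>#t. image_mset (\<lambda>(x', y'). (m x x', m y y')) u)"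


section \<open>Coalgebras, bialgebras and Hopf algebras\<close>

locale coalgebra = vector_space scale
  for scale :: "'k::field \<Rightarrow> 'a::ab_group_add \<Rightarrow> 'a" +
  fixes comult :: "'a \<Rightarrow> ('a \<times> 'a) multiset"
    and counit :: "'a \<Rightarrow> 'k"
  assumes comult_add: "tensor_eq scale scale (comult (x + y)) (comult x + comult y)"
    and comult_scale:
      "tensor_eq scale scale (comult (scale c x)) (image_mset (map_prod (scale c) id) (comult x))"
    and counit_linear: "Vector_Spaces.linear scale (*) counit"
    and coassoc: "tensor3_eq scale
      (\<Sum>(x, y)\<in>#comult a. image_mset (\<lambda>(x', x''). (x', x'', y)) (comult x))
      (\<Sum>(x, y)\<in>#comult a. image_mset (\<lambda>(y', y''). (x, y', y'')) (comult y))"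
    and counit_left: "(\<Sum>(x, y)\<in>#comult a. scale (counit x) y) = a"
    and counit_right: "(\<Sum>(x, y)\<in>#comult a. scale (counit y) x) = a"

locale bialgebra = coalgebra scale comult counit
  for scale :: "'k::field \<Rightarrow> 'a::ring_1 \<Rightarrow> 'a" and comult counit +
  assumes scale_mult_left: "scale c x * y = scale c (x * y)"
    and scale_mult_right: "x * scale c y = scale c (x * y)"
    and comult_mult:
      "tensor_eq scale scale (comult (x * y)) (tensor_mult (*) (comult x) (comult y))"
    and comult_one: "tensor_eq scale scale (comult 1) {#(1, 1)#}"
    and counit_mult: "counit (x * y) = counit x * counit y"
    and counit_one: "counit 1 = 1"

locale hopf_algebra = bialgebra scale comult counit
  for scale :: "'k::field \<Rightarrow> 'a::ring_1 \<Rightarrow> 'a" and comult counit +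
  fixes antipode :: "'a \<Rightarrow> 'a"
  assumes antipode_linear: "Vector_Spaces.linear scale scale antipode"
    and antipode_left: "(\<Sum>(x, y)\<in>#comult a. antipode x * y) = scale (counit a) 1"
    and antipode_right: "(\<Sum>(x, y)\<in>#comult a. x * antipode y) = scale (counit a) 1"

definition coalgebra_hom ::
    "('k::field \<Rightarrow> 'a::ab_group_add \<Rightarrow> 'a) \<Rightarrow> ('a \<Rightarrow> ('a \<times> 'a) multiset) \<Rightarrow> ('a \<Rightarrow> 'k) \<Rightarrow>
      ('k \<Rightarrow> 'b::ab_group_add \<Rightarrow> 'b) \<Rightarrow> ('b \<Rightarrow> ('b \<times> 'b) multiset) \<Rightarrow> ('b \<Rightarrow> 'k) \<Rightarrow>
      ('a \<Rightarrow> 'b) \<Rightarrow> bool"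
  where "coalgebra_hom sA \<Delta>A \<epsilon>A sB \<Delta>B \<epsilon>B f \<longleftrightarrow>
    Vector_Spaces.linear sA sB f \<and>
    (\<forall>a. tensor_eq sB sB (\<Delta>B (f a)) (image_mset (map_prod f f) (\<Delta>A a))) \<and>
    (\<forall>a. \<epsilon>B (f a) = \<epsilon>A a)"

definition bialgebra_hom ::
    "('k::field \<Rightarrow> 'a::ring_1 \<Rightarrow> 'a) \<Rightarrow> ('a \<Rightarrow> ('a \<times> 'a) multiset) \<Rightarrow> ('a \<Rightarrow> 'k) \<Rightarrow>
      ('k \<Rightarrow> 'b::ring_1 \<Rightarrow> 'b) \<Rightarrow> ('b \<Rightarrow> ('b \<times> 'b) multiset) \<Rightarrow> ('b \<Rightarrow> 'k) \<Rightarrow>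
      ('a \<Rightarrow> 'b) \<Rightarrow> bool"
  where "bialgebra_hom sA \<Delta>A \<epsilon>A sB \<Delta>B \<epsilon>B f \<longleftrightarrow>
    coalgebra_hom sA \<Delta>A \<epsilon>A sB \<Delta>B \<epsilon>B f \<and>
    (\<forall>x y. f (x * y) = f x * f y) \<and> f 1 = 1"


section \<open>Subcoalgebras, coradical, thin coalgebras\<close>

text \<open>
  The notions below concern a coalgebra whose underlying space is a subspace \<open>C\<close> of an ambient
  vector space \<open>V\<close>. Over a field, \<open>D \<otimes> D\<close> embeds into \<open>V \<otimes> V\<close> for every subspace \<open>D\<close>, so
  equality of tensors is taken in \<open>V \<otimes> V\<close>.
\<close>

definition grouplike ::
    "('k::field \<Rightarrow> 'v::ab_group_add \<Rightarrow> 'v) \<Rightarrow> ('v \<Rightarrow> ('v \<times> 'v) multiset) \<Rightarrow> ('v \<Rightarrow> 'k) \<Rightarrow>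
      'v \<Rightarrow> bool"
  where "grouplike s \<Delta> \<epsilon> g \<longleftrightarrow> tensor_eq s s (\<Delta> g) {#(g, g)#} \<and> \<epsilon> g = 1"

definition finite_dimensional :: "('k::field \<Rightarrow> 'v::ab_group_add \<Rightarrow> 'v) \<Rightarrow> bool"
  where "finite_dimensional s \<longleftrightarrow> (\<exists>B. finite B \<and> Modules.module.span s B = UNIV)"

text \<open>Unlike \<open>dim V = n\<close>, this is false for infinite-dimensional \<open>V\<close> when \<open>n = 0\<close>.\<close>

definition has_dim :: "('k::field \<Rightarrow> 'v::ab_group_add \<Rightarrow> 'v) \<Rightarrow> 'v set \<Rightarrow> nat \<Rightarrow> bool"
  where "has_dim s V n \<longleftrightarrow>
    (\<exists>B. finite B \<and> \<not> Modules.module.dependent s B \<and> Modules.module.span s B = V \<and> card B = n)"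

definition subcoalgebra ::
    "('k::field \<Rightarrow> 'v::ab_group_add \<Rightarrow> 'v) \<Rightarrow> ('v \<Rightarrow> ('v \<times> 'v) multiset) \<Rightarrow> 'v set \<Rightarrow> bool"
  where "subcoalgebra s \<Delta> D \<longleftrightarrow>
    Modules.module.subspace s D \<and>
    (\<forall>d\<in>D. \<exists>t. set_mset t \<subseteq> D \<times> D \<and> tensor_eq s s (\<Delta> d) t)"

definition simple_subcoalgebra ::
    "('k::field \<Rightarrow> 'v::ab_group_add \<Rightarrow> 'v) \<Rightarrow> ('v \<Rightarrow> ('v \<times> 'v) multiset) \<Rightarrow> 'v set \<Rightarrow> bool"
  where "simple_subcoalgebra s \<Delta> D \<longleftrightarrow>
    subcoalgebra s \<Delta> D \<and> D \<noteq> {0} \<and>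
    (\<forall>E. subcoalgebra s \<Delta> E \<and> E \<subseteq> D \<longrightarrow> E = {0} \<or> E = D)"

definition coradical ::
    "('k::field \<Rightarrow> 'v::ab_group_add \<Rightarrow> 'v) \<Rightarrow> ('v \<Rightarrow> ('v \<times> 'v) multiset) \<Rightarrow> 'v set \<Rightarrow> 'v set"
  where "coradical s \<Delta> C = Modules.module.span s (\<Union>{D. simple_subcoalgebra s \<Delta> D \<and> D \<subseteq> C})"

definition cosemisimple ::
    "('k::field \<Rightarrow> 'v::ab_group_add \<Rightarrow> 'v) \<Rightarrow> ('v \<Rightarrow> ('v \<times> 'v) multiset) \<Rightarrow> bool"
  where "cosemisimple s \<Delta> \<longleftrightarrow> coradical s \<Delta> UNIV = UNIV"

definition primitives ::
    "('k::field \<Rightarrow> 'v::ab_group_add \<Rightarrow> 'v) \<Rightarrow> ('v \<Rightarrow> ('v \<times> 'v) multiset) \<Rightarrow> 'v set \<Rightarrow>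
      'v \<Rightarrow> 'v set"
  where "primitives s \<Delta> C e = {c \<in> C. tensor_eq s s (\<Delta> c) {#(c, e), (e, c)#}}"

text \<open>
  A one-dimensional coradical is spanned by a unique group-like element \<open>e\<close>, with respect to
  which the primitive elements are formed.
\<close>

definition thin ::
    "('k::field \<Rightarrow> 'v::ab_group_add \<Rightarrow> 'v) \<Rightarrow> ('v \<Rightarrow> ('v \<times> 'v) multiset) \<Rightarrow> ('v \<Rightarrow> 'k) \<Rightarrow>
      'v set \<Rightarrow> bool"
  where "thin s \<Delta> \<epsilon> C \<longleftrightarrow>
    has_dim s (coradical s \<Delta> C) 1 \<and>
    (\<exists>e\<in>C. grouplike s \<Delta> \<epsilon> e \<and> has_dim s (primitives s \<Delta> C e) 1)"


section \<open>The coalgebra of a bialgebra with a projection\<close>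

definition proj_tau ::
    "('a::ring_1 \<Rightarrow> ('a \<times> 'a) multiset) \<Rightarrow> ('h \<Rightarrow> 'h) \<Rightarrow> ('h \<Rightarrow> 'a) \<Rightarrow> ('a \<Rightarrow> 'h) \<Rightarrow> 'a \<Rightarrow> 'a"
  where "proj_tau \<Delta>A S \<sigma> \<pi> a = (\<Sum>(x, y)\<in>#\<Delta>A a. x * \<sigma> (S (\<pi> y)))"

definition proj_R ::
    "('k::field \<Rightarrow> 'a::ring_1 \<Rightarrow> 'a) \<Rightarrow> ('a \<Rightarrow> ('a \<times> 'a) multiset) \<Rightarrow>
      ('k \<Rightarrow> 'h::ring_1 \<Rightarrow> 'h) \<Rightarrow> ('a \<Rightarrow> 'h) \<Rightarrow> 'a set"
  where "proj_R sA \<Delta>A sH \<pi> =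
    {a. tensor_eq sA sH (image_mset (map_prod id \<pi>) (\<Delta>A a)) {#(a, 1)#}}"

definition proj_delta ::
    "('a::ring_1 \<Rightarrow> ('a \<times> 'a) multiset) \<Rightarrow> ('h \<Rightarrow> 'h) \<Rightarrow> ('h \<Rightarrow> 'a) \<Rightarrow> ('a \<Rightarrow> 'h) \<Rightarrow>
      'a \<Rightarrow> ('a \<times> 'a) multiset"
  where "proj_delta \<Delta>A S \<sigma> \<pi> r = image_mset (map_prod (proj_tau \<Delta>A S \<sigma> \<pi>) id) (\<Delta>A r)"


section \<open>Compatible data\<close>

definition primitive_root_of_unity :: "nat \<Rightarrow> 'k::field \<Rightarrow> bool"
  where "primitive_root_of_unity N q \<longleftrightarrow>
    N > 0 \<and> q ^ N = 1 \<and> (\<forall>m. 0 < m \<and> m < N \<longrightarrow> q ^ m \<noteq> 1)"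

definition algebra_character ::
    "('k::field \<Rightarrow> 'h::ring_1 \<Rightarrow> 'h) \<Rightarrow> ('h \<Rightarrow> 'k) \<Rightarrow> bool"
  where "algebra_character sH \<chi> \<longleftrightarrow>
    Vector_Spaces.linear sH (*) \<chi> \<and> (\<forall>x y. \<chi> (x * y) = \<chi> x * \<chi> y) \<and> \<chi> 1 = 1"

text \<open>The \<open>n\<close>-th power of \<open>\<chi>\<close> in the convolution algebra \<open>H\<^sup>*\<close>, whose unit is the counit.\<close>

primrec conv_power ::
    "('h \<Rightarrow> ('h \<times> 'h) multiset) \<Rightarrow> ('h \<Rightarrow> 'k::field) \<Rightarrow> ('h \<Rightarrow> 'k) \<Rightarrow> nat \<Rightarrow> 'h \<Rightarrow> 'k"
  where
    "conv_power \<Delta>H \<epsilon>H \<chi> 0 = \<epsilon>H"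
  | "conv_power \<Delta>H \<epsilon>H \<chi> (Suc n) =
      (\<lambda>h. \<Sum>(x, y)\<in>#\<Delta>H h. \<chi> x * conv_power \<Delta>H \<epsilon>H \<chi> n y)"

definition yetter_drinfeld_datum ::
    "('k::field \<Rightarrow> 'h::ring_1 \<Rightarrow> 'h) \<Rightarrow> ('h \<Rightarrow> ('h \<times> 'h) multiset) \<Rightarrow> ('h \<Rightarrow> 'k) \<Rightarrow>
      'k \<Rightarrow> 'h \<Rightarrow> ('h \<Rightarrow> 'k) \<Rightarrow> bool"
  where "yetter_drinfeld_datum sH \<Delta>H \<epsilon>H q g \<chi> \<longleftrightarrow>
    grouplike sH \<Delta>H \<epsilon>H g \<and> algebra_character sH \<chi> \<and> \<chi> g = q \<and>
    (\<forall>h. g * (\<Sum>(x, y)\<in>#\<Delta>H h. sH (\<chi> x) y) = (\<Sum>(x, y)\<in>#\<Delta>H h. sH (\<chi> y) x) * g)"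

definition compatible_datum ::
    "('k::field \<Rightarrow> 'h::ring_1 \<Rightarrow> 'h) \<Rightarrow> ('h \<Rightarrow> ('h \<times> 'h) multiset) \<Rightarrow> ('h \<Rightarrow> 'k) \<Rightarrow>
      ('h \<Rightarrow> 'h) \<Rightarrow> nat \<Rightarrow> 'k \<Rightarrow> 'h \<Rightarrow> ('h \<Rightarrow> 'k) \<Rightarrow> 'k \<Rightarrow> bool"
  where "compatible_datum sH \<Delta>H \<epsilon>H S N q g \<chi> l \<longleftrightarrow>
    yetter_drinfeld_datum sH \<Delta>H \<epsilon>H q g \<chi> \<and>
    (g ^ N = 1 \<or>
      (\<exists>h. sH (conv_power \<Delta>H \<epsilon>H \<chi> N h) (1 - g ^ N)
            \<noteq> (\<Sum>(x, y)\<in>#\<Delta>H h. x * (1 - g ^ N) * S y)) \<longrightarrow> l = 0)"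


section \<open>The Ore extension \<open>H[X, \<phi>\<^sub>H, 0]\<close>\<close>

text \<open>
  The polynomial with coefficients \<open>h\<^sub>0, h\<^sub>1, \<dots>\<close> represents \<open>\<Sum> X\<^sup>i h\<^sub>i\<close>, with coefficients on the
  right of the powers of \<open>X\<close>. From \<open>h X = X \<phi>(h)\<close> one gets
  \<open>(X\<^sup>i h)(X\<^sup>j k) = X\<^sup>i\<^sup>+\<^sup>j \<phi>\<^sup>j(h) k\<close>.
\<close>

definition ore_phi ::
    "('k::field \<Rightarrow> 'h::ring_1 \<Rightarrow> 'h) \<Rightarrow> ('h \<Rightarrow> ('h \<times> 'h) multiset) \<Rightarrow> ('h \<Rightarrow> 'k) \<Rightarrow> 'h \<Rightarrow> 'h"
  where "ore_phi sH \<Delta>H \<chi> h = (\<Sum>(x, y)\<in>#\<Delta>H h. sH (\<chi> x) y)"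

definition ore_mult :: "('h::ring_1 \<Rightarrow> 'h) \<Rightarrow> 'h poly \<Rightarrow> 'h poly \<Rightarrow> 'h poly"
  where "ore_mult \<phi> p r =
    (\<Sum>i\<le>Polynomial.degree p. \<Sum>j\<le>Polynomial.degree r.
      Polynomial.monom ((\<phi> ^^ j) (Polynomial.coeff p i) * Polynomial.coeff r j) (i + j))"

definition ore_const :: "'h::ring_1 \<Rightarrow> 'h poly"
  where "ore_const h = Polynomial.monom h 0"

definition ore_X :: "'h::ring_1 poly"
  where "ore_X = Polynomial.monom 1 1"

definition ore_ring :: "('h::ring_1 \<Rightarrow> 'h) \<Rightarrow> 'h poly ring"
  where "ore_ring \<phi> =
    \<lparr>carrier = UNIV, monoid.mult = ore_mult \<phi>, one = ore_const 1, ring.zero = 0, add = (+)\<rparr>"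

text \<open>
  The algebra map with \<open>\<Delta>(X) = X \<otimes> 1 + g \<otimes> X\<close> that extends the comultiplication of \<open>H\<close>:
  \<open>\<Delta>(\<Sum> X\<^sup>i h\<^sub>i) = \<Sum> (X \<otimes> 1 + g \<otimes> X)\<^sup>i \<Delta>(h\<^sub>i)\<close>.
\<close>

definition ore_comult ::
    "('h::ring_1 \<Rightarrow> ('h \<times> 'h) multiset) \<Rightarrow> ('h \<Rightarrow> 'h) \<Rightarrow> 'h \<Rightarrow>
      'h poly \<Rightarrow> ('h poly \<times> 'h poly) multiset"
  where "ore_comult \<Delta>H \<phi> g p =
    (\<Sum>i\<le>Polynomial.degree p.
      (tensor_mult (ore_mult \<phi>) {#(ore_X, ore_const 1), (ore_const g, ore_X)#} ^^ i)
        (image_mset (map_prod ore_const ore_const) (\<Delta>H (Polynomial.coeff p i))))"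

text \<open>The algebra map with \<open>\<epsilon>(X) = 0\<close> that extends the counit of \<open>H\<close>.\<close>

definition ore_counit :: "('h::ring_1 \<Rightarrow> 'k) \<Rightarrow> 'h poly \<Rightarrow> 'k"
  where "ore_counit \<epsilon>H p = \<epsilon>H (Polynomial.coeff p 0)"


section \<open>The Hopf algebra \<open>\<O>(H, g, \<chi>, \<lambda>)\<close>\<close>

record ('k, 'b) bialgebra_struct = "'b ring" +
  scal :: "'k \<Rightarrow> 'b \<Rightarrow> 'b"
  comul :: "'b \<Rightarrow> ('b \<times> 'b) multiset"
  couni :: "'b \<Rightarrow> 'k"

definition O_ideal ::
    "('k::field \<Rightarrow> 'h::ring_1 \<Rightarrow> 'h) \<Rightarrow> ('h \<Rightarrow> ('h \<times> 'h) multiset) \<Rightarrow>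
      nat \<Rightarrow> 'h \<Rightarrow> ('h \<Rightarrow> 'k) \<Rightarrow> 'k \<Rightarrow> 'h poly set"
  where "O_ideal sH \<Delta>H N g \<chi> l =
    (let R = ore_ring (ore_phi sH \<Delta>H \<chi>)
     in Idl\<^bsub>R\<^esub> {ore_X [^]\<^bsub>R\<^esub> N - ore_const (sH l (1 - g ^ N))})"

definition O_class ::
    "('k::field \<Rightarrow> 'h::ring_1 \<Rightarrow> 'h) \<Rightarrow> ('h \<Rightarrow> ('h \<times> 'h) multiset) \<Rightarrow>
      nat \<Rightarrow> 'h \<Rightarrow> ('h \<Rightarrow> 'k) \<Rightarrow> 'k \<Rightarrow> 'h poly \<Rightarrow> 'h poly set"
  where "O_class sH \<Delta>H N g \<chi> l p =
    O_ideal sH \<Delta>H N g \<chi> l +>\<^bsub>ore_ring (ore_phi sH \<Delta>H \<chi>)\<^esub> p"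

text \<open>
  The elements of the quotient are the cosets of the ideal. The coalgebra operations and the
  scalar multiplication are computed on an arbitrary element of a coset; for a compatible datum
  the ideal is a coideal, so the resulting tensor does not depend on that element.
\<close>

definition O_bialgebra ::
    "('k::field \<Rightarrow> 'h::ring_1 \<Rightarrow> 'h) \<Rightarrow> ('h \<Rightarrow> ('h \<times> 'h) multiset) \<Rightarrow> ('h \<Rightarrow> 'k) \<Rightarrow>
      nat \<Rightarrow> 'h \<Rightarrow> ('h \<Rightarrow> 'k) \<Rightarrow> 'k \<Rightarrow> ('k, 'h poly set) bialgebra_struct"
  where "O_bialgebra sH \<Delta>H \<epsilon>H N g \<chi> l =
    (let \<phi> = ore_phi sH \<Delta>H \<chi>;
         cls = O_class sH \<Delta>H N g \<chi> l;
         rep = (\<lambda>C. SOME p. p \<in> C)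
     in ring.extend (ore_ring \<phi> Quot O_ideal sH \<Delta>H N g \<chi> l)
          (bialgebra_struct.fields
            (\<lambda>c C. cls (map_poly (sH c) (rep C)))
            (\<lambda>C. image_mset (map_prod cls cls) (ore_comult \<Delta>H \<phi> g (rep C)))
            (\<lambda>C. ore_counit \<epsilon>H (rep C))))"

definition O_sigma ::
    "('k::field \<Rightarrow> 'h::ring_1 \<Rightarrow> 'h) \<Rightarrow> ('h \<Rightarrow> ('h \<times> 'h) multiset) \<Rightarrow>
      nat \<Rightarrow> 'h \<Rightarrow> ('h \<Rightarrow> 'k) \<Rightarrow> 'k \<Rightarrow> 'h \<Rightarrow> 'h poly set"
  where "O_sigma sH \<Delta>H N g \<chi> l h = O_class sH \<Delta>H N g \<chi> l (ore_const h)"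

text \<open>
  Isomorphisms from a structure given by a carrier set onto a bialgebra that lives on a whole type.
\<close>

definition bialgebra_iso ::
    "('k::field, 'b) bialgebra_struct \<Rightarrow>
      ('k \<Rightarrow> 'a::ring_1 \<Rightarrow> 'a) \<Rightarrow> ('a \<Rightarrow> ('a \<times> 'a) multiset) \<Rightarrow> ('a \<Rightarrow> 'k) \<Rightarrow>
      ('b \<Rightarrow> 'a) \<Rightarrow> bool"
  where "bialgebra_iso B sA \<Delta>A \<epsilon>A f \<longleftrightarrow>
    f \<in> ring_iso B ring_of_type_algebra \<and>
    (\<forall>c. \<forall>x\<in>carrier B. f (scal B c x) = sA c (f x)) \<and>
    (\<forall>x\<in>carrier B. tensor_eq sA sA (\<Delta>A (f x)) (image_mset (map_prod f f) (comul B x))) \<and>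
    (\<forall>x\<in>carrier B. \<epsilon>A (f x) = couni B x)"

end

theory Submission
  imports Defs "HOL-Computational_Algebra.Formal_Power_Series"
begin

text \<open>
  Let \<open>R\<close> be the space of coinvariants of \<open>A\<close>. Multiplication is a bijection from \<open>R \<otimes> H\<close> onto \<open>A\<close>, and
  \<open>a = \<Sum> \<tau>(a\<^sub>1) \<sigma>(\<pi>(a\<^sub>2))\<close> is the corresponding decomposition. The primitive elements of \<open>R\<close> form a line
  \<open>K y\<close> that is stable under the coaction and the adjoint action of \<open>H\<close>. So \<open>H\<close> coacts on it by a
  group-like element \<open>g\<close> and acts by a character \<open>\<chi>\<close>, which means that
  \<open>\<Delta>(y) = y \<otimes> 1 + \<sigma>(g) \<otimes> y\<close> and \<open>\<sigma>(h) y = \<Sum> \<chi>(h\<^sub>1) y \<sigma>(h\<^sub>2)\<close>. These are the relations of the Ore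
  extension, and \<open>X \<mapsto> y\<close> defines a bialgebra map from it to \<open>A\<close>. It remains to see that
  \<open>q = \<chi>(g)\<close> is a primitive \<open>N\<close>-th root of unity, that \<open>y\<^sup>N = \<lambda> (1 - g\<^sup>N)\<close>, and that \<open>1, y, \<dots>, y\<^sup>N\<^sup>-\<^sup>1\<close> is a
  basis of \<open>A\<close> over \<open>H\<close>.

  The main tool is the operator \<open>D(a) = \<Sum> T(a\<^sub>1) a\<^sub>2\<close> for a functional \<open>T\<close> with \<open>T(1) = 0\<close>, \<open>T(y) = 1\<close> and
  \<open>T(a \<sigma>(h)) = T(a) \<epsilon>(h)\<close>. It commutes with right multiplication by \<open>H\<close> and preserves \<open>R\<close>. Because \<open>R\<close> is
  thin, \<open>D\<close> acts on \<open>R\<close> as a single nilpotent Jordan block (\<open>divided_power_basis\<close>). Indeed every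
  nonzero right coideal of \<open>R\<close> contains \<open>1\<close> (\<open>coideal_contains_e\<close>); if the kernel of \<open>D\<close> were larger
  than \<open>K 1\<close>, this coideal would contain a primitive element outside \<open>K y\<close>, and if \<open>D\<close> were not
  nilpotent, it would be onto a nonzero coideal, where \<open>1\<close> would have iterated preimages of every
  order. It follows that \<open>D\<^sup>N = 0\<close> on \<open>A\<close> and that the kernel of \<open>D\<close> is \<open>\<sigma>(H)\<close>.

  On the powers of \<open>y\<close> the operator \<open>D\<close> acts like a \<open>q\<close>-derivative: \<open>D\<^sup>m(y\<^sup>m) = (m)\<^sub>q!\<close>. Since \<open>D\<^sup>N = 0\<close>
  and the characteristic is zero, \<open>q\<close> is a root of unity of some order \<open>n\<close> with \<open>2 \<le> n \<le> N\<close>. Now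
  \<open>D(y\<^sup>n)\<close> is a scalar, and conjugation by \<open>g\<close> shows that it is zero, so \<open>y\<^sup>n\<close> lies in \<open>\<sigma>(H)\<close>. There it
  is a skew-primitive element commuting with \<open>g\<close>, and in a Hopf algebra that is finite-dimensional
  over a field of characteristic zero or cosemisimple such an element is a multiple of \<open>1 - g\<^sup>n\<close>
  (\<open>skew_primitive_trivial\<close>).

  Finally \<open>n = N\<close> (\<open>n_eq_N\<close>). The kernels of the powers of \<open>D\<close> form a multiplicative filtration of \<open>A\<close>,
  and on leading terms \<open>D\<close> is a derivation twisted by the coaction. If \<open>n < N\<close>, there is an element
  \<open>z\<close> of \<open>R\<close> with \<open>D\<^sup>n(z) = 1\<close>. The mixed terms of the Leibniz rule for \<open>D\<^sup>n\<close> have Gaussian binomial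
  coefficients that vanish because \<open>q\<close> has order \<open>n\<close>, so \<open>D\<^sup>n\<close> acts on the powers of \<open>z\<close> like an ordinary
  derivation and \<open>D\<^sup>n\<^sup>s(z\<^sup>s) = s!\<close> for every \<open>s\<close>, against the nilpotency of \<open>D\<close>. With \<open>n = N\<close> the
  derivatives \<open>D\<^sup>m(y\<^sup>m) = (m)\<^sub>q! \<noteq> 0\<close> for \<open>m < N\<close> show that the powers of \<open>y\<close> are a basis over \<open>H\<close>, and
  division with remainder by \<open>X\<^sup>N - \<lambda> (1 - g\<^sup>N)\<close> identifies the kernel of \<open>X \<mapsto> y\<close>.
\<close>

section \<open>Linear maps and sums over tensors\<close>

text \<open>
  Linearity without the vector space axioms, so that the closure rules below have few premises.
  Functionals are the case \<open>s2 = (*)\<close>.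
\<close>

definition lin ::
    "('k \<Rightarrow> 'v::ab_group_add \<Rightarrow> 'v) \<Rightarrow> ('k \<Rightarrow> 'w::ab_group_add \<Rightarrow> 'w) \<Rightarrow> ('v \<Rightarrow> 'w) \<Rightarrow> bool"
  where "lin s1 s2 f \<longleftrightarrow> (\<forall>x y. f (x + y) = f x + f y) \<and> (\<forall>c x. f (s1 c x) = s2 c (f x))"

definition bilin ::
    "('k \<Rightarrow> 'v::ab_group_add \<Rightarrow> 'v) \<Rightarrow> ('k \<Rightarrow> 'w::ab_group_add \<Rightarrow> 'w) \<Rightarrow>
      ('k \<Rightarrow> 'u::ab_group_add \<Rightarrow> 'u) \<Rightarrow> ('v \<Rightarrow> 'w \<Rightarrow> 'u) \<Rightarrow> bool"
  where "bilin s1 s2 s3 F \<longleftrightarrow> (\<forall>y. lin s1 s3 (\<lambda>x. F x y)) \<and> (\<forall>x. lin s2 s3 (F x))"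

text \<open>
  For bilinear \<open>F\<close> this is the linear map on the tensor product that \<open>F\<close> induces. All Sweedler sums
  are written in this form.
\<close>

definition tsum :: "('v \<times> 'w) multiset \<Rightarrow> ('v \<Rightarrow> 'w \<Rightarrow> 'u::ab_group_add) \<Rightarrow> 'u"
  where "tsum t F = (\<Sum>(x, y)\<in>#t. F x y)"

lemma lin_add: "lin s1 s2 f \<Longrightarrow> f (x + y) = f x + f y"
  and lin_scale: "lin s1 s2 f \<Longrightarrow> f (s1 c x) = s2 c (f x)"
  by (auto simp: lin_def)

lemma linI:
  "(\<And>x y. f (x + y) = f x + f y) \<Longrightarrow> (\<And>c x. f (s1 c x) = s2 c (f x)) \<Longrightarrow> lin s1 s2 f"
  by (auto simp: lin_def)

lemma lin_zero: "lin s1 s2 f \<Longrightarrow> f 0 = 0"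
  by (metis add_cancel_right_left lin_add)

lemma lin_minus: "lin s1 s2 f \<Longrightarrow> f (- x) = - f x"
  using lin_add[of s1 s2 f x "- x"] lin_zero[of s1 s2 f] by (simp add: eq_neg_iff_add_eq_0 add.commute)

lemma lin_diff: "lin s1 s2 f \<Longrightarrow> f (x - y) = f x - f y"
  using lin_add[of s1 s2 f x "- y"] by (simp add: lin_minus)

lemma lin_sum: "lin s1 s2 f \<Longrightarrow> f (sum g A) = (\<Sum>x\<in>A. f (g x))"
  by (induction A rule: infinite_finite_induct) (auto simp: lin_zero lin_add)

lemma lin_tsum_arg: "lin s1 s2 f \<Longrightarrow> f (tsum t G) = tsum t (\<lambda>x y. f (G x y))"
  by (induction t) (auto simp: tsum_def lin_zero lin_add)

lemma lin_iff_linear: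
  "vector_space s1 \<Longrightarrow> vector_space s2 \<Longrightarrow> Vector_Spaces.linear s1 s2 f \<longleftrightarrow> lin s1 s2 f"
  by (auto simp: lin_def Vector_Spaces.linear_def module_hom_def module_hom_axioms_def
      vector_space_def Modules.module_def)

lemma vector_space_mult: "vector_space ((*) :: 'k::field \<Rightarrow> 'k \<Rightarrow> 'k)"
  by unfold_locales (auto simp: algebra_simps)

lemma bilinI [intro?]:
  "(\<And>y. lin s1 s3 (\<lambda>x. F x y)) \<Longrightarrow> (\<And>x. lin s2 s3 (\<lambda>y. F x y)) \<Longrightarrow> bilin s1 s2 s3 F"
  by (auto simp: bilin_def)

lemma bilin1: "bilin s1 s2 s3 F \<Longrightarrow> lin s1 s3 (\<lambda>x. F x y)"
  and bilin2: "bilin s1 s2 s3 F \<Longrightarrow> lin s2 s3 (\<lambda>y. F x y)"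
  by (auto simp: bilin_def)

lemma lin_compose: "lin s2 s3 f \<Longrightarrow> lin s1 s2 g \<Longrightarrow> lin s1 s3 (\<lambda>x. f (g x))"
  by (auto simp: lin_def)

lemma tsum_add [simp]: "tsum (t + u) F = tsum t F + tsum u F"
  and tsum_empty [simp]: "tsum {#} F = 0"
  and tsum_single [simp]: "tsum {#(x, y)#} F = F x y"
  and tsum_insert [simp]: "tsum (add_mset (x, y) t) F = F x y + tsum t F"
  by (auto simp: tsum_def)

lemma tsum_map: "tsum (image_mset (map_prod f g) t) F = tsum t (\<lambda>x y. F (f x) (g y))"
  by (simp add: tsum_def image_mset.compositionality case_prod_unfold o_def)

lemma tsum_plus: "tsum t (\<lambda>x y. F x y + G x y) = tsum t F + tsum t G"
  by (induction t) (auto simp: algebra_simps)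

lemma tsum_zero [simp]: "tsum t (\<lambda>x y. 0) = 0"
  by (induction t) auto

lemma tsum_minus: "tsum t (\<lambda>x y. F x y - G x y) = tsum t F - tsum t G"
  by (induction t) (auto simp: algebra_simps)

lemma tsum_sum: "tsum t (\<lambda>x y. \<Sum>i\<in>I. F i x y) = (\<Sum>i\<in>I. tsum t (F i))"
  by (induction I rule: infinite_finite_induct) (auto simp: tsum_plus)

lemma tsum_cong: "(\<And>x y. (x, y) \<in># t \<Longrightarrow> F x y = G x y) \<Longrightarrow> tsum t F = tsum t G"
  by (induction t) auto

lemma tsum_in:
  "Modules.module.subspace s W \<Longrightarrow> Modules.module s \<Longrightarrow> (\<And>x y. (x, y) \<in># t \<Longrightarrow> F x y \<in> W) \<Longrightarrow> tsum t F \<in> W"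
  by (induction t) (auto simp: Modules.module.subspace_add Modules.module.subspace_0)

lemma tsum_swap: "tsum t (\<lambda>x y. tsum u (F x y)) = tsum u (\<lambda>a b. tsum t (\<lambda>x y. F x y a b))"
  by (induction u) (auto simp: tsum_plus)

text \<open>The rules collected here reduce the linearity of a composite term to that of its constituents.\<close>

named_theorems lin_rules

lemma lin_const_zero [lin_rules]: "vector_space s2 \<Longrightarrow> lin s1 s2 (\<lambda>x. 0)"
  by (auto simp: lin_def Modules.module.scale_zero_right Modules.module_def vector_space_def)

lemma lin_id [lin_rules]: "lin s s (\<lambda>x. x)"
  by (auto simp: lin_def)

lemma lin_plus [lin_rules]:
  "vector_space s2 \<Longrightarrow> lin s1 s2 f \<Longrightarrow> lin s1 s2 g \<Longrightarrow> lin s1 s2 (\<lambda>x. f x + g x)"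
  by (auto simp: lin_def vector_space.vector_space_assms)

lemma lin_scale_const [lin_rules]:
  "vector_space s2 \<Longrightarrow> lin s1 s2 f \<Longrightarrow> lin s1 s2 (\<lambda>x. s2 c (f x))"
  by (auto simp: lin_def vector_space.vector_space_assms mult.commute)

lemma lin_scale_by [lin_rules]:
  "vector_space s2 \<Longrightarrow> lin s1 (*) f \<Longrightarrow> lin s1 s2 (\<lambda>x. s2 (f x) v)"
  by (auto simp: lin_def vector_space.vector_space_assms)

lemma lin_mult_const [lin_rules]:
  "lin s1 (*) f \<Longrightarrow> lin s1 (*) (\<lambda>x. f x * (c::'k::field))"
  by (auto simp: lin_def algebra_simps)

lemma lin_const_mult [lin_rules]:
  "lin s1 (*) f \<Longrightarrow> lin s1 (*) (\<lambda>x. (c::'k::field) * f x)"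
  by (auto simp: lin_def algebra_simps)

lemma lin_tsum [lin_rules]:
  assumes "vector_space s2" "\<And>x y. lin s1 s2 (\<lambda>v. F v x y)"
  shows "lin s1 s2 (\<lambda>v. tsum t (F v))"
proof (induction t)
  case empty
  then show ?case using lin_const_zero[OF assms(1)] by simp
next
  case (add p t)
  show ?case using lin_plus[OF assms(1) assms(2) add, of "fst p" "snd p"]
    by (cases p) simp
qed

lemma lin_setsum [lin_rules]:
  assumes "vector_space s2" "\<And>i. lin s1 s2 (\<lambda>v. F v i)"
  shows "lin s1 s2 (\<lambda>v. \<Sum>i\<in>I. F v i)"
  by (induction I rule: infinite_finite_induct)
    (use assms in \<open>auto intro: lin_const_zero lin_plus\<close>)

lemma tensor_eq_tsum:
  assumes "tensor_eq s1 s2 t u" "bilin s1 s2 s3 F"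
  shows "tsum t F = tsum u F"
  using assms(1) unfolding tensor_eq_def
proof (induction rule: multiset_cong.induct)
  case (base t u)
  then show ?case
  proof cases
    case (add_left x x' y)
    then show ?thesis using lin_add[OF bilin1[OF assms(2)]] by simp
  next
    case (add_right x y y')
    then show ?thesis using lin_add[OF bilin2[OF assms(2)]] by simp
  next
    case (zero_left y)
    then show ?thesis using lin_zero[OF bilin1[OF assms(2)]] by simp
  next
    case (scale c x y)
    then show ?thesis
      using lin_scale[OF bilin2[OF assms(2)]] lin_scale[OF bilin1[OF assms(2)]] by simp
  qed
qed auto

lemma tensor_eq_refl: "tensor_eq s1 s2 t t"
  and tensor_eq_sym: "tensor_eq s1 s2 t u \<Longrightarrow> tensor_eq s1 s2 u t"
  and tensor_eq_trans: "tensor_eq s1 s2 t u \<Longrightarrow> tensor_eq s1 s2 u v \<Longrightarrow> tensor_eq s1 s2 t v"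
  and tensor_eq_add:
    "tensor_eq s1 s2 t u \<Longrightarrow> tensor_eq s1 s2 t' u' \<Longrightarrow> tensor_eq s1 s2 (t + t') (u + u')"
  unfolding tensor_eq_def by (auto intro: multiset_cong.intros)

lemma tensor_eq_base: "tensor_rel s1 s2 t u \<Longrightarrow> tensor_eq s1 s2 t u"
  unfolding tensor_eq_def by (auto intro: multiset_cong.intros)

text \<open>
  One step of the expansion of a tensor along a basis of the first factor.
\<close>

lemma tensor_eq_scaled_sum:
  assumes "vector_space s1"
  shows "finite S \<Longrightarrow>
    tensor_eq s1 s2 {#(\<Sum>b\<in>S. s1 (f b) b, y)#} (\<Sum>b\<in>S. {#(b, s2 (f b) y)#})"
proof (induction S rule: finite_induct)
  case empty
  show ?case by (simp add: tensor_eq_base tensor_rel.zero_left)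
next
  case (insert b S)
  have "tensor_eq s1 s2 {#(s1 (f b) b + (\<Sum>b\<in>S. s1 (f b) b), y)#}
      ({#(s1 (f b) b, y)#} + {#(\<Sum>b\<in>S. s1 (f b) b, y)#})"
    using tensor_eq_base[OF tensor_rel.add_left[of s1 s2 "s1 (f b) b" "\<Sum>b\<in>S. s1 (f b) b" y]]
    by (simp add: add_mset_commute)
  also have "tensor_eq s1 s2 \<dots> ({#(b, s2 (f b) y)#} + (\<Sum>b\<in>S. {#(b, s2 (f b) y)#}))"
    by (intro tensor_eq_add insert tensor_eq_base tensor_rel.scale)
  finally (tensor_eq_trans) show ?case using insert by simp
qed

text \<open>
  Expanding the first factors in a basis brings a tensor into a normal form whose second factors
  are determined by the values on products of functionals. Hence the functionals on both factors
  separate tensors, and it is enough to compare sums of scalars.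
\<close>

lemma tensor_eqI:
  fixes s1 :: "'k::field \<Rightarrow> 'v::ab_group_add \<Rightarrow> 'v" and s2 :: "'k \<Rightarrow> 'w::ab_group_add \<Rightarrow> 'w"
  assumes v1: "vector_space s1" and v2: "vector_space s2"
    and eq: "\<And>f g. lin s1 (*) f \<Longrightarrow> lin s2 (*) g \<Longrightarrow>
      tsum t (\<lambda>x y. f x * g y) = tsum u (\<lambda>x y. f x * g y)"
  shows "tensor_eq s1 s2 t u"
proof -
  interpret V: vector_space s1 by fact
  interpret W: vector_space s2 by fact
  interpret W1: vector_space_pair s2 "(*) :: 'k \<Rightarrow> 'k \<Rightarrow> 'k"
    by (simp add: vector_space_pair_def v2 vector_space_mult)
  obtain B where B: "V.independent B" "V.span B = UNIV"
    by (metis V.independent_empty V.maximal_independent_subset_extend V.span_UNIV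
        V.span_eq top_greatest)
  define firsts where "firsts = fst ` (set_mset t \<union> set_mset u)"
  define S where "S = (\<Union>x\<in>firsts. {b. V.representation B x b \<noteq> 0})"
  have finS: "finite S"
    unfolding S_def firsts_def by (auto intro: V.finite_representation)
  have SB: "S \<subseteq> B"
    unfolding S_def by (auto intro: V.representation_ne_zero)
  have expand: "(\<Sum>b\<in>S. s1 (V.representation B x b) b) = x" if "x \<in> firsts" for x
  proof -
    have "(\<Sum>b\<in>S. s1 (V.representation B x b) b)
        = (\<Sum>b | V.representation B x b \<noteq> 0. s1 (V.representation B x b) b)"
      using that finS by (intro sum.mono_neutral_right) (auto simp: S_def)
    also have "\<dots> = x" using B by (intro V.sum_nonzero_representation_eq) auto
    finally show ?thesis .
  qed
  define w where "w v b = tsum v (\<lambda>x y. s2 (V.representation B x b) y)" for v :: "('v \<times> 'w) multiset" and b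
  have nf: "tensor_eq s1 s2 v (\<Sum>b\<in>S. {#(b, w v b)#})" if "fst ` set_mset v \<subseteq> firsts" for v
    using that
  proof (induction v)
    case empty
    have "tensor_eq s1 s2 {#} (\<Sum>b\<in>S. {#(b, 0)#})" using finS
    proof (induction S rule: finite_induct)
      case (insert b S)
      have "tensor_eq s1 s2 {#(0, 0)#} {#(b, 0)#}"
        using tensor_eq_base[OF tensor_rel.scale[of s1 s2 0 b 0]] by simp
      from tensor_eq_trans[OF tensor_eq_sym[OF tensor_eq_base[OF tensor_rel.zero_left]] this]
      show ?case using insert.hyps tensor_eq_add[OF _ insert.IH] by fastforce
    qed (simp add: tensor_eq_refl)
    then show ?case by (simp add: w_def)
  next
    case (add p v)
    obtain x y where p: "p = (x, y)" by force
    have x: "x \<in> firsts" using add.prems p by auto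
    have "tensor_eq s1 s2 (add_mset p v)
        ((\<Sum>b\<in>S. {#(b, s2 (V.representation B x b) y)#}) + (\<Sum>b\<in>S. {#(b, w v b)#}))"
      using tensor_eq_add[OF tensor_eq_scaled_sum[OF v1 finS, of s2 "V.representation B x" y]
          add.IH] add.prems expand[OF x] by (simp add: p)
    also have "tensor_eq s1 s2 \<dots> (\<Sum>b\<in>S. {#(b, w (add_mset p v) b)#})"
      using finS
    proof (induction S rule: finite_induct)
      case (insert b S)
      have 1: "tensor_eq s1 s2 ({#(b, s2 (V.representation B x b) y)#} + {#(b, w v b)#})
          {#(b, w (add_mset p v) b)#}"
        unfolding w_def p using tensor_rel.add_right[of s1 s2 b]
        by (auto intro!: tensor_eq_sym[OF tensor_eq_base] simp: add_mset_commute)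
      show ?case using tensor_eq_add[OF 1 insert.IH] insert.hyps
        by (simp add: ac_simps)
    qed (simp add: tensor_eq_refl)
    finally (tensor_eq_trans) show ?case .
  qed
  have "w t b = w u b" for b
  proof (rule ccontr)
    assume "w t b \<noteq> w u b"
    then have "W.independent {w t b - w u b}" by simp
    then obtain g where g: "Vector_Spaces.linear s2 (*) g" "g (w t b - w u b) = 1"
      using W1.linear_independent_extend[of "{w t b - w u b}" "\<lambda>_. 1"] by auto
    have g': "lin s2 (*) g" using g(1) lin_iff_linear[OF v2 vector_space_mult] by blast
    have f': "lin s1 (*) (\<lambda>x. V.representation B x b)"
      by (intro linI) (use B in \<open>auto simp: V.representation_add V.representation_scale\<close>)
    have "g (w v b) = tsum v (\<lambda>x y. V.representation B x b * g y)" for v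
      unfolding w_def lin_tsum_arg[OF g'] lin_scale[OF g'] ..
    then have "g (w t b) = g (w u b)" using eq[OF f' g'] by simp
    then show False using g(2) lin_diff[OF g'] by simp
  qed
  then have "(\<Sum>b\<in>S. {#(b, w t b)#}) = (\<Sum>b\<in>S. {#(b, w u b)#})" by simp
  then show ?thesis using nf[of t] nf[of u]
    by (metis (no_types, lifting) firsts_def image_mono set_mset_union sup_ge1 sup_ge2 tensor_eq_sym
        tensor_eq_trans)
qed

lemma separating_functional:
  fixes s :: "'k::field \<Rightarrow> 'v::ab_group_add \<Rightarrow> 'v"
  assumes v: "vector_space s" and W: "Modules.module.subspace s W" and x: "x \<notin> W"
  obtains f where "lin s (*) f" "f x = 1" "\<And>w. w \<in> W \<Longrightarrow> f w = 0"
proof -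
  interpret V: vector_space s by fact
  interpret P: vector_space_pair s "(*) :: 'k \<Rightarrow> 'k \<Rightarrow> 'k"
    by (simp add: vector_space_pair_def v vector_space_mult)
  obtain B where B: "B \<subseteq> W" "V.independent B" "W \<subseteq> V.span B"
    using V.maximal_independent_subset by blast
  have "V.span B \<subseteq> W" using B(1) W by (simp add: V.span_minimal)
  then have "x \<notin> V.span B" using x by blast
  then have "V.independent (insert x B)" using B(2) by (simp add: V.independent_insert)
  then obtain f where f: "Vector_Spaces.linear s (*) f"
      "\<forall>z\<in>insert x B. f z = (if z = x then 1 else 0)"
    using P.linear_independent_extend[of "insert x B" "\<lambda>z. if z = x then 1 else 0"] by blast
  have l: "lin s (*) f" using f(1) lin_iff_linear[OF v vector_space_mult] by blast
  interpret f: Vector_Spaces.linear s "(*)" f by fact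
  have "f w = 0" if "w \<in> W" for w
  proof -
    have "w \<in> V.span B" using that B(3) by blast
    then show ?thesis
    proof (induction rule: V.span_induct_alt)
      case (step c z w)
      have "z \<noteq> x" using step.hyps B(1) x by blast
      then show ?case using f(2) step by (simp add: lin_add[OF l] lin_scale[OF l])
    qed (simp add: lin_zero[OF l])
  qed
  then show ?thesis using that[OF l] f(2) by auto
qed

lemma eq_by_functionals:
  fixes s :: "'k::field \<Rightarrow> 'v::ab_group_add \<Rightarrow> 'v"
  assumes v: "vector_space s" and eq: "\<And>f. lin s (*) f \<Longrightarrow> f x = f y"
  shows "x = y"
proof (rule ccontr)
  interpret V: vector_space s by fact
  assume "x \<noteq> y"
  then have "x - y \<notin> {0}" by simp
  then obtain f where f: "lin s (*) f" "f (x - y) = 1"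
    by (rule separating_functional[OF v V.subspace_single_0])
  show False using eq[OF f(1)] f(2) lin_diff[OF f(1)] by simp
qed

lemma coordinate_functional:
  fixes s :: "'k::field \<Rightarrow> 'v::ab_group_add \<Rightarrow> 'v"
  assumes v: "vector_space s" and T: "\<not> Modules.module.dependent s T"
  shows "\<exists>p. lin s (*) p \<and> (\<forall>z\<in>T. p z = (if z = w then 1 else 0))"
proof -
  interpret P: vector_space_pair s "(*) :: 'k \<Rightarrow> 'k \<Rightarrow> 'k"
    by (simp add: vector_space_pair_def v vector_space_mult)
  show ?thesis
    using P.linear_independent_extend[OF T, of "\<lambda>z. if z = w then 1 else 0"]
      lin_iff_linear[OF v vector_space_mult] by blast
qed

lemma projection_onto:
  fixes s :: "'k::field \<Rightarrow> 'v::ab_group_add \<Rightarrow> 'v"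
  assumes v: "vector_space s" and W: "Modules.module.subspace s W" and U: "Modules.module.subspace s U"
    and WU: "W \<inter> U \<subseteq> {0}"
  obtains p where "lin s s p" "\<And>x. p x \<in> W" "\<And>x. x \<in> W \<Longrightarrow> p x = x" "\<And>x. x \<in> U \<Longrightarrow> p x = 0"
proof -
  interpret V: vector_space s by fact
  interpret P: vector_space_pair s s by (simp add: vector_space_pair_def v)
  obtain B where B: "B \<subseteq> W" "V.independent B" "W \<subseteq> V.span B"
    using V.maximal_independent_subset by blast
  obtain E where E: "E \<subseteq> U" "V.independent E" "U \<subseteq> V.span E"
    using V.maximal_independent_subset by blast
  have BW: "V.span B = W" and EU: "V.span E = U"
    using B E W U V.span_minimal by blast+
  have disj: "B \<inter> E = {}"
    using B E WU V.dependent_zero by blast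
  have "V.independent (B \<union> E)"
    unfolding V.independent_explicit_module
  proof (intro allI impI ballI)
    fix t c x
    assume t: "finite t" "t \<subseteq> B \<union> E" "(\<Sum>v\<in>t. s (c v) v) = 0" "x \<in> t"
    have "(\<Sum>v\<in>t. s (c v) v) = (\<Sum>v\<in>t \<inter> B. s (c v) v) + (\<Sum>v\<in>t \<inter> E. s (c v) v)"
      using t(1,2) disj
      by (subst sum.union_disjoint[symmetric]) (auto intro!: sum.cong)
    then have eq: "(\<Sum>v\<in>t \<inter> B. s (c v) v) = - (\<Sum>v\<in>t \<inter> E. s (c v) v)"
      using t(3) by (simp add: eq_neg_iff_add_eq_0)
    moreover have 1: "(\<Sum>v\<in>t \<inter> B. s (c v) v) \<in> W"
      unfolding BW[symmetric] by (intro V.span_sum V.span_scale V.span_base) auto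
    moreover have 2: "(\<Sum>v\<in>t \<inter> E. s (c v) v) \<in> U"
      unfolding EU[symmetric] by (intro V.span_sum V.span_scale V.span_base) auto
    ultimately have "(\<Sum>v\<in>t \<inter> B. s (c v) v) \<in> W \<inter> U" using U V.subspace_neg by auto
    then have "(\<Sum>v\<in>t \<inter> B. s (c v) v) = 0" using WU by blast
    then have zero: "(\<Sum>v\<in>t \<inter> B. s (c v) v) = 0" "(\<Sum>v\<in>t \<inter> E. s (c v) v) = 0"
      using eq by auto
    show "c x = 0"
    proof (cases "x \<in> B")
      case True
      then show ?thesis using B(2) zero(1) t unfolding V.independent_explicit_module
        by (metis Int_iff Int_lower2 finite_Int)
    next
      case False
      then have "x \<in> E" using t by blast
      then show ?thesis using E(2) zero(2) t unfolding V.independent_explicit_module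
        by (metis Int_iff Int_lower2 finite_Int)
    qed
  qed
  then obtain p where p: "Vector_Spaces.linear s s p" "\<forall>z\<in>B \<union> E. p z = (if z \<in> B then z else 0)"
      "range p = V.span ((\<lambda>z. if z \<in> B then z else 0) ` (B \<union> E))"
    using P.linear_independent_extend_subspace[of "B \<union> E" "\<lambda>z. if z \<in> B then z else 0"] by blast
  have l: "lin s s p" using p(1) lin_iff_linear[OF v v] by blast
  have W1: "p x = x" if "x \<in> W" for x
  proof -
    have "x \<in> V.span B" using that B(3) by blast
    then show ?thesis
      by (induction rule: V.span_induct_alt)
        (use p(2) in \<open>auto simp: lin_zero[OF l] lin_add[OF l] lin_scale[OF l]\<close>)
  qed
  have U1: "p x = 0" if "x \<in> U" for x
  proof -
    have "x \<in> V.span E" using that E(3) by blast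
    then show ?thesis
      by (induction rule: V.span_induct_alt)
        (use p(2) disj in \<open>auto simp: lin_zero[OF l] lin_add[OF l] lin_scale[OF l]\<close>)
  qed
  have "range p \<subseteq> W"
    unfolding p(3) using W B(1) V.subspace_0[OF W] by (intro V.span_minimal) auto
  then show ?thesis using that[OF l] W1 U1 by blast
qed


section \<open>Sweedler calculus\<close>

lemma sum_mset_image_Sum:
  "(\<Sum>z\<in>#(\<Sum>p\<in>#t. G p). f z) = (\<Sum>p\<in>#t. \<Sum>z\<in>#G p. (f z :: 'u::comm_monoid_add))"
  by (induction t) auto

lemma tensor3_eq_sum:
  assumes "tensor3_eq s t u"
    and l1: "\<And>y z. lin s s3 (\<lambda>x. F x y z)" and l2: "\<And>x z. lin s s3 (\<lambda>y. F x y z)"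
    and l3: "\<And>x y. lin s s3 (\<lambda>z. F x y z)"
  shows "(\<Sum>(x, y, z)\<in>#t. F x y z) = (\<Sum>(x, y, z)\<in>#u. F x y z)"
  using assms(1) unfolding tensor3_eq_def
proof (induction rule: multiset_cong.induct)
  case (base t u)
  then show ?case
  proof cases
    case (left t' u' z)
    have "tsum t' (\<lambda>x y. F x y z) = tsum u' (\<lambda>x y. F x y z)"
      by (rule tensor_eq_tsum[OF tensor_eq_base[OF left(3)]]) (auto intro: bilinI l1 l2)
    then show ?thesis unfolding left
      by (simp add: tsum_def image_mset.compositionality case_prod_unfold o_def)
  next
    case (right t' u' x)
    have "tsum t' (\<lambda>y z. F x y z) = tsum u' (\<lambda>y z. F x y z)"
      by (rule tensor_eq_tsum[OF tensor_eq_base[OF right(3)]]) (auto intro: bilinI l2 l3)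
    then show ?thesis unfolding right
      by (simp add: tsum_def image_mset.compositionality case_prod_unfold o_def)
  qed
qed auto

lemma lin_funpow: "lin s s D \<Longrightarrow> lin s s (D ^^ n)"
  by (induction n) (auto simp: lin_def)

text \<open>
  The maps \<open>(f \<otimes> id) \<Delta>\<close> and \<open>(id \<otimes> f) \<Delta>\<close>, that is, the two actions of the dual algebra on a coalgebra.
\<close>

definition lcontr ::
    "('k \<Rightarrow> 'a::ab_group_add \<Rightarrow> 'a) \<Rightarrow> ('a \<Rightarrow> ('a \<times> 'a) multiset) \<Rightarrow> ('a \<Rightarrow> 'k) \<Rightarrow> 'a \<Rightarrow> 'a"
  where "lcontr s \<Delta> f a = tsum (\<Delta> a) (\<lambda>x y. s (f x) y)"

definition rcontr ::
    "('k \<Rightarrow> 'a::ab_group_add \<Rightarrow> 'a) \<Rightarrow> ('a \<Rightarrow> ('a \<times> 'a) multiset) \<Rightarrow> ('a \<Rightarrow> 'k) \<Rightarrow> 'a \<Rightarrow> 'a"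
  where "rcontr s \<Delta> f a = tsum (\<Delta> a) (\<lambda>x y. s (f y) x)"

context coalgebra
begin

lemma lin_comult [lin_rules]:
  assumes "vector_space s3" "lin s1 scale f" "bilin scale scale s3 F"
  shows "lin s1 s3 (\<lambda>a. tsum (comult (f a)) F)"
proof (rule linI)
  fix x y c
  show "tsum (comult (f (x + y))) F = tsum (comult (f x)) F + tsum (comult (f y)) F"
    using tensor_eq_tsum[OF comult_add assms(3)] by (simp add: lin_add[OF assms(2)])
  have "lin s3 s3 (s3 c)" by (intro lin_rules assms)
  then show "tsum (comult (f (s1 c x))) F = s3 c (tsum (comult (f x)) F)"
    using tensor_eq_tsum[OF comult_scale assms(3)]
    by (simp add: tsum_map lin_scale[OF assms(2)] lin_tsum_arg lin_scale[OF bilin1[OF assms(3)]])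
qed

lemma comult_tsum:
  assumes "vector_space s3" "bilin scale scale s3 F"
  shows "tsum (comult (tsum t G)) F = tsum t (\<lambda>x y. tsum (comult (G x y)) F)"
  by (rule lin_tsum_arg[OF lin_comult[OF assms(1) lin_id assms(2)]])

lemma sweedler_coassoc:
  assumes "\<And>y z. lin scale sU (\<lambda>x. F x y z)" "\<And>x z. lin scale sU (\<lambda>y. F x y z)"
    "\<And>x y. lin scale sU (\<lambda>z. F x y z)"
  shows "tsum (comult a) (\<lambda>x y. tsum (comult x) (\<lambda>x' x''. F x' x'' y)) =
    tsum (comult a) (\<lambda>x y. tsum (comult y) (\<lambda>y' y''. F x y' y''))"
  using tensor3_eq_sum[OF coassoc assms, of a]
  by (simp add: sum_mset_image_Sum tsum_def image_mset.compositionality case_prod_unfold o_def)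

lemma lin_counit [lin_rules]: "lin s1 scale f \<Longrightarrow> lin s1 (*) (\<lambda>x. counit (f x))"
  using counit_linear lin_iff_linear[OF vector_space_axioms vector_space_mult] lin_compose by blast

lemma sweedler_counit_left: "lin scale s3 f \<Longrightarrow> tsum (comult a) (\<lambda>x y. s3 (counit x) (f y)) = f a"
  using lin_tsum_arg[of scale s3 f "comult a" "\<lambda>x y. scale (counit x) y"] counit_left[of a]
  by (simp add: tsum_def lin_scale)

lemma sweedler_counit_right: "lin scale s3 f \<Longrightarrow> tsum (comult a) (\<lambda>x y. s3 (counit y) (f x)) = f a"
  using lin_tsum_arg[of scale s3 f "comult a" "\<lambda>x y. scale (counit y) x"] counit_right[of a]
  by (simp add: tsum_def lin_scale)

lemma lin_lcontr [lin_rules]: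
  assumes "lin scale (*) f" "lin s1 scale g"
  shows "lin s1 scale (\<lambda>a. lcontr scale comult f (g a))"
  unfolding lcontr_def by (intro lin_rules bilinI vector_space_axioms assms)

text \<open>
  By coassociativity, contraction on the left leg commutes with splitting off a right leg.
\<close>

lemma comult_lcontr:
  assumes "vector_space s3" "lin scale (*) f" "bilin scale scale s3 F"
  shows "tsum (comult (lcontr scale comult f a)) F =
    tsum (comult a) (\<lambda>x y. F (lcontr scale comult f x) y)"
proof -
  note [lin_rules] = bilin1[OF assms(3)] bilin2[OF assms(3)]
  have "tsum (comult (lcontr scale comult f a)) F =
      tsum (comult a) (\<lambda>x y. tsum (comult y) (\<lambda>y' y''. s3 (f x) (F y' y'')))"
    unfolding lcontr_def comult_tsum[OF assms(1,3)]
    by (simp add: lin_scale[OF lin_comult[OF assms(1) lin_id assms(3)]]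
        lin_tsum_arg[OF lin_scale_const[OF assms(1) lin_id]])
  also have "\<dots> = tsum (comult a) (\<lambda>x y. tsum (comult x) (\<lambda>x' x''. s3 (f x') (F x'' y)))"
    by (rule sweedler_coassoc[where sU = s3, symmetric]) (intro lin_rules assms)+
  also have "\<dots> = tsum (comult a) (\<lambda>x y. F (lcontr scale comult f x) y)"
    unfolding lcontr_def by (simp add: lin_tsum_arg[OF bilin1[OF assms(3)]]
        lin_scale[OF bilin1[OF assms(3)]])
  finally show ?thesis .
qed

end

context bialgebra
begin

lemma lin_mult_left [lin_rules]: "lin s1 scale f \<Longrightarrow> lin s1 scale (\<lambda>x. f x * a)"
  by (auto simp: lin_def distrib_right scale_mult_left)

lemma lin_mult_right [lin_rules]: "lin s1 scale f \<Longrightarrow> lin s1 scale (\<lambda>x. a * f x)"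
  by (auto simp: lin_def distrib_left scale_mult_right)

lemma tsum_tensor_mult:
  "tsum (tensor_mult m t u) F = tsum t (\<lambda>a b. tsum u (\<lambda>a' b'. F (m a a') (m b b')))"
  by (simp add: tsum_def tensor_mult_def sum_mset_image_Sum image_mset.compositionality
      case_prod_unfold o_def)

lemma sweedler_mult:
  "bilin scale scale s3 F \<Longrightarrow> tsum (comult (a * b)) F =
    tsum (comult a) (\<lambda>a1 a2. tsum (comult b) (\<lambda>b1 b2. F (a1 * b1) (a2 * b2)))"
  using tensor_eq_tsum[OF comult_mult] by (simp add: tsum_tensor_mult)

lemma sweedler_one: "bilin scale scale s3 F \<Longrightarrow> tsum (comult 1) F = F 1 1"
  using tensor_eq_tsum[OF comult_one] by simp

end

context hopf_algebra
begin

lemma lin_antipode [lin_rules]: "lin s1 scale f \<Longrightarrow> lin s1 scale (\<lambda>x. antipode (f x))"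
  using antipode_linear lin_iff_linear[OF vector_space_axioms vector_space_axioms] lin_compose
  by blast

lemma sweedler_antipode_left: "tsum (comult a) (\<lambda>x y. antipode x * y) = scale (counit a) 1"
  and sweedler_antipode_right: "tsum (comult a) (\<lambda>x y. x * antipode y) = scale (counit a) 1"
  by (simp_all add: tsum_def antipode_left antipode_right)

lemma antipode_one: "antipode 1 = 1"
proof -
  have "bilin scale scale scale (\<lambda>x y. antipode x * y)" by (intro bilinI lin_rules)
  from sweedler_one[OF this] show ?thesis
    using sweedler_antipode_left[of 1] by (simp add: counit_one)
qed

text \<open>
  In Sweedler notation \<open>\<Sum> S(h\<^sub>2)\<^sub>1 \<otimes> h\<^sub>1 S(h\<^sub>2)\<^sub>2 = S(h) \<otimes> 1\<close>. Since \<open>\<Sum> \<Delta>(h\<^sub>1) \<Delta>(S(h\<^sub>2)) = \<epsilon>(h) 1 \<otimes> 1\<close>,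
  both sides agree with \<open>\<Sum> S(h\<^sub>1) h\<^sub>2 S(h\<^sub>4)\<^sub>1 \<otimes> h\<^sub>3 S(h\<^sub>4)\<^sub>2\<close>. This identity is what makes \<open>\<tau>\<close> take values
  in the coinvariants.
\<close>

lemma sweedler_comult_antipode:
  assumes v3: "vector_space s3" and F: "bilin scale scale s3 F"
  shows "tsum (comult h) (\<lambda>a b. tsum (comult (antipode b)) (\<lambda>p q. F p (a * q))) = F (antipode h) 1"
proof -
  note v = vector_space_axioms v3
  note F1 = lin_compose[OF bilin1[OF F]] and F2 = lin_compose[OF bilin2[OF F]]
  have l3: "lin s3 s3 (s3 c)" for c by (intro lin_rules v)
  \<comment> \<open>Regrouping \<open>h\<^sub>1 \<otimes> h\<^sub>2 \<otimes> h\<^sub>3\<close> in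
    two ways evaluates the sum of \<open>Y\<close> once by the right and once by the left antipode
    axiom.\<close>
  define Y where "Y u a c = tsum (comult c) (\<lambda>a2 b. tsum (comult (antipode b))
      (\<lambda>p q. F (antipode u * (a * p)) (a2 * q)))" for u a c
  have inner: "tsum (comult k) (\<lambda>a c. Y u a c) = s3 (counit k) (F (antipode u) 1)" for u k
  proof -
    have bil: "bilin scale scale s3 (\<lambda>p q. F (antipode u * p) q)"
      by (intro bilinI lin_rules F1 F2)
    have "tsum (comult k) (\<lambda>a c. Y u a c) = tsum (comult k) (\<lambda>a b. tsum (comult a) (\<lambda>a1 a2.
        tsum (comult (antipode b)) (\<lambda>p q. F (antipode u * (a1 * p)) (a2 * q))))"
      unfolding Y_def by (rule sweedler_coassoc[where sU = s3, symmetric]) (intro lin_rules F1 F2 bilinI v)+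
    also have "\<dots> = tsum (comult k) (\<lambda>a b. tsum (comult (a * antipode b)) (\<lambda>p q. F (antipode u * p) q))"
      by (simp add: sweedler_mult[OF bil])
    also have "\<dots> = tsum (comult (scale (counit k) 1)) (\<lambda>p q. F (antipode u * p) q)"
      by (simp add: comult_tsum[OF v3 bil, symmetric] sweedler_antipode_right)
    also have "\<dots> = s3 (counit k) (F (antipode u) 1)"
      by (simp add: lin_scale[OF lin_comult[OF v3 lin_id bil]] sweedler_one[OF bil])
    finally show ?thesis .
  qed
  have "F (antipode h) 1 = tsum (comult h) (\<lambda>u k. s3 (counit k) (F (antipode u) 1))"
    by (rule sweedler_counit_right[symmetric]) (intro lin_rules F1)
  also have "\<dots> = tsum (comult h) (\<lambda>u k. tsum (comult k) (\<lambda>a c. Y u a c))"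
    by (simp add: inner)
  also have "\<dots> = tsum (comult h) (\<lambda>w c. tsum (comult w) (\<lambda>u a. Y u a c))"
    unfolding Y_def by (rule sweedler_coassoc[where sU = s3, symmetric]) (intro lin_rules F1 F2 bilinI v)+
  also have "\<dots> = tsum (comult h) (\<lambda>w c. s3 (counit w)
      (tsum (comult c) (\<lambda>a2 b. tsum (comult (antipode b)) (\<lambda>p q. F p (a2 * q)))))"
  proof (rule tsum_cong)
    fix w c
    have "tsum (comult w) (\<lambda>u a. Y u a c) = tsum (comult c) (\<lambda>a2 b. tsum (comult (antipode b))
      (\<lambda>p q. tsum (comult w) (\<lambda>u a. F ((antipode u * a) * p) (a2 * q))))"
      unfolding Y_def by (subst tsum_swap) (simp add: tsum_swap[of "comult w"] mult.assoc)
    also have "\<dots> = tsum (comult c) (\<lambda>a2 b. tsum (comult (antipode b))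
      (\<lambda>p q. F (scale (counit w) 1 * p) (a2 * q)))"
    proof (intro tsum_cong)
      fix a2 b p q
      have "lin scale s3 (\<lambda>z. F (z * p) (a2 * q))" by (intro lin_rules F1)
      from lin_tsum_arg[OF this, of "comult w" "\<lambda>u a. antipode u * a"]
      show "tsum (comult w) (\<lambda>u a. F (antipode u * a * p) (a2 * q)) =
          F (scale (counit w) 1 * p) (a2 * q)"
        by (simp add: sweedler_antipode_left)
    qed
    also have "\<dots> = s3 (counit w)
      (tsum (comult c) (\<lambda>a2 b. tsum (comult (antipode b)) (\<lambda>p q. F p (a2 * q))))"
      by (simp add: scale_mult_left lin_scale[OF bilin1[OF F]] lin_tsum_arg[OF l3])
    finally show "tsum (comult w) (\<lambda>u a. Y u a c) = \<dots>" .
  qed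
  also have "\<dots> = tsum (comult h) (\<lambda>a2 b. tsum (comult (antipode b)) (\<lambda>p q. F p (a2 * q)))"
    by (rule sweedler_counit_left) (intro lin_rules F1 F2 bilinI v)
  finally show ?thesis by simp
qed

end


section \<open>Powers of a skew-primitive element\<close>

text \<open>
  Gaussian binomial coefficients, by the recursion that the coefficients of \<open>(a + b)\<^sup>m\<close> satisfy when
  \<open>b a = q a b\<close> and \<open>a\<close> is moved to the left.
\<close>

fun qbinom :: "'k::field \<Rightarrow> nat \<Rightarrow> nat \<Rightarrow> 'k" where
  "qbinom q m 0 = 1"
| "qbinom q 0 (Suc k) = 0"
| "qbinom q (Suc m) (Suc k) = qbinom q m k + q ^ Suc k * qbinom q m (Suc k)"

definition qint :: "'k::field \<Rightarrow> nat \<Rightarrow> 'k"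
  where "qint q m = (\<Sum>i<m. q ^ i)"

definition qfact :: "'k::field \<Rightarrow> nat \<Rightarrow> 'k"
  where "qfact q m = (\<Prod>i=1..m. qint q i)"

lemma qint_0 [simp]: "qint q 0 = 0"
  by (simp add: qint_def)

lemma qint_Suc: "qint q (Suc m) = 1 + q * qint q m"
  unfolding qint_def by (subst sum.lessThan_Suc_shift) (simp add: sum_distrib_left)

lemma qint_add: "qint q (m + n) = qint q m + q ^ m * qint q n"
  by (induction m) (simp_all add: qint_Suc algebra_simps)

lemma qfact_Suc: "qfact q (Suc m) = qint q (Suc m) * qfact q m"
  by (simp add: qfact_def mult.commute)

lemma qfact_0 [simp]: "qfact q 0 = 1"
  by (simp add: qfact_def)

lemma qbinom_eq_0: "m < k \<Longrightarrow> qbinom q m k = 0"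
  by (induction q m k rule: qbinom.induct) auto

lemma qbinom_1: "qbinom q m (Suc 0) = qint q m"
proof (induction m)
  case (Suc m)
  then show ?case by (simp add: qint_Suc)
qed simp

lemma qbinom_self: "qbinom q m m = 1"
  by (induction m) (auto simp: qbinom_eq_0)

lemma qbinom_qfact: "k \<le> m \<Longrightarrow> qbinom q m k * (qfact q k * qfact q (m - k)) = qfact q m"
proof (induction q m k rule: qbinom.induct)
  case (3 q m k)
  show ?case
  proof (cases "k = m")
    case True
    then show ?thesis by (simp add: qbinom_self qbinom_eq_0)
  next
    case False
    then have k: "Suc k \<le> m" using 3 by simp
    then obtain r where r: "m - k = Suc r" "m - Suc k = r" "m = k + Suc r"
      by (metis Suc_diff_Suc Suc_le_eq le_add_diff_inverse less_imp_le)
    have 1: "qbinom q m k * (qfact q k * qfact q (Suc r)) = qfact q m"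
      and 2: "qbinom q m (Suc k) * (qfact q (Suc k) * qfact q r) = qfact q m"
      using 3 k r by auto
    have "qbinom q (Suc m) (Suc k) * (qfact q (Suc k) * qfact q (Suc m - Suc k)) =
       qbinom q m k * (qfact q k * qfact q (Suc r)) * qint q (Suc k) +
       q ^ Suc k * qint q (Suc r) * (qbinom q m (Suc k) * (qfact q (Suc k) * qfact q r))"
      using r(1) by (simp add: qfact_Suc algebra_simps)
    also have "\<dots> = qfact q m * (qint q (Suc k) + q ^ Suc k * qint q (Suc r))"
      unfolding 1 2 by (simp only: algebra_simps)
    also have "qint q (Suc k) + q ^ Suc k * qint q (Suc r) = qint q (Suc m)"
      using r(3) qint_add[of q "Suc k" "Suc r"] by simp
    finally show ?thesis by (simp add: qfact_Suc mult.commute)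
  qed
qed auto

text \<open>
  At a root of unity of order \<open>n\<close> the numerator \<open>(n)\<^sub>q!\<close> vanishes, but the denominator does not.
\<close>

lemma qbinom_root_of_unity:
  assumes "\<And>i. 0 < i \<Longrightarrow> i < n \<Longrightarrow> qint q i \<noteq> 0" "qint q n = 0" "0 < k" "k < n"
  shows "qbinom q n k = 0"
proof -
  have "qfact q i \<noteq> 0" if "i < n" for i
    using assms(1) that by (auto simp: qfact_def)
  moreover have "qfact q n = 0" using assms(2-4) by (auto simp: qfact_def)
  ultimately show ?thesis using qbinom_qfact[of k n q] assms(3,4) by auto
qed

context bialgebra
begin

lemma lin_commute_power:
  assumes "g * y = scale q (y * g)"
  shows "g * y ^ k = scale (q ^ k) (y ^ k * g)" "g ^ k * y = scale (q ^ k) (y * g ^ k)"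
proof (induction k)
  case (Suc k)
  {
    case 1
    have "g * y ^ Suc k = (g * y ^ k) * y" by (simp add: power_Suc2 mult.assoc del: power_Suc)
    also have "\<dots> = scale (q ^ Suc k) (y ^ Suc k * g)"
      by (simp add: Suc assms scale_mult_left scale_mult_right mult.assoc power_Suc2 mult.commute
          del: power_Suc)
    finally show ?case .
  next
    case 2
    have "g ^ Suc k * y = g ^ k * (g * y)" by (simp add: power_Suc2 mult.assoc del: power_Suc)
    also have "\<dots> = scale q ((g ^ k * y) * g)" by (simp add: assms scale_mult_right mult.assoc)
    also have "\<dots> = scale (q ^ Suc k) (y * g ^ Suc k)"
      by (simp add: Suc scale_mult_left mult.assoc power_Suc2 del: power_Suc)
    finally show ?case .
  }
qed auto

text \<open>
  The \<open>q\<close>-binomial theorem for \<open>\<Delta>(y) = y \<otimes> 1 + g \<otimes> y\<close>: the two summands commute up to \<open>q\<close>.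
\<close>

lemma sweedler_skew_primitive_power:
  assumes v3: "vector_space s3" and F: "bilin scale scale s3 F"
    and y: "tensor_eq scale scale (comult y) {#(y, 1), (g, y)#}"
    and gy: "g * y = scale q (y * g)"
  shows "tsum (comult (y ^ m)) F =
    (\<Sum>k\<le>m. s3 (qbinom q m k) (F (y ^ k * g ^ (m - k)) (y ^ (m - k))))"
  using F
proof (induction m arbitrary: F)
  case 0
  interpret V3: vector_space s3 by fact
  show ?case using sweedler_one[OF 0] by simp
next
  case (Suc m)
  interpret V3: vector_space s3 by fact
  note F = Suc.prems
  note F1 = lin_compose[OF bilin1[OF F]] and F2 = lin_compose[OF bilin2[OF F]]
  define G where "G a b = tsum (comult (y ^ m)) (\<lambda>a' b'. F (a * a') (b * b'))" for a b
  have G: "G a b = (\<Sum>k\<le>m. s3 (qbinom q m k) (F (a * (y ^ k * g ^ (m - k))) (b * y ^ (m - k))))" for a b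
    unfolding G_def by (rule Suc.IH) (intro bilinI lin_rules F1 F2)
  have "tsum (comult (y ^ Suc m)) F = tsum (comult y) G"
    unfolding G_def by (simp add: sweedler_mult[OF F])
  also have "\<dots> = G y 1 + G g y"
    by (subst tensor_eq_tsum[OF y, of s3]) (auto simp: G_def intro!: bilinI lin_rules F1 F2 v3)
  also have "G y 1 = (\<Sum>k\<le>m. s3 (qbinom q m k) (F (y ^ Suc k * g ^ (m - k)) (y ^ (m - k))))"
    by (simp add: G mult.assoc)
  also have "G g y = (\<Sum>k\<le>m. s3 (q ^ k * qbinom q m k) (F (y ^ k * g ^ (Suc m - k)) (y ^ (Suc m - k))))"
    unfolding G
  proof (rule sum.cong)
    fix k assume "k \<in> {..m}"
    then have e: "Suc m - k = Suc (m - k)" by auto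
    have "g * (y ^ k * g ^ (m - k)) = scale (q ^ k) (y ^ k * g ^ (Suc m - k))"
      unfolding e by (simp add: mult.assoc[symmetric] lin_commute_power(1)[OF gy] scale_mult_left)
    then show "s3 (qbinom q m k) (F (g * (y ^ k * g ^ (m - k))) (y * y ^ (m - k))) =
      s3 (q ^ k * qbinom q m k) (F (y ^ k * g ^ (Suc m - k)) (y ^ (Suc m - k)))"
      by (simp add: e lin_scale[OF bilin1[OF F]] mult.commute)
  qed simp
  also have "\<dots> = (\<Sum>k\<le>Suc m. s3 (q ^ k * qbinom q m k) (F (y ^ k * g ^ (Suc m - k)) (y ^ (Suc m - k))))"
    by (simp add: qbinom_eq_0)
  also have "\<dots> = F (g ^ Suc m) (y ^ Suc m) +
      (\<Sum>k\<le>m. s3 (q ^ Suc k * qbinom q m (Suc k)) (F (y ^ Suc k * g ^ (m - k)) (y ^ (m - k))))"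
    by (subst sum.atMost_Suc_shift) simp
  finally show ?case
    by (subst sum.atMost_Suc_shift) (simp add: sum.distrib V3.scale_left_distrib)
qed

text \<open>
  For a functional \<open>f\<close> with \<open>f(1) = 0\<close>, \<open>f(y) = 1\<close> and \<open>f(a g) = f(a)\<close>, contraction by \<open>f\<close> acts on the
  powers of \<open>y\<close> like a \<open>q\<close>-derivative, up to terms of lower degree.
\<close>

lemma lcontr_skew_primitive_power:
  assumes y: "tensor_eq scale scale (comult y) {#(y, 1), (g, y)#}"
    and gy: "g * y = scale q (y * g)"
    and f: "lin scale (*) f" "f 1 = 0" "f y = 1" "\<And>a. f (a * g) = f a"
  shows "(lcontr scale comult f ^^ m) (y ^ m) = scale (qfact q m) 1"
    and "(lcontr scale comult f ^^ Suc m) (y ^ m) = 0"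
    and "lcontr scale comult f (y ^ m) = (\<Sum>k\<le>m. scale (qbinom q m k * f (y ^ k)) (y ^ (m - k)))"
proof -
  let ?D = "lcontr scale comult f"
  have lD: "lin scale scale (?D ^^ j)" for j
    by (rule lin_funpow) (intro lin_rules f)
  have fg: "f (a * g ^ j) = f a" for a j
    by (induction j) (auto simp: mult.assoc[symmetric] power_Suc2 f(4) simp del: power_Suc)
  have D: "?D (y ^ m) = (\<Sum>k\<le>m. scale (qbinom q m k * f (y ^ k)) (y ^ (m - k)))" for m
    unfolding lcontr_def
    by (subst sweedler_skew_primitive_power[OF vector_space_axioms _ y gy])
      (auto intro!: bilinI lin_rules f vector_space_axioms simp: fg)
  then show "?D (y ^ m) = (\<Sum>k\<le>m. scale (qbinom q m k * f (y ^ k)) (y ^ (m - k)))" .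
  have *: "(?D ^^ m) (y ^ m) = scale (qfact q m) 1 \<and> (\<forall>j>m. (?D ^^ j) (y ^ m) = 0)"
  proof (induction m rule: less_induct)
    case (less m)
    show ?case
    proof (cases m)
      case 0
      have "(?D ^^ Suc j) 1 = 0" for j
        using D[of 0] f(2) lin_zero[OF lD] by (simp add: funpow_swap1)
      then show ?thesis using 0 by (auto simp: gr0_conv_Suc)
    next
      case (Suc n)
      have step: "?D (y ^ m) = scale (qint q m) (y ^ n) +
          (\<Sum>k<n. scale (qbinom q m (Suc (Suc k)) * f (y ^ Suc (Suc k))) (y ^ (n - Suc k)))"
        unfolding D Suc by (subst sum.atMost_Suc_shift)
          (simp add: f sum.atMost_shift qbinom_1 del: qbinom.simps(3) power_Suc)
      have low: "(?D ^^ j) (\<Sum>k<n. scale (c k) (y ^ (n - Suc k))) = 0" if "n \<le> j" for j c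
        unfolding lin_sum[OF lD] lin_scale[OF lD] using less that Suc by (intro sum.neutral) auto
      have top: "(?D ^^ Suc j) (y ^ m) = scale (qint q m) ((?D ^^ j) (y ^ n))" if "n \<le> j" for j
        by (simp add: funpow_Suc_right step lin_add[OF lD] lin_scale[OF lD] low[OF that]
            del: funpow.simps)
      have IH: "(?D ^^ n) (y ^ n) = scale (qfact q n) 1" "\<And>j. j > n \<Longrightarrow> (?D ^^ j) (y ^ n) = 0"
        using less Suc by auto
      have "(?D ^^ m) (y ^ m) = scale (qfact q m) 1"
        using top[of n] IH Suc by (simp add: qfact_Suc del: funpow.simps)
      moreover have "(?D ^^ j) (y ^ m) = 0" if j: "j > m" for j
      proof -
        obtain i where "j = Suc i" "i > n" using j Suc Suc_less_eq2 by auto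
        then show ?thesis using top[of i] IH(2)[of i] by (simp del: funpow.simps)
      qed
      ultimately show ?thesis by blast
    qed
  qed
  then show "(?D ^^ m) (y ^ m) = scale (qfact q m) 1" "(?D ^^ Suc m) (y ^ m) = 0" by auto
qed

end


section \<open>Skew-primitive elements of finite-dimensional and of cosemisimple Hopf algebras\<close>

text \<open>
  Vectors on which a linear operator is nilpotent of strictly increasing order are linearly
  independent, so a finite-dimensional space does not contain infinitely many of them.
\<close>

lemma no_infinite_ladder:
  fixes s :: "'k::field \<Rightarrow> 'v::ab_group_add \<Rightarrow> 'v" and v :: "nat \<Rightarrow> 'v"
  assumes "vector_space s" and B: "finite B" "\<And>m. v m \<in> Modules.module.span s B"
    and D: "lin s s D"
    and nz: "\<And>m. (D ^^ m) (v m) \<noteq> 0" and z: "\<And>m. (D ^^ Suc m) (v m) = 0"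
  shows False
proof -
  interpret V: vector_space s by fact
  have z': "(D ^^ j) (v m) = 0" if "m < j" for j m
  proof -
    have j: "j = (j - Suc m) + Suc m" using that by simp
    show ?thesis
      by (subst j, subst funpow_add) (simp add: z lin_zero[OF lin_funpow[OF D]] del: funpow.simps)
  qed
  have "inj v"
    by (rule linorder_injI) (metis nz z')
  have "V.independent (range v)"
    unfolding V.independent_explicit_module
  proof (intro allI impI)
    fix t u x
    assume t: "finite t" "t \<subseteq> range v" "(\<Sum>x\<in>t. s (u x) x) = 0" "x \<in> t"
    then obtain I where I: "t = v ` I" "finite I"
      by (metis finite_subset_image)
    show "u x = 0"
    proof (rule ccontr)
      assume "u x \<noteq> 0"
      define M where "M = Max {m \<in> I. u (v m) \<noteq> 0}"
      have fin: "finite {m \<in> I. u (v m) \<noteq> 0}" "{m \<in> I. u (v m) \<noteq> 0} \<noteq> {}"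
        using I t \<open>u x \<noteq> 0\<close> by auto
      have M: "M \<in> I" "u (v M) \<noteq> 0" using Max_in[OF fin] by (auto simp: M_def)
      have M': "m \<le> M" if "m \<in> I" "u (v m) \<noteq> 0" for m
        unfolding M_def using that fin by (intro Max_ge) auto
      note l = lin_funpow[OF D, of M]
      have "0 = (D ^^ M) (\<Sum>m\<in>I. s (u (v m)) (v m))"
        using t(3) \<open>inj v\<close> lin_zero[OF l] by (simp add: I sum.reindex inj_on_subset)
      also have "\<dots> = (\<Sum>m\<in>I. s (u (v m)) ((D ^^ M) (v m)))"
        by (simp add: lin_sum[OF l] lin_scale[OF l])
      also have "\<dots> = (\<Sum>m\<in>{M}. s (u (v m)) ((D ^^ M) (v m)))"
      proof (intro sum.mono_neutral_right ballI)
        fix m assume m: "m \<in> I - {M}"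
        show "s (u (v m)) ((D ^^ M) (v m)) = 0"
          using M'[of m] z'[of m M] m by (cases "u (v m) = 0") auto
      qed (use I M in auto)
      finally show False using M nz[of M] by simp
    qed
  qed
  then have "finite (range v)"
    using V.independent_span_bound[OF B(1), of "range v"] B(2) by auto
  then show False using \<open>inj v\<close> range_inj_infinite by blast
qed

context vector_space
begin

lemma sweedler_grouplike:
  "grouplike scale comult counit e \<Longrightarrow> bilin scale scale s3 F \<Longrightarrow> tsum (comult e) F = F e e"
  using tensor_eq_tsum[of scale scale "comult e" "{#(e, e)#}" s3 F] by (simp add: grouplike_def)

lemma lcontr_grouplike:
  assumes "grouplike scale comult counit e" "lin scale (*) f"
  shows "lcontr scale comult f e = scale (f e) e" "rcontr scale comult f e = scale (f e) e"
proof -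
  have "bilin scale scale scale (\<lambda>x y. scale (f x) y)" "bilin scale scale scale (\<lambda>x y. scale (f y) x)"
    by (intro bilinI lin_rules assms vector_space_axioms)+
  from this[THEN sweedler_grouplike[OF assms(1)]]
  show "lcontr scale comult f e = scale (f e) e" "rcontr scale comult f e = scale (f e) e"
    by (simp_all add: lcontr_def rcontr_def)
qed

lemma lcontr_subcoalgebra:
  assumes "subcoalgebra scale comult D" "d \<in> D" "lin scale (*) f"
  shows "lcontr scale comult f d \<in> D" "rcontr scale comult f d \<in> D"
    and "(\<And>x. x \<in> D \<Longrightarrow> f x = 0) \<Longrightarrow> lcontr scale comult f d = 0"
proof -
  obtain t where t: "set_mset t \<subseteq> D \<times> D" "tensor_eq scale scale (comult d) t"
    using assms(1,2) unfolding subcoalgebra_def by blast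
  have D: "subspace D" using assms(1) by (simp add: subcoalgebra_def)
  have "bilin scale scale scale (\<lambda>x y. scale (f x) y)" "bilin scale scale scale (\<lambda>x y. scale (f y) x)"
    by (intro bilinI lin_rules assms vector_space_axioms)+
  from this[THEN tensor_eq_tsum[OF t(2)]]
  have eq: "lcontr scale comult f d = tsum t (\<lambda>x y. scale (f x) y)"
    "rcontr scale comult f d = tsum t (\<lambda>x y. scale (f y) x)"
    by (simp_all add: lcontr_def rcontr_def)
  show "lcontr scale comult f d \<in> D" "rcontr scale comult f d \<in> D"
    unfolding eq using t(1) D by (auto intro!: tsum_in module_axioms subspace_scale)
  assume "\<And>x. x \<in> D \<Longrightarrow> f x = 0"
  then have "tsum t (\<lambda>x y. scale (f x) y) = tsum t (\<lambda>x y. 0)"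
    using t(1) by (intro tsum_cong) auto
  then show "lcontr scale comult f d = 0" unfolding eq by simp
qed

end

context coalgebra
begin

text \<open>
  If \<open>g = \<Sum> c\<^sub>v v\<close>, then contraction by the functional dual to \<open>w\<close> gives \<open>c\<^sub>w g = c\<^sub>w w\<close>.
\<close>

lemma grouplike_independent:
  assumes "finite T" "\<And>e. e \<in> T \<Longrightarrow> grouplike scale comult counit e"
  shows "independent T"
  using assms
proof (induction T rule: finite_induct)
  case (insert g T)
  have T: "independent T" using insert by simp
  have "g \<notin> span T"
  proof
    assume "g \<in> span T"
    then obtain c where c: "g = (\<Sum>v\<in>T. scale (c v) v)"
      using insert.hyps(1) by (auto simp: span_finite)
    have "c w = 0" if w: "w \<in> T" for w
    proof -
      obtain p where p: "lin scale (*) p" "\<And>z. z \<in> T \<Longrightarrow> p z = (if z = w then 1 else 0)"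
        using coordinate_functional[OF vector_space_axioms T] by blast
      note l = p(1)
      have lp: "lin scale scale (lcontr scale comult p)" by (intro lin_rules l)
      have pg: "p g = c w"
      proof -
        have "p g = (\<Sum>v\<in>T. if v = w then c w else 0)"
          unfolding c lin_sum[OF l] lin_scale[OF l] by (intro sum.cong refl) (use p(2) in auto)
        then show ?thesis using w insert.hyps(1) by simp
      qed
      have "scale (p g) g = lcontr scale comult p g"
        by (rule lcontr_grouplike[symmetric]) (use insert.prems l in auto)
      also have "\<dots> = (\<Sum>v\<in>T. scale (c v) (scale (p v) v))"
        unfolding c lin_sum[OF lp] lin_scale[OF lp]
        by (intro sum.cong refl arg_cong[where f = "scale _"] lcontr_grouplike(1)[OF insert.prems l]) auto
      also have "\<dots> = (\<Sum>v\<in>T. if v = w then scale (c w) w else 0)"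
        by (intro sum.cong refl) (use p(2) in auto)
      also have "\<dots> = scale (c w) w"
        using w insert.hyps(1) by simp
      finally show ?thesis using pg insert.hyps(2) w by (auto simp: scale_left_imp_eq)
    qed
    then have "g = 0" by (simp add: c)
    then show False using insert.prems[of g] lin_zero[OF lin_counit[OF lin_id]]
      by (simp add: grouplike_def)
  qed
  then show ?case using T by (simp add: independent_insert insert.hyps)
qed (simp add: independent_empty)

lemma skew_primitive_counit:
  assumes e: "counit e = 1" and g: "counit g = 1"
    and x: "tensor_eq scale scale (comult x) {#(x, e), (g, x)#}"
  shows "counit x = 0"
proof -
  have "bilin scale scale (*) (\<lambda>a b. counit a * counit b)"
    by (intro bilinI lin_rules)
  from tensor_eq_tsum[OF x this] have "counit x = counit x + counit x"
    using e g sweedler_counit_left[OF lin_counit[OF lin_id], of x] by simp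
  then show ?thesis by (metis add_cancel_right_right)
qed

lemma subcoalgebra_span_grouplike:
  assumes "grouplike scale comult counit e"
  shows "subcoalgebra scale comult (span {e})"
  unfolding subcoalgebra_def
proof (intro conjI ballI)
  fix d assume "d \<in> span {e}"
  then obtain c where d: "d = scale c e" by (auto simp: span_singleton)
  have "tensor_eq scale scale (comult d) {#(scale c e, e)#}"
  proof (rule tensor_eqI[OF vector_space_axioms vector_space_axioms])
    fix f g assume fg: "lin scale (*) f" "lin scale (*) g"
    have b: "bilin scale scale (*) (\<lambda>x y. f x * g y)"
      by (intro bilinI lin_rules fg)
    show "tsum (comult d) (\<lambda>x y. f x * g y) = tsum {#(scale c e, e)#} (\<lambda>x y. f x * g y)"
      unfolding d lin_scale[OF lin_comult[OF vector_space_mult lin_id b]]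
      using sweedler_grouplike[OF assms b] by (simp add: lin_scale[OF fg(1)])
  qed
  then show "\<exists>t. set_mset t \<subseteq> span {e} \<times> span {e} \<and> tensor_eq scale scale (comult d) t"
    by (intro exI[of _ "{#(scale c e, e)#}"]) (auto intro: span_base span_scale)
qed (rule subspace_span)

lemma simple_subcoalgebra_grouplike:
  assumes "simple_subcoalgebra scale comult D" "grouplike scale comult counit e" "e \<in> D"
  shows "D = span {e}"
proof -
  have "e \<noteq> 0" using assms(2) lin_zero[OF lin_counit[OF lin_id]] by (auto simp: grouplike_def)
  moreover have "span {e} \<subseteq> D"
    using assms(1,3) by (intro span_minimal) (auto simp: simple_subcoalgebra_def subcoalgebra_def)
  ultimately show ?thesis
    using assms subcoalgebra_span_grouplike span_base[of e "{e}"]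
    unfolding simple_subcoalgebra_def by (metis insertI1 singletonD)
qed

text \<open>
  If \<open>e\<close> is a sum of elements of several subcoalgebras and a functional \<open>f\<close> with \<open>f(e) = 1\<close>
  vanishes on one of them, then contraction by \<open>f\<close> fixes \<open>e\<close> and removes that summand.
\<close>

lemma grouplike_in_sum_of_subcoalgebras:
  assumes e: "grouplike scale comult counit e"
    and sub: "\<And>D. D \<in> \<D> \<Longrightarrow> subcoalgebra scale comult D"
    and mem: "e \<in> span (\<Union>\<D>)"
  shows "\<exists>D\<in>\<D>. e \<in> D"
proof -
  have e0: "e \<noteq> 0" using e lin_zero[OF lin_counit[OF lin_id]] by (auto simp: grouplike_def)
  have fin: "\<exists>D\<in>\<T>. e \<in> D"
    if "finite \<T>" "\<T> \<subseteq> \<D>" "e \<in> span (\<Union>\<T>)" for \<T>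
    using that
  proof (induction \<T> rule: finite_induct)
    case (insert D \<T>)
    show ?case
    proof (cases "e \<in> D")
      case False
      have D: "subcoalgebra scale comult D" using insert sub by auto
      then have sD: "subspace D" by (simp add: subcoalgebra_def)
      obtain v w where vw: "e = v + w" "v \<in> D" "w \<in> span (\<Union>\<T>)"
        using insert.prems(2) sD span_Un[of D "\<Union>\<T>"] by (auto simp: span_eq_iff[THEN iffD2])
      obtain f where f: "lin scale (*) f" "f e = 1" "\<And>x. x \<in> D \<Longrightarrow> f x = 0"
        using separating_functional[OF vector_space_axioms sD False] by blast
      have lf: "lin scale scale (lcontr scale comult f)" by (intro lin_rules f)
      have "e = lcontr scale comult f e" using lcontr_grouplike(1)[OF e f(1)] f(2) by simp
      also have "\<dots> = lcontr scale comult f w"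
        using lcontr_subcoalgebra(3)[OF D vw(2) f(1)] f(3) by (simp add: vw lin_add[OF lf])
      also have "\<dots> \<in> span (\<Union>\<T>)"
        using vw(3)
      proof (induction rule: span_induct_alt)
        case (step c x y)
        then obtain E where "E \<in> \<T>" "x \<in> E" by blast
        then have "lcontr scale comult f x \<in> span (\<Union>\<T>)"
          using lcontr_subcoalgebra(1)[of comult E x f] sub insert.prems f(1)
          by (intro span_base) blast
        then show ?case using step by (simp add: lin_add[OF lf] lin_scale[OF lf] span_add span_scale)
      qed (simp add: lin_zero[OF lf] span_zero)
      finally show ?thesis using insert by blast
    qed simp
  qed (use e0 in simp)
  obtain t r where t: "finite t" "t \<subseteq> \<Union>\<D>" "e = (\<Sum>a\<in>t. scale (r a) a)"
    using mem unfolding span_explicit by blast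
  then obtain \<T> where "finite \<T>" "\<T> \<subseteq> \<D>" "t \<subseteq> \<Union>\<T>"
    by (metis finite_subset_Union)
  moreover have "e \<in> span (\<Union>\<T>)"
    unfolding t(3) using \<open>t \<subseteq> \<Union>\<T>\<close> by (intro span_sum span_scale span_base) auto
  ultimately show ?thesis using fin by blast
qed

text \<open>
  The simple subcoalgebras other than the lines of \<open>e\<close> and \<open>g\<close> span a subcoalgebra that complements
  the span of \<open>e\<close> and \<open>g\<close>. The projection onto it, applied to both tensor factors, annihilates
  \<open>x \<otimes> e + g \<otimes> x\<close>, so the component of \<open>x\<close> in the complement vanishes.
\<close>

lemma cosemisimple_skew_primitive:
  assumes cs: "cosemisimple scale comult"
    and e: "grouplike scale comult counit e" and g: "grouplike scale comult counit g"
    and x: "tensor_eq scale scale (comult x) {#(x, e), (g, x)#}"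
  shows "x \<in> span {e, g}"
proof -
  define \<D> where "\<D> = {D. simple_subcoalgebra scale comult D \<and> e \<notin> D \<and> g \<notin> D}"
  define L where "L = span (\<Union>\<D>)"
  have sub: "subcoalgebra scale comult D" if "D \<in> \<D>" for D
    using that by (simp add: \<D>_def simple_subcoalgebra_def)
  have L: "subspace L" unfolding L_def by (rule subspace_span)
  have notin: "h \<notin> L" if h: "grouplike scale comult counit h" and D: "\<forall>D\<in>\<D>. h \<notin> D" for h
    using grouplike_in_sum_of_subcoalgebras[OF h, of \<D>] sub D unfolding L_def by blast
  have notL: "e \<notin> L" "g \<notin> L"
    by (rule notin[OF e], simp add: \<D>_def, rule notin[OF g], simp add: \<D>_def)
  have LL: "lcontr scale comult f v \<in> L" if f: "lin scale (*) f" and v: "v \<in> L" for f v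
  proof -
    have lf: "lin scale scale (lcontr scale comult f)" by (intro lin_rules f)
    show ?thesis using v unfolding L_def
    proof (induction rule: span_induct_alt)
      case (step c x y)
      then obtain E where "E \<in> \<D>" "x \<in> E" by blast
      then have "lcontr scale comult f x \<in> span (\<Union>\<D>)"
        using lcontr_subcoalgebra(1)[OF sub _ f] by (intro span_base) blast
      then show ?case using step by (simp add: lin_add[OF lf] lin_scale[OF lf] span_add span_scale)
    qed (simp add: lin_zero[OF lf] span_zero)
  qed
  \<comment> \<open>Contracting \<open>c h + d k\<close> by a functional with \<open>f(h) =
    1\<close> and \<open>f(k) = 0\<close> would put \<open>h\<close> into \<open>L\<close>.\<close>
  have only: "c = 0" if h: "grouplike scale comult counit h" "h \<notin> L"
    and k: "grouplike scale comult counit k" "k \<noteq> h" and v: "scale c h + scale d k \<in> L" for c d h k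
  proof (rule ccontr)
    assume "c \<noteq> 0"
    have "h \<notin> span {k}"
    proof
      assume "h \<in> span {k}"
      then obtain r where "h = scale r k" by (auto simp: span_singleton)
      then show False using h k lin_scale[OF lin_counit[OF lin_id], of r k]
        by (auto simp: grouplike_def)
    qed
    then obtain f where f: "lin scale (*) f" "f h = 1" "\<And>x. x \<in> span {k} \<Longrightarrow> f x = 0"
      by (rule separating_functional[OF vector_space_axioms subspace_span]) blast
    have lf: "lin scale scale (lcontr scale comult f)" by (intro lin_rules f)
    have "f k = 0" using f(3) span_base by blast
    then have "scale c h \<in> L"
      using LL[OF f(1) v] f(2)
      by (simp add: lin_add[OF lf] lin_scale[OF lf] lcontr_grouplike(1)[OF h(1) f(1)]
          lcontr_grouplike(1)[OF k(1) f(1)])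
    then have "scale (1 / c) (scale c h) \<in> L" by (rule subspace_scale[OF L])
    then show False using \<open>c \<noteq> 0\<close> h(2) by simp
  qed
  have disj: "L \<inter> span {e, g} \<subseteq> {0}"
  proof
    fix v assume v: "v \<in> L \<inter> span {e, g}"
    then obtain c d where cd: "v = scale c e + scale d g"
      by (auto simp: span_insert span_singleton algebra_simps)
    show "v \<in> {0}"
    proof (cases "e = g")
      case True
      then have "v = scale (c + d) e" using cd by (simp add: scale_left_distrib)
      moreover have "c + d = 0"
      proof (rule ccontr)
        assume "c + d \<noteq> 0"
        moreover have "scale (1 / (c + d)) v \<in> L" using v subspace_scale[OF L] by blast
        ultimately show False using notL \<open>v = scale (c + d) e\<close> by simp
      qed
      ultimately show ?thesis by simp
    next
      case False
      have "scale c e + scale d g \<in> L" "scale d g + scale c e \<in> L"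
        using v cd by (simp_all add: add.commute)
      then have "c = 0" "d = 0"
        using only[OF e notL(1) g False[symmetric]] only[OF g notL(2) e False] by blast+
      then show ?thesis using cd by simp
    qed
  qed
  obtain p where p: "lin scale scale p" "\<And>x. p x \<in> L" "\<And>x. x \<in> L \<Longrightarrow> p x = x"
      "\<And>x. x \<in> span {e, g} \<Longrightarrow> p x = 0"
    using projection_onto[OF vector_space_axioms L subspace_span disj] by blast
  have "(\<Union>{D. simple_subcoalgebra scale comult D \<and> D \<subseteq> UNIV}) \<subseteq> span (\<Union>\<D> \<union> {e, g})"
  proof (rule Union_least)
    fix D assume "D \<in> {D. simple_subcoalgebra scale comult D \<and> D \<subseteq> UNIV}"
    then have D: "simple_subcoalgebra scale comult D" by simp
    consider "e \<in> D" | "g \<in> D" | "D \<in> \<D>" using D by (auto simp: \<D>_def)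
    then show "D \<subseteq> span (\<Union>\<D> \<union> {e, g})"
    proof cases
      case 1
      show ?thesis unfolding simple_subcoalgebra_grouplike[OF D e 1] by (intro span_mono) auto
    next
      case 2
      show ?thesis unfolding simple_subcoalgebra_grouplike[OF D g 2] by (intro span_mono) auto
    next
      case 3
      then show ?thesis by (auto intro: span_base)
    qed
  qed
  then have "x \<in> span (\<Union>\<D> \<union> {e, g})"
    using cs unfolding cosemisimple_def coradical_def
    by (metis UNIV_I span_minimal subset_iff subspace_span)
  then obtain l v where lv: "x = l + v" "l \<in> L" "v \<in> span {e, g}"
    unfolding span_Un L_def by blast
  have eg: "p e = 0" "p g = 0" using p(4) by (auto intro: span_base)
  let ?F = "\<lambda>a b. scale (counit a) b"
  let ?G = "\<lambda>a b. scale (counit (p a)) (p b)"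
  have bil: "bilin scale scale scale ?F" "bilin scale scale scale ?G"
    by (intro bilinI lin_rules vector_space_axioms p(1) lin_counit[OF p(1)])+
  have lG: "lin scale scale (\<lambda>v. tsum (comult v) ?G)"
    and lF: "lin scale scale (\<lambda>v. tsum (comult v) ?F)"
    by (intro lin_comult vector_space_axioms lin_id bil)+
  have "tsum (comult l) ?G = tsum (comult l) ?F"
    using lv(2) unfolding L_def
  proof (induction rule: span_induct_alt)
    case base
    then show ?case by (simp add: lin_zero[OF lG] lin_zero[OF lF])
  next
    case (step c a b)
    then obtain E where E: "E \<in> \<D>" "a \<in> E" by blast
    then obtain t where t: "set_mset t \<subseteq> E \<times> E" "tensor_eq scale scale (comult a) t"
      using sub[OF E(1)] unfolding subcoalgebra_def by blast
    have "E \<subseteq> L" unfolding L_def using E by (auto intro: span_base)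
    then have "tsum t ?G = tsum t ?F" using t(1) by (intro tsum_cong) (auto simp: p(3) subset_iff)
    then show ?case using step(2) tensor_eq_tsum[OF t(2) bil(1)] tensor_eq_tsum[OF t(2) bil(2)]
      by (simp add: lin_add[OF lG] lin_add[OF lF] lin_scale[OF lG] lin_scale[OF lF])
  qed
  moreover have "tsum (comult l) ?F = l" using sweedler_counit_left[OF lin_id] by simp
  moreover have "tsum (comult v) ?G = 0"
    using lv(3)
  proof (induction rule: span_induct_alt)
    case base
    then show ?case by (simp add: lin_zero[OF lG])
  next
    case (step c a b)
    have "grouplike scale comult counit a" "p a = 0"
      using step(1) e g eg by auto
    then show ?case using step(2) sweedler_grouplike[OF _ bil(2)]
      by (simp add: lin_add[OF lG] lin_scale[OF lG])
  qed
  moreover have "tsum (comult x) ?G = 0"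
    using tensor_eq_tsum[OF x bil(2)] eg lin_zero[OF lin_counit[OF lin_id]] by simp
  ultimately have "l = 0" using lin_add[OF lG, of l v] lv(1) by simp
  then show ?thesis using lv by simp
qed

end

context bialgebra
begin

lemma grouplike_power:
  assumes "grouplike scale comult counit g"
  shows "grouplike scale comult counit (g ^ n)"
  unfolding grouplike_def
proof
  show "counit (g ^ n) = 1"
    using assms by (induction n) (auto simp: counit_one counit_mult grouplike_def)
  show "tensor_eq scale scale (comult (g ^ n)) {#(g ^ n, g ^ n)#}"
  proof (rule tensor_eqI[OF vector_space_axioms vector_space_axioms])
    fix f h assume "lin scale (*) f" "lin scale (*) h"
    then show "tsum (comult (g ^ n)) (\<lambda>x y. f x * h y) = tsum {#(g ^ n, g ^ n)#} (\<lambda>x y. f x * h y)"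
    proof (induction n arbitrary: f h)
      case 0
      have "bilin scale scale (*) (\<lambda>x y. f x * h y)" by (intro bilinI lin_rules 0)
      then show ?case using sweedler_one by simp
    next
      case (Suc n)
      note F = lin_compose[OF Suc.prems(1)] lin_compose[OF Suc.prems(2)]
      have 1: "bilin scale scale (*) (\<lambda>x y. f x * h y)"
        by (intro bilinI lin_rules Suc.prems)
      have 2: "bilin scale scale (*) (\<lambda>x y. f (g * x) * h (g * y))"
        by (intro bilinI lin_rules F)
      have 3: "bilin scale scale (*) (\<lambda>a b. tsum (comult (g ^ n)) (\<lambda>x y. f (a * x) * h (b * y)))"
        by (intro bilinI lin_rules F vector_space_mult)
      have "tsum (comult (g ^ Suc n)) (\<lambda>x y. f x * h y) =
          tsum (comult (g ^ n)) (\<lambda>x y. f (g * x) * h (g * y))"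
        using sweedler_mult[OF 1, of g "g ^ n"] sweedler_grouplike[OF assms 3] by simp
      also have "\<dots> = f (g * g ^ n) * h (g * g ^ n)"
        using Suc.IH[of "\<lambda>x. f (g * x)" "\<lambda>x. h (g * x)", OF F[OF lin_mult_right[OF lin_id]]]
        by simp
      finally show ?case by simp
    qed
  qed
qed

end

context hopf_algebra
begin

lemma antipode_grouplike:
  assumes "grouplike scale comult counit g"
  shows "antipode g * g = 1"
proof -
  have b: "bilin scale scale scale (\<lambda>x y. antipode x * y)" by (intro bilinI lin_rules)
  from sweedler_grouplike[OF assms b] show ?thesis
    using sweedler_antipode_left[of g] assms by (simp add: grouplike_def)
qed

text \<open>
  Infinitely many distinct powers would be linearly independent. The least \<open>s\<close> with \<open>g\<^sup>s = 1\<close> makes the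
  powers below \<open>s\<close> distinct, because \<open>g\<close> is cancellable.
\<close>

lemma grouplike_finite_order:
  assumes fd: "finite_dimensional scale" and g: "grouplike scale comult counit g"
  shows "\<exists>s>0. g ^ s = 1 \<and> inj_on (\<lambda>i. g ^ i) {..<s}"
proof -
  have cancel: "g ^ (j - i) = 1" if "g ^ i = g ^ j" "i \<le> j" for i j
    using that
  proof (induction i arbitrary: j)
    case (Suc i)
    then obtain k where k: "j = Suc k" by (cases j) auto
    have "antipode g * (g * g ^ i) = antipode g * (g * g ^ k)" using Suc.prems k by simp
    then have "g ^ i = g ^ k"
      by (simp add: antipode_grouplike[OF g] flip: mult.assoc)
    then show ?case using Suc k by simp
  qed simp
  obtain B where B: "finite B" "span B = UNIV"
    using fd by (auto simp: finite_dimensional_def)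
  have "\<not> inj_on (\<lambda>i. g ^ i) {..card B}"
  proof
    assume inj: "inj_on (\<lambda>i. g ^ i) {..card B}"
    have "independent ((\<lambda>i. g ^ i) ` {..card B})"
      by (intro grouplike_independent) (auto simp: grouplike_power[OF g])
    then have "card ((\<lambda>i. g ^ i) ` {..card B}) \<le> card B"
      using independent_span_bound[OF B(1)] B(2) by blast
    then show False using card_image[OF inj] by simp
  qed
  then obtain i j where "i < j" "g ^ i = g ^ j"
    unfolding inj_on_def by (metis nat_neq_iff)
  then have ex: "\<exists>s>0. g ^ s = 1" using cancel[of i j] by (metis less_imp_le zero_less_diff)
  define s where "s = (LEAST s. s > 0 \<and> g ^ s = 1)"
  have s: "s > 0" "g ^ s = 1" "\<And>r. r > 0 \<Longrightarrow> g ^ r = 1 \<Longrightarrow> s \<le> r"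
    using LeastI_ex[OF ex] Least_le[of "\<lambda>s. s > 0 \<and> g ^ s = 1"] by (auto simp: s_def)
  have "inj_on (\<lambda>i. g ^ i) {..<s}"
  proof (rule linorder_inj_onI)
    fix i j assume "i < j" "j \<in> {..<s}"
    then show "g ^ i \<noteq> g ^ j" using cancel[of i j] s(3)[of "j - i"] by fastforce
  qed auto
  then show ?thesis using s by blast
qed

text \<open>
  If \<open>x\<close> were not in the span of the powers of \<open>g\<close>, then \<open>x E\<close> with \<open>E = \<Sum> g\<^sup>i\<close> would not be a
  multiple of \<open>E\<close>. A functional that vanishes at \<open>E\<close> but not at \<open>x E\<close> then gives \<open>f(a) = f\<^sub>0(a E)\<close>
  as in the lemma on powers of skew-primitive elements, and the powers of \<open>x\<close> are linearly
  independent in characteristic zero.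
\<close>

lemma finite_dimensional_skew_primitive:
  assumes fd: "finite_dimensional scale"
    and char0: "\<And>n. n > 0 \<Longrightarrow> of_nat n \<noteq> (0::'k)"
    and g: "grouplike scale comult counit g"
    and x: "tensor_eq scale scale (comult x) {#(x, 1), (g, x)#}"
    and comm: "g * x = x * g"
  shows "x \<in> span (range (\<lambda>i. g ^ i))"
proof -
  obtain s where s: "s > 0" "g ^ s = 1" "inj_on (\<lambda>i. g ^ i) {..<s}"
    using grouplike_finite_order[OF fd g] by blast
  \<comment> \<open>A multiple of the averaging idempotent of the cyclic group generated by
    \<open>g\<close>.\<close>
  define E where "E = (\<Sum>i<s. g ^ i)"
  have gE: "g * E = E"
  proof -
    have "g * E + 1 = (\<Sum>i<Suc s. g ^ i)"
      unfolding E_def by (subst sum.lessThan_Suc_shift) (simp add: sum_distrib_left)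
    also have "\<dots> = E + 1" using s(2) by (simp add: E_def)
    finally show ?thesis by simp
  qed
  have lc: "lin scale (*) counit" by (rule lin_counit[OF lin_id])
  have cE: "counit E = of_nat s"
    using grouplike_power[OF g] by (simp add: E_def lin_sum[OF lc] grouplike_def)
  have cx: "counit x = 0"
    using skew_primitive_counit[OF counit_one _ x] g by (simp add: grouplike_def)
  show ?thesis
  proof (cases "x * E \<in> span {E}")
    case True
    then obtain c where c: "x * E = scale c E" by (auto simp: span_singleton)
    then have "c * of_nat s = 0"
      using counit_mult[of x E] cx cE lin_scale[OF lc, of c E] by simp
    then have xE: "x * E = 0" using char0[OF s(1)] c by simp
    define T where "T = (\<lambda>i. g ^ i) ` {..<s}"
    have T: "independent T"
      unfolding T_def by (intro grouplike_independent) (auto simp: grouplike_power[OF g])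
    obtain p where p: "lin scale (*) p" "\<And>z. z \<in> T \<Longrightarrow> p z = (if z = 1 then 1 else 0)"
      using coordinate_functional[OF vector_space_axioms T] by blast
    have pg: "p (g ^ i) = (if i = 0 then 1 else 0)" if "i < s" for i
    proof -
      have "g ^ i = 1 \<longleftrightarrow> i = 0"
        using inj_on_eq_iff[OF s(3), of i 0] that s(1) by simp
      then show ?thesis using p(2)[of "g ^ i"] that by (auto simp: T_def)
    qed
    have bil: "bilin scale scale scale (\<lambda>a b. scale (p b) a)"
      by (intro bilinI lin_rules p vector_space_axioms)
    have xg: "tsum (comult (x * g ^ i)) (\<lambda>a b. scale (p b) a) =
        scale (p (g ^ i)) (x * g ^ i) + scale (p (x * g ^ i)) (g ^ Suc i)" for i
    proof -
      have bil2: "bilin scale scale scale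
          (\<lambda>a1 a2. tsum (comult (g ^ i)) (\<lambda>b1 b2. scale (p (a2 * b2)) (a1 * b1)))"
        and bil3: "\<And>u v. bilin scale scale scale (\<lambda>b1 b2. scale (p (u * b2)) (v * b1))"
        by (intro bilinI lin_rules lin_compose[OF p(1)] vector_space_axioms)+
      show ?thesis
        using tensor_eq_tsum[OF x bil2] sweedler_grouplike[OF grouplike_power[OF g] bil3]
        by (simp add: sweedler_mult[OF bil])
    qed
    \<comment> \<open>Here \<open>x E = 0\<close>. Applying \<open>p\<close> to the second factor
      of \<open>\<Delta>(x E)\<close> recovers \<open>x\<close> up to powers of \<open>g\<close>.\<close>
    have "0 = tsum (comult (x * E)) (\<lambda>a b. scale (p b) a)"
      using xE lin_zero[OF lin_comult[OF vector_space_axioms lin_id bil]] by simp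
    also have "\<dots> = (\<Sum>i<s. tsum (comult (x * g ^ i)) (\<lambda>a b. scale (p b) a))"
      unfolding E_def sum_distrib_left
      by (rule lin_sum[OF lin_comult[OF vector_space_axioms lin_id bil]])
    also have "\<dots> = (\<Sum>i<s. if i = 0 then x else 0) + (\<Sum>i<s. scale (p (x * g ^ i)) (g ^ Suc i))"
      unfolding xg sum.distrib by (intro arg_cong2[of _ _ _ _ "(+)"] sum.cong refl) (auto simp: pg)
    also have "(\<Sum>i<s. if i = 0 then x else 0) = x" using s(1) by simp
    finally have "x = - (\<Sum>i<s. scale (p (x * g ^ i)) (g ^ Suc i))"
      by (simp add: eq_neg_iff_add_eq_0)
    moreover have "- (\<Sum>i<s. scale (p (x * g ^ i)) (g ^ Suc i)) \<in> span (range (\<lambda>i. g ^ i))"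
      by (intro span_neg span_sum span_scale span_base) blast
    ultimately show ?thesis by simp
  next
    case False
    then obtain f0 where f0: "lin scale (*) f0" "f0 (x * E) = 1" "\<And>v. v \<in> span {E} \<Longrightarrow> f0 v = 0"
      by (rule separating_functional[OF vector_space_axioms subspace_span]) blast
    define f where "f a = f0 (a * E)" for a
    have f: "lin scale (*) f" "f 1 = 0" "f x = 1" "\<And>a. f (a * g) = f a"
      unfolding f_def using f0
      by (auto intro!: lin_rules lin_compose[OF f0(1)] span_base simp: mult.assoc gE)
    have gx: "g * x = scale 1 (x * g)" using comm by simp
    have "qint 1 m = (of_nat m :: 'k)" for m by (simp add: qint_def)
    then have "qfact (1::'k) m \<noteq> 0" for m using char0 by (auto simp: qfact_def)
    moreover have "(1::'a) \<noteq> 0" using counit_one lin_zero[OF lc] by auto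
    ultimately have "(lcontr scale comult f ^^ m) (x ^ m) \<noteq> 0" for m
      unfolding lcontr_skew_primitive_power(1)[OF x gx f] by simp
    moreover have "(lcontr scale comult f ^^ Suc m) (x ^ m) = 0" for m
      by (rule lcontr_skew_primitive_power(2)[OF x gx f])
    moreover obtain B where "finite B" "span B = UNIV"
      using fd by (auto simp: finite_dimensional_def)
    moreover have "lin scale scale (lcontr scale comult f)" by (intro lin_rules f)
    ultimately have False
      using no_infinite_ladder[OF vector_space_axioms, of B "\<lambda>m. x ^ m"] by auto
    then show ?thesis ..
  qed
qed

text \<open>
  For a group-like \<open>w\<close> other than \<open>1\<close> and \<open>g\<close>, contracting \<open>x\<close> by the functional dual to \<open>w\<close> gives \<open>c\<^sub>w w\<close>
  from the expansion and \<open>c\<^sub>w 1\<close> from the comultiplication, so only \<open>1\<close> and \<open>g\<close> occur in \<open>x\<close>. The counit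
  makes their coefficients opposite.
\<close>

lemma skew_primitive_in_grouplike_span:
  assumes T: "finite T" "\<And>e. e \<in> T \<Longrightarrow> grouplike scale comult counit e" "1 \<in> T" "g \<in> T"
    and x: "tensor_eq scale scale (comult x) {#(x, 1), (g, x)#}" and xT: "x \<in> span T"
  shows "\<exists>l. x = scale l (1 - g)"
proof -
  have ind: "independent T" using T by (intro grouplike_independent) auto
  obtain c where c: "x = (\<Sum>v\<in>T. scale (c v) v)"
    using xT T(1) by (auto simp: span_finite)
  have lc: "lin scale (*) counit" by (rule lin_counit[OF lin_id])
  have cx: "counit x = 0"
    using skew_primitive_counit[OF counit_one _ x] T(2,4) by (simp add: grouplike_def)
  have c0: "c w = 0" if w: "w \<in> T" "w \<noteq> 1" "w \<noteq> g" for w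
  proof -
    obtain p where p: "lin scale (*) p" "\<And>z. z \<in> T \<Longrightarrow> p z = (if z = w then 1 else 0)"
      using coordinate_functional[OF vector_space_axioms ind] by blast
    have lp: "lin scale scale (lcontr scale comult p)" by (intro lin_rules p)
    have bil: "bilin scale scale scale (\<lambda>a b. scale (p a) b)"
      by (intro bilinI lin_rules p vector_space_axioms)
    have "lcontr scale comult p x = (\<Sum>v\<in>T. scale (c v) (scale (p v) v))"
      unfolding c lin_sum[OF lp] lin_scale[OF lp]
      by (intro sum.cong refl arg_cong[where f = "scale _"] lcontr_grouplike(1)[OF T(2) p(1)]) auto
    also have "\<dots> = (\<Sum>v\<in>T. if v = w then scale (c w) w else 0)"
      by (intro sum.cong refl) (use p(2) in auto)
    also have "\<dots> = scale (c w) w" using w T(1) by simp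
    finally have 1: "lcontr scale comult p x = scale (c w) w" .
    have "p x = (\<Sum>v\<in>T. if v = w then c w else 0)"
      unfolding c lin_sum[OF p(1)] lin_scale[OF p(1)] by (intro sum.cong refl) (use p(2) in auto)
    then have "p x = c w" using w T(1) by simp
    moreover have "lcontr scale comult p x = scale (p x) 1"
      using tensor_eq_tsum[OF x bil] p(2)[OF T(4)] w by (simp add: lcontr_def)
    ultimately show ?thesis using 1 w scale_left_imp_eq by auto
  qed
  show ?thesis
  proof (cases "g = 1")
    case True
    have "x = (\<Sum>v\<in>{1}. scale (c v) v)"
      unfolding c using T c0 True by (intro sum.mono_neutral_right) auto
    then have "x = scale (c 1) 1" by simp
    then have "x = 0" using cx counit_one lin_scale[OF lc, of "c 1" 1] by simp
    then show ?thesis using True by simp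
  next
    case False
    have "x = (\<Sum>v\<in>{1, g}. scale (c v) v)"
      unfolding c using T c0 by (intro sum.mono_neutral_right) auto
    then have e: "x = scale (c 1) 1 + scale (c g) g" using False by simp
    then have "c 1 + c g = 0"
      using cx counit_one T(2)[OF T(4)] by (simp add: lin_add[OF lc] lin_scale[OF lc] grouplike_def)
    then have "c g = - c 1" by (simp add: eq_neg_iff_add_eq_0 add.commute)
    then have "x = scale (c 1) (1 - g)" using e by (simp add: scale_right_diff_distrib)
    then show ?thesis ..
  qed
qed

lemma grouplike_one: "grouplike scale comult counit 1"
  by (simp add: grouplike_def comult_one counit_one)

text \<open>
  The point at which the hypothesis on \<open>H\<close> enters: in both cases \<open>x\<close> is a combination of group-like
  elements.
\<close>

lemma skew_primitive_trivial:
  assumes H: "finite_dimensional scale \<or> cosemisimple scale comult"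
    and char0: "\<And>n. n > 0 \<Longrightarrow> of_nat n \<noteq> (0::'k)"
    and g: "grouplike scale comult counit g"
    and x: "tensor_eq scale scale (comult x) {#(x, 1), (g, x)#}"
    and comm: "g * x = x * g"
  shows "\<exists>l. x = scale l (1 - g)"
  using H
proof
  assume fd: "finite_dimensional scale"
  then obtain s where s: "s > 0" "g ^ s = 1"
    using grouplike_finite_order[OF _ g] by blast
  have "g ^ i = g ^ (i mod s)" for i
  proof -
    have "g ^ i = (g ^ s) ^ (i div s) * g ^ (i mod s)"
      by (simp add: power_add[symmetric] power_mult[symmetric])
    then show ?thesis using s(2) by simp
  qed
  then have r: "range (\<lambda>i. g ^ i) = (\<lambda>i. g ^ i) ` {..<s}"
    using s(1) by (auto simp: image_iff) (metis lessThan_iff mod_less_divisor)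
  show ?thesis
  proof (rule skew_primitive_in_grouplike_span[OF _ _ _ _ x])
    show "finite (range (\<lambda>i. g ^ i))" unfolding r by simp
    show "1 \<in> range (\<lambda>i. g ^ i)" "g \<in> range (\<lambda>i. g ^ i)"
      by (auto intro: range_eqI[of _ _ 0] range_eqI[of _ _ 1])
    show "x \<in> span (range (\<lambda>i. g ^ i))"
      by (rule finite_dimensional_skew_primitive[OF fd char0 g x comm])
  qed (auto simp: grouplike_power[OF g])
next
  assume cs: "cosemisimple scale comult"
  show ?thesis
    by (rule skew_primitive_in_grouplike_span[OF _ _ _ _ x
          cosemisimple_skew_primitive[OF cs grouplike_one g x]])
      (auto simp: g grouplike_one)
qed

end


section \<open>Thin coalgebras\<close>

context vector_space
begin

lemma minimal_subspace_exists:
  assumes B: "finite B" and \<D>: "\<And>D. D \<in> \<D> \<Longrightarrow> subspace D \<and> D \<subseteq> span B" and "D0 \<in> \<D>"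
  shows "\<exists>D\<in>\<D>. \<forall>E\<in>\<D>. E \<subseteq> D \<longrightarrow> E = D"
proof -
  obtain D where D: "D \<in> \<D>" and least: "\<And>E. E \<in> \<D> \<Longrightarrow> dim D \<le> dim E"
    using ex_has_least_nat[of "\<lambda>D. D \<in> \<D>" D0 dim] assms(3) by blast
  have "E = D" if E: "E \<in> \<D>" "E \<subseteq> D" for E
  proof (rule ccontr)
    assume "E \<noteq> D"
    then obtain x where x: "x \<in> D" "x \<notin> E" using E by blast
    obtain bE where bE: "bE \<subseteq> E" "independent bE" "E \<subseteq> span bE" "card bE = dim E"
      by (rule basis_exists)
    obtain bD where bD: "bD \<subseteq> D" "independent bD" "D \<subseteq> span bD" "card bD = dim D"
      by (rule basis_exists)
    have fin: "finite bE" "finite bD"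
      using independent_span_bound[OF B bE(2)] independent_span_bound[OF B bD(2)] bE(1) bD(1) \<D> D E
      by blast+
    have "span bE \<subseteq> E" using bE(1) \<D>[OF E(1)] by (simp add: span_minimal)
    then have "x \<notin> span bE" using x by blast
    then have "independent (insert x bE)" "x \<notin> bE"
      using bE(2) span_base by (auto simp: independent_insert)
    then have "card (insert x bE) \<le> card bD"
      using independent_span_bound[OF fin(2), of "insert x bE"] x E bE bD by blast
    then show False using least[OF E(1)] bE(4) bD(4) fin \<open>x \<notin> bE\<close> by simp
  qed
  then show ?thesis using D by blast
qed

end

text \<open>
  A coalgebra on a subspace \<open>C\<close> of a vector space, described through the contractions of its
  comultiplication by functionals: these are the two commuting actions of the dual algebra on \<open>C\<close>.
\<close>

locale subspace_coalgebra = vector_space scale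
  for scale :: "'k::field \<Rightarrow> 'v::ab_group_add \<Rightarrow> 'v" +
  fixes comult :: "'v \<Rightarrow> ('v \<times> 'v) multiset" and counit :: "'v \<Rightarrow> 'k" and C :: "'v set"
  assumes C_subspace: "subspace C"
    and lin_left: "lin scale (*) f \<Longrightarrow> lin scale scale (lcontr scale comult f)"
    and lin_right: "lin scale (*) f \<Longrightarrow> lin scale scale (rcontr scale comult f)"
    and left_closed: "lin scale (*) f \<Longrightarrow> c \<in> C \<Longrightarrow> lcontr scale comult f c \<in> C"
    and right_closed: "lin scale (*) f \<Longrightarrow> c \<in> C \<Longrightarrow> rcontr scale comult f c \<in> C"
    and left_right: "lin scale (*) f \<Longrightarrow> lin scale (*) g \<Longrightarrow> c \<in> C \<Longrightarrow>
      lcontr scale comult f (rcontr scale comult g c) = rcontr scale comult g (lcontr scale comult f c)"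
    and lin_eps: "lin scale (*) counit"
    and left_counit: "c \<in> C \<Longrightarrow> lcontr scale comult counit c = c"
    and right_counit: "c \<in> C \<Longrightarrow> rcontr scale comult counit c = c"
begin

abbreviation lc :: "('v \<Rightarrow> 'k) \<Rightarrow> 'v \<Rightarrow> 'v" where "lc \<equiv> lcontr scale comult"
abbreviation rc :: "('v \<Rightarrow> 'k) \<Rightarrow> 'v \<Rightarrow> 'v" where "rc \<equiv> rcontr scale comult"

lemma pairing_left: "lin scale (*) g \<Longrightarrow> tsum (comult c) (\<lambda>x y. f x * g y) = g (lc f c)"
  by (simp add: lcontr_def lin_tsum_arg lin_scale)

lemma pairing_right: "lin scale (*) f \<Longrightarrow> tsum (comult c) (\<lambda>x y. f x * g y) = f (rc g c)"
  by (simp add: rcontr_def lin_tsum_arg lin_scale mult.commute)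

lemma pairing: "lin scale (*) f \<Longrightarrow> lin scale (*) g \<Longrightarrow> g (lc f c) = f (rc g c)"
  using pairing_left[of g c f] pairing_right[of f c g] by simp

text \<open>
  Iterated contraction is contraction by the convolution product; tested against functionals, this
  is a consequence of the commutation of the two actions.
\<close>

lemma left_left:
  assumes "lin scale (*) f" "lin scale (*) g" "c \<in> C"
  shows "lc g (lc f c) = lc (\<lambda>x. g (lc f x)) c"
proof (rule eq_by_functionals[OF vector_space_axioms])
  fix h assume h: "lin scale (*) h"
  have gf: "lin scale (*) (\<lambda>x. g (lc f x))" by (rule lin_compose[OF assms(2) lin_left[OF assms(1)]])
  have "h (lc g (lc f c)) = g (lc f (rc h c))"
    using pairing[OF assms(2) h] left_right[OF assms(1) h assms(3)] by simp
  also have "\<dots> = h (lc (\<lambda>x. g (lc f x)) c)"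
    using pairing[OF gf h] by simp
  finally show "h (lc g (lc f c)) = h (lc (\<lambda>x. g (lc f x)) c)" .
qed

definition biinvariant :: "'v set \<Rightarrow> bool"
  where "biinvariant D \<longleftrightarrow> subspace D \<and> D \<subseteq> C \<and>
    (\<forall>f d. lin scale (*) f \<longrightarrow> d \<in> D \<longrightarrow> lc f d \<in> D \<and> rc f d \<in> D)"

text \<open>
  The subcomodules of \<open>C\<close> for its right coaction on itself.
\<close>

definition coideal :: "'v set \<Rightarrow> bool"
  where "coideal W \<longleftrightarrow> subspace W \<and> W \<subseteq> C \<and> (\<forall>f w. lin scale (*) f \<longrightarrow> w \<in> W \<longrightarrow> rc f w \<in> W)"

text \<open>
  If \<open>D\<close> is stable under both actions and \<open>p\<close> is a projection onto \<open>D\<close>, then \<open>(p \<otimes> p) \<Delta>\<close> and \<open>\<Delta>\<close> agree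
  on \<open>D\<close>, which exhibits a representative of \<open>\<Delta>(d)\<close> with entries in \<open>D\<close>.
\<close>

lemma biinvariant_iff_subcoalgebra: "biinvariant D \<longleftrightarrow> subcoalgebra scale comult D \<and> D \<subseteq> C"
proof
  assume "subcoalgebra scale comult D \<and> D \<subseteq> C"
  then show "biinvariant D"
    unfolding biinvariant_def
    using lcontr_subcoalgebra(1,2)[of comult D] by (auto simp: subcoalgebra_def)
next
  assume D: "biinvariant D"
  then have sD: "subspace D" and DC: "D \<subseteq> C" by (auto simp: biinvariant_def)
  have "D \<inter> {0} \<subseteq> {0}" by blast
  then obtain p where p: "lin scale scale p" "\<And>x. p x \<in> D" "\<And>x. x \<in> D \<Longrightarrow> p x = x"
    using projection_onto[OF vector_space_axioms sD subspace_single_0] by metis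
  have "tensor_eq scale scale (comult d) (image_mset (map_prod p p) (comult d))" if d: "d \<in> D" for d
  proof (rule tensor_eqI[OF vector_space_axioms vector_space_axioms])
    fix f g assume fg: "lin scale (*) f" "lin scale (*) g"
    note fp = lin_compose[OF fg(1) p(1)] and gp = lin_compose[OF fg(2) p(1)]
    have "tsum (image_mset (map_prod p p) (comult d)) (\<lambda>x y. f x * g y) =
        tsum (comult d) (\<lambda>x y. f (p x) * g (p y))"
      by (simp add: tsum_map)
    also have "\<dots> = g (p (lc (\<lambda>x. f (p x)) d))"
      by (rule pairing_left[OF gp])
    also have "p (lc (\<lambda>x. f (p x)) d) = lc (\<lambda>x. f (p x)) d"
      using D d fp by (intro p(3)) (auto simp: biinvariant_def)
    also have "g \<dots> = f (p (rc g d))"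
      by (rule pairing[OF fp fg(2)])
    also have "p (rc g d) = rc g d"
      using D d fg by (intro p(3)) (auto simp: biinvariant_def)
    also have "f \<dots> = tsum (comult d) (\<lambda>x y. f x * g y)"
      by (rule pairing_right[OF fg(1), symmetric])
    finally show "tsum (comult d) (\<lambda>x y. f x * g y) =
        tsum (image_mset (map_prod p p) (comult d)) (\<lambda>x y. f x * g y)" ..
  qed
  moreover have "set_mset (image_mset (map_prod p p) (comult d)) \<subseteq> D \<times> D" for d
    using p(2) by auto
  ultimately show "subcoalgebra scale comult D \<and> D \<subseteq> C"
    unfolding subcoalgebra_def using sD DC by blast
qed

lemma biinvariant_contains_simple:
  assumes B: "finite B" "C \<subseteq> span B" and D: "biinvariant D" "D \<noteq> {0}"
  shows "\<exists>E. simple_subcoalgebra scale comult E \<and> E \<subseteq> D"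
proof -
  let ?\<D> = "{E. biinvariant E \<and> E \<noteq> {0} \<and> E \<subseteq> D}"
  have "\<exists>E\<in>?\<D>. \<forall>E'\<in>?\<D>. E' \<subseteq> E \<longrightarrow> E' = E"
  proof (rule minimal_subspace_exists[OF B(1)])
    show "D \<in> ?\<D>" using D by simp
  qed (use B(2) in \<open>auto simp: biinvariant_def\<close>)
  then obtain E where E: "biinvariant E" "E \<noteq> {0}" "E \<subseteq> D"
    and min: "\<And>E'. biinvariant E' \<Longrightarrow> E' \<noteq> {0} \<Longrightarrow> E' \<subseteq> E \<Longrightarrow> E' = E"
    by (metis (mono_tags, lifting) mem_Collect_eq subset_trans)
  have "E \<subseteq> C" using E(1) by (simp add: biinvariant_def)
  then have "simple_subcoalgebra scale comult E"
    unfolding simple_subcoalgebra_def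
  proof (intro conjI allI impI)
    show "subcoalgebra scale comult E" using E(1) by (simp add: biinvariant_iff_subcoalgebra)
    fix E' assume E': "subcoalgebra scale comult E' \<and> E' \<subseteq> E"
    then have "biinvariant E'" using \<open>E \<subseteq> C\<close> by (auto simp: biinvariant_iff_subcoalgebra)
    then show "E' = {0} \<or> E' = E" using min E' by blast
  qed (rule E(2))
  then show ?thesis using E by blast
qed

end

text \<open>
  A finite-dimensional coalgebra with one-dimensional coradical: every nonzero subcoalgebra contains a
  simple one, and this is the line of the group-like element \<open>e\<close>.
\<close>

locale connected_coalgebra = subspace_coalgebra +
  fixes e :: 'b and B :: "'b set"
  assumes finite_B: "finite B" and C_span: "C \<subseteq> span B"
    and e_in: "e \<in> C" and e_counit: "counit e = 1"
    and left_e: "lin scale (*) f \<Longrightarrow> lc f e = scale (f e) e"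
    and right_e: "lin scale (*) f \<Longrightarrow> rc f e = scale (f e) e"
    and unique: "biinvariant D \<Longrightarrow> D \<noteq> {0} \<Longrightarrow> e \<in> D"
begin

lemma e_nonzero: "e \<noteq> 0"
  using e_counit lin_zero[OF lin_eps] by auto

lemma minimal_coideal:
  assumes "P W0" "\<And>W. P W \<Longrightarrow> coideal W"
  obtains W where "P W" "W \<subseteq> W0" "\<And>V. P V \<Longrightarrow> V \<subseteq> W \<Longrightarrow> V = W"
proof -
  have "\<exists>W\<in>{W. P W \<and> W \<subseteq> W0}. \<forall>V\<in>{W. P W \<and> W \<subseteq> W0}. V \<subseteq> W \<longrightarrow> V = W"
  proof (rule minimal_subspace_exists[OF finite_B])
    show "W0 \<in> {W. P W \<and> W \<subseteq> W0}" using assms(1) by simp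
  next
    fix D assume "D \<in> {W. P W \<and> W \<subseteq> W0}"
    then have "coideal D" using assms(2) by simp
    then show "subspace D \<and> D \<subseteq> span B" using C_span unfolding coideal_def by blast
  qed
  then obtain W where W: "P W" "W \<subseteq> W0"
    and min: "\<forall>V\<in>{W. P W \<and> W \<subseteq> W0}. V \<subseteq> W \<longrightarrow> V = W"
    by blast
  show ?thesis
  proof (rule that[OF W])
    fix V assume "P V" "V \<subseteq> W"
    moreover from this have "V \<subseteq> W0" using W(2) by (rule_tac subset_trans)
    ultimately show "V = W" using min by simp
  qed
qed

lemma coideal_image:
  assumes "coideal W" "lin scale (*) f"
  shows "coideal (lc f ` W)"
  unfolding coideal_def
proof (intro conjI allI impI)
  note lf = lin_left[OF assms(2)]
  have sW: "subspace W" and WC: "W \<subseteq> C" using assms(1) by (auto simp: coideal_def)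
  show "subspace (lc f ` W)"
  proof (rule subspaceI)
    show "0 \<in> lc f ` W" using lin_zero[OF lf] subspace_0[OF sW] by force
  next
    fix x y assume "x \<in> lc f ` W" "y \<in> lc f ` W"
    then obtain v w where "x = lc f v" "y = lc f w" "v \<in> W" "w \<in> W" by blast
    then show "x + y \<in> lc f ` W"
      using lin_add[OF lf, of v w] subspace_add[OF sW, of v w] by (metis imageI)
  next
    fix c x assume "x \<in> lc f ` W"
    then obtain v where "x = lc f v" "v \<in> W" by blast
    then show "scale c x \<in> lc f ` W"
      using lin_scale[OF lf, of c v] subspace_scale[OF sW, of v c] by (metis imageI)
  qed
  show "lc f ` W \<subseteq> C" using WC left_closed[OF assms(2)] by blast
  fix g x assume g: "lin scale (*) g" and "x \<in> lc f ` W"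
  then obtain v where v: "x = lc f v" "v \<in> W" by blast
  then have "rc g x = lc f (rc g v)" using left_right[OF assms(2) g] WC by auto
  then show "rc g x \<in> lc f ` W" using v g assms(1) by (auto simp: coideal_def)
qed

lemma coideal_preimage:
  assumes W: "coideal W" and f: "lin scale (*) f"
    and V: "subspace V" "\<And>g v. lin scale (*) g \<Longrightarrow> v \<in> V \<Longrightarrow> rc g v \<in> V"
  shows "coideal {w \<in> W. lc f w \<in> V}"
  unfolding coideal_def
proof (intro conjI allI impI)
  note lf = lin_left[OF f]
  have sW: "subspace W" and WC: "W \<subseteq> C" using W by (auto simp: coideal_def)
  show "subspace {w \<in> W. lc f w \<in> V}"
    by (rule subspaceI) (auto simp: lin_zero[OF lf] lin_add[OF lf] lin_scale[OF lf] subspace_0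
        subspace_add subspace_scale sW V(1))
  show "{w \<in> W. lc f w \<in> V} \<subseteq> C" using WC by blast
  fix g w assume "lin scale (*) g" "w \<in> {w \<in> W. lc f w \<in> V}"
  then show "rc g w \<in> {w \<in> W. lc f w \<in> V}"
    using W V(2) left_right[OF f, of g w] WC by (auto simp: coideal_def)
qed

lemma span_e_closed: "lin scale (*) g \<Longrightarrow> v \<in> span {e} \<Longrightarrow> rc g v \<in> span {e}"
  using right_e lin_scale[OF lin_right] by (auto simp: span_singleton)

text \<open>
  If a sum of images of a right coideal under left contractions contains \<open>e\<close>, then one image does:
  a functional that is \<open>1\<close> at \<open>e\<close> and vanishes on one of the images removes that image.
\<close>

lemma e_in_sum_of_images:
  assumes W: "coideal W"
    and ps: "\<And>f w. (f, w) \<in> set ps \<Longrightarrow> lin scale (*) f \<and> w \<in> W"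
    and e: "e = (\<Sum>(f, w)\<leftarrow>ps. lc f w)"
  shows "\<exists>f. lin scale (*) f \<and> e \<in> lc f ` W"
  using ps e
proof (induction "length ps" arbitrary: ps)
  case 0
  then show ?case using e_nonzero by simp
next
  case (Suc n)
  then obtain f w ps' where ps': "ps = (f, w) # ps'" by (cases ps) auto
  have f: "lin scale (*) f" and w: "w \<in> W" using Suc.prems(1) ps' by auto
  have WC: "W \<subseteq> C" using W by (simp add: coideal_def)
  show ?case
  proof (cases "e \<in> lc f ` W")
    case False
    have co: "coideal (lc f ` W)" by (rule coideal_image[OF W f])
    then have "subspace (lc f ` W)" by (simp add: coideal_def)
    then obtain p where p: "lin scale (*) p" "p e = 1" "\<And>v. v \<in> lc f ` W \<Longrightarrow> p v = 0"
      using separating_functional[OF vector_space_axioms _ False] by blast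
    have zero: "lc p (lc f w) = 0"
    proof (rule eq_by_functionals[OF vector_space_axioms])
      fix h assume h: "lin scale (*) h"
      have "h (lc p (lc f w)) = p (rc h (lc f w))" by (rule pairing[OF p(1) h])
      also have "\<dots> = 0" using co h w by (intro p(3)) (auto simp: coideal_def)
      finally show "h (lc p (lc f w)) = h 0" by (simp add: lin_zero[OF h])
    qed
    define qs where "qs = map (\<lambda>(f, w). (\<lambda>x. p (lc f x), w)) ps'"
    note lp = lin_left[OF p(1)]
    have "lc p (\<Sum>(f, w)\<leftarrow>ps'. lc f w) = (\<Sum>(f, w)\<leftarrow>qs. lc f w)"
      if "\<And>f w. (f, w) \<in> set ps' \<Longrightarrow> lin scale (*) f \<and> w \<in> W"
      using that unfolding qs_def
    proof (induction ps')
      case (Cons q ps')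
      obtain f' w' where q: "q = (f', w')" by force
      have "lc p (lc f' w') = lc (\<lambda>x. p (lc f' x)) w'"
        using Cons.prems[of f' w'] q WC by (intro left_left p(1)) auto
      moreover have "lc p (\<Sum>(f, w)\<leftarrow>ps'. lc f w) =
          (\<Sum>(f, w)\<leftarrow>map (\<lambda>(f, w). (\<lambda>x. p (lc f x), w)) ps'. lc f w)"
        by (rule Cons.IH) (use Cons.prems in auto)
      ultimately show ?case using q by (simp add: lin_add[OF lp])
    qed (simp add: lin_zero[OF lp])
    then have 1: "lc p (\<Sum>(f, w)\<leftarrow>ps'. lc f w) = (\<Sum>(f, w)\<leftarrow>qs. lc f w)"
      using Suc.prems(1) ps' by auto
    have "e = lc p e" using left_e[OF p(1)] p(2) by simp
    also have "\<dots> = lc p (lc f w + (\<Sum>(f, w)\<leftarrow>ps'. lc f w))"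
      using Suc.prems(2) ps' by simp
    also have "\<dots> = (\<Sum>(f, w)\<leftarrow>qs. lc f w)"
      unfolding lin_add[OF lp] zero 1 by simp
    finally have 2: "e = (\<Sum>(f, w)\<leftarrow>qs. lc f w)" .
    have 3: "lin scale (*) f' \<and> w' \<in> W" if q: "(f', w') \<in> set qs" for f' w'
    proof -
      obtain f'' where "(f'', w') \<in> set ps'" "f' = (\<lambda>x. p (lc f'' x))"
        using q by (auto simp: qs_def)
      then show ?thesis using Suc.prems(1) ps' lin_compose[OF p(1) lin_left] by auto
    qed
    show ?thesis by (rule Suc.hyps(1)[OF _ 3 2]) (use Suc.hyps(2) ps' in \<open>auto simp: qs_def\<close>)
  qed (use f in blast)
qed

text \<open>
  The images of a minimal right coideal \<open>W\<close> under left contractions add up to a subcoalgebra, which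
  contains \<open>e\<close>. So \<open>W\<close> is isomorphic to the line of \<open>e\<close> and hence equal to it.
\<close>

lemma coideal_contains_e:
  assumes W0: "coideal W0" "W0 \<noteq> {0}"
  shows "e \<in> W0"
proof -
  obtain W where "coideal W \<and> W \<noteq> {0}" and WW0: "W \<subseteq> W0"
    and min: "\<And>V. coideal V \<and> V \<noteq> {0} \<Longrightarrow> V \<subseteq> W \<Longrightarrow> V = W"
    using minimal_coideal[of "\<lambda>W. coideal W \<and> W \<noteq> {0}" W0] W0 by blast
  then have W: "coideal W" "W \<noteq> {0}" by auto
  then have sW: "subspace W" and WC: "W \<subseteq> C" by (auto simp: coideal_def)
  \<comment> \<open>The sum of all images of \<open>W\<close> under left contractions.\<close>
  define D where "D = {v. \<exists>ps. (\<forall>(f, w)\<in>set ps. lin scale (*) f \<and> w \<in> W) \<and> v = (\<Sum>(f, w)\<leftarrow>ps. lc f w)}"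
  have D_lc: "lc f w \<in> D" if "lin scale (*) f" "w \<in> W" for f w
    unfolding D_def using that by (intro CollectI exI[of _ "[(f, w)]"]) auto
  have D_add: "x + y \<in> D" if "x \<in> D" "y \<in> D" for x y
  proof -
    obtain ps qs where "\<forall>(f, w)\<in>set ps. lin scale (*) f \<and> w \<in> W" "x = (\<Sum>(f, w)\<leftarrow>ps. lc f w)"
      "\<forall>(f, w)\<in>set qs. lin scale (*) f \<and> w \<in> W" "y = (\<Sum>(f, w)\<leftarrow>qs. lc f w)"
      using \<open>x \<in> D\<close> \<open>y \<in> D\<close> unfolding D_def by blast
    then show ?thesis unfolding D_def by (intro CollectI exI[of _ "ps @ qs"]) auto
  qed
  have D_0: "0 \<in> D" unfolding D_def by (intro CollectI exI[of _ "[]"]) auto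
  have D_ind: "v \<in> D \<Longrightarrow> Q 0 \<Longrightarrow> (\<And>f w v. lin scale (*) f \<Longrightarrow> w \<in> W \<Longrightarrow> Q v \<Longrightarrow> Q (lc f w + v)) \<Longrightarrow> Q v"
    for v Q
  proof -
    assume "v \<in> D" and Q: "Q 0" "\<And>f w v. lin scale (*) f \<Longrightarrow> w \<in> W \<Longrightarrow> Q v \<Longrightarrow> Q (lc f w + v)"
    then obtain ps where ps: "\<forall>(f, w)\<in>set ps. lin scale (*) f \<and> w \<in> W" "v = (\<Sum>(f, w)\<leftarrow>ps. lc f w)"
      unfolding D_def by blast
    show "Q v" unfolding ps(2) using ps(1) by (induction ps) (auto simp: Q)
  qed
  have "biinvariant D"
    unfolding biinvariant_def
  proof (intro conjI allI impI)
    show "subspace D"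
    proof (rule subspaceI)
      fix c x assume "x \<in> D"
      then show "scale c x \<in> D"
      proof (rule D_ind)
        fix f w v assume "lin scale (*) f" "w \<in> W" "scale c v \<in> D"
        then show "scale c (lc f w + v) \<in> D"
          using D_add[OF D_lc[of f "scale c w"]] subspace_scale[OF sW] lin_scale[OF lin_left]
          by (simp add: scale_right_distrib)
      qed (simp add: D_0)
    qed (auto intro: D_0 D_add)
    show "D \<subseteq> C"
    proof
      fix x assume "x \<in> D"
      then show "x \<in> C"
        by (rule D_ind) (use WC C_subspace left_closed in \<open>auto intro: subspace_0 subspace_add\<close>)
    qed
    fix g x assume g: "lin scale (*) g" and x: "x \<in> D"
    show "lc g x \<in> D"
      using x
    proof (rule D_ind)
      fix f w v assume f: "lin scale (*) f" and w: "w \<in> W" and v: "lc g v \<in> D"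
      have "lc g (lc f w) = lc (\<lambda>x. g (lc f x)) w" using w WC by (intro left_left f g) auto
      moreover have "lin scale (*) (\<lambda>x. g (lc f x))" by (rule lin_compose[OF g lin_left[OF f]])
      ultimately show "lc g (lc f w + v) \<in> D"
        using v w by (simp add: lin_add[OF lin_left[OF g]] D_add D_lc)
    qed (simp add: lin_zero[OF lin_left[OF g]] D_0)
    show "rc g x \<in> D"
      using x
    proof (rule D_ind)
      fix f w v assume f: "lin scale (*) f" and w: "w \<in> W" and v: "rc g v \<in> D"
      have "rc g (lc f w) = lc f (rc g w)" using left_right[OF f g, of w] w WC by auto
      moreover have "rc g w \<in> W" using W g w by (auto simp: coideal_def)
      ultimately show "rc g (lc f w + v) \<in> D"
        using v f by (simp add: lin_add[OF lin_right[OF g]] D_add D_lc)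
    qed (simp add: lin_zero[OF lin_right[OF g]] D_0)
  qed
  moreover have "D \<noteq> {0}"
  proof -
    obtain w where "w \<in> W" "w \<noteq> 0" using W subspace_0[OF sW] by blast
    then show ?thesis using D_lc[OF lin_eps, of w] left_counit WC by auto
  qed
  ultimately have "e \<in> D" by (rule unique)
  then obtain ps where "\<And>f w. (f, w) \<in> set ps \<Longrightarrow> lin scale (*) f \<and> w \<in> W"
      "e = (\<Sum>(f, w)\<leftarrow>ps. lc f w)"
    unfolding D_def by blast
  then obtain f w0 where f: "lin scale (*) f" and w0: "w0 \<in> W" "lc f w0 = e"
    using e_in_sum_of_images[OF W(1)] by (metis imageE)
  note lf = lin_left[OF f]
  have w00: "w0 \<noteq> 0" using w0 e_nonzero lin_zero[OF lf] by auto
  \<comment> \<open>By minimality \<open>lc f\<close> is injective on \<open>W\<close> and maps it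
    onto the line of \<open>e\<close>.\<close>
  have ker: "w = 0" if w: "w \<in> W" "lc f w = 0" for w
  proof (rule ccontr)
    assume "w \<noteq> 0"
    have "coideal {w \<in> W. lc f w \<in> {0}}"
      by (rule coideal_preimage[OF W(1) f subspace_single_0])
        (use lin_zero[OF lin_right] in auto)
    then have "{w \<in> W. lc f w \<in> {0}} = W"
      using w \<open>w \<noteq> 0\<close> by (intro min) auto
    then show False using w0 e_nonzero by auto
  qed
  have line: "\<exists>c. w = scale c w0" if "w \<in> W" for w
  proof -
    have "coideal {w \<in> W. lc f w \<in> span {e}}"
      by (rule coideal_preimage[OF W(1) f subspace_span span_e_closed])
    moreover have "w0 \<in> {w \<in> W. lc f w \<in> span {e}}" using w0 by (auto intro: span_base)
    ultimately have "{w \<in> W. lc f w \<in> span {e}} = W"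
      using w00 by (intro min) auto
    then have "lc f w \<in> span {e}" using that by blast
    then obtain c where "lc f w = scale c e" by (auto simp: span_singleton)
    then have "lc f (w - scale c w0) = 0"
      using w0 by (simp add: lin_diff[OF lf] lin_scale[OF lf])
    then have "w - scale c w0 = 0"
      by (rule ker[OF subspace_diff[OF sW that subspace_scale[OF sW w0(1)]]])
    then show ?thesis by (intro exI[of _ c]) simp
  qed
  \<comment> \<open>So \<open>w0\<close> transforms like \<open>e\<close> and is a multiple of it.\<close>
  have eig: "rc h w0 = scale (h e) w0" if h: "lin scale (*) h" for h
  proof -
    have "rc h w0 \<in> W" using W h w0 by (auto simp: coideal_def)
    then obtain c where c: "rc h w0 = scale c w0" using line by blast
    have "scale c e = lc f (rc h w0)" using c w0 lin_scale[OF lf] by simp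
    also have "\<dots> = rc h e" using left_right[OF f h, of w0] w0 WC by auto
    also have "\<dots> = scale (h e) e" by (rule right_e[OF h])
    finally show ?thesis using c e_nonzero scale_right_imp_eq by blast
  qed
  have "w0 = scale (counit w0) e"
  proof (rule eq_by_functionals[OF vector_space_axioms])
    fix h assume h: "lin scale (*) h"
    have "h w0 = h (lc counit w0)" using left_counit w0 WC by auto
    also have "\<dots> = counit (rc h w0)" by (rule pairing[OF lin_eps h])
    also have "\<dots> = h (scale (counit w0) e)"
      by (simp add: eig[OF h] lin_scale[OF lin_eps] lin_scale[OF h])
    finally show "h w0 = h (scale (counit w0) e)" .
  qed
  moreover from this have "counit w0 \<noteq> 0" using w00 by auto
  moreover have "scale (1 / counit w0) w0 \<in> W" by (rule subspace_scale[OF sW w0(1)])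
  ultimately have "e \<in> W" by (metis nonzero_divide_eq_eq scale_one scale_scale)
  then show ?thesis using WW0 by blast
qed

text \<open>
  In a minimal right coideal \<open>W\<close> properly containing the line of \<open>e\<close>, every left contraction by a
  functional that vanishes at \<open>e\<close> sends \<open>W\<close> into that line, by the previous lemma and minimality.
\<close>

lemma coideal_contains_primitive:
  assumes W0: "coideal W0" "e \<in> W0" "W0 \<noteq> span {e}"
  shows "\<exists>w\<in>W0. w \<notin> span {e} \<and> tensor_eq scale scale (comult w) {#(w, e), (e, w)#}"
proof -
  obtain W where "coideal W \<and> e \<in> W \<and> W \<noteq> span {e}" and WW0: "W \<subseteq> W0"
    and min: "\<And>V. coideal V \<and> e \<in> V \<and> V \<noteq> span {e} \<Longrightarrow> V \<subseteq> W \<Longrightarrow> V = W"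
    using minimal_coideal[of "\<lambda>W. coideal W \<and> e \<in> W \<and> W \<noteq> span {e}" W0] W0 by blast
  then have W: "coideal W" "e \<in> W" "W \<noteq> span {e}" by auto
  then have sW: "subspace W" and WC: "W \<subseteq> C" by (auto simp: coideal_def)
  have eW: "span {e} \<subseteq> W" using W(2) sW by (simp add: span_minimal)
  have le: "\<exists>c. lc f w = scale c e" if f: "lin scale (*) f" "f e = 0" and w: "w \<in> W" for f w
  proof (cases "lc f ` W = {0}")
    case True
    then show ?thesis using w by (intro exI[of _ 0]) auto
  next
    case False
    have "e \<in> lc f ` W" by (rule coideal_contains_e[OF coideal_image[OF W(1) f(1)] False])
    then obtain v where v: "v \<in> W" "lc f v = e" by auto
    have fe: "lc f e = 0" using left_e[OF f(1)] f(2) by simp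
    have "v \<notin> span {e}"
    proof
      assume "v \<in> span {e}"
      then obtain k where "v = scale k e" by (auto simp: span_singleton)
      then have "lc f v = 0" using fe lin_scale[OF lin_left[OF f(1)], of k e] by simp
      then show False using v e_nonzero by simp
    qed
    moreover have "coideal {w \<in> W. lc f w \<in> span {e}}"
      by (rule coideal_preimage[OF W(1) f(1) subspace_span span_e_closed])
    ultimately have "{w \<in> W. lc f w \<in> span {e}} = W"
      using v fe W(2) by (intro min) (auto intro: span_base span_zero)
    then have "lc f w \<in> span {e}" using w by blast
    then show ?thesis by (auto simp: span_singleton)
  qed
  obtain w where w: "w \<in> W" "w \<notin> span {e}" using W eW by blast
  define w1 where "w1 = w - scale (counit w) e"
  have w1W: "w1 \<in> W" unfolding w1_def using w W sW by (intro subspace_diff subspace_scale)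
  have w1e: "w1 \<notin> span {e}"
    using w span_add[of w1 "{e}" "scale (counit w) e"] span_scale[OF span_base[of e "{e}"]]
    by (auto simp: w1_def)
  have cw1: "counit w1 = 0"
    by (simp add: w1_def lin_diff[OF lin_eps] lin_scale[OF lin_eps] e_counit)
  have th: "lc f w1 = scale (f w1) e + scale (f e) w1" if f: "lin scale (*) f" for f
  proof -
    \<comment> \<open>Correct \<open>f\<close> by the counit so that it vanishes at
      \<open>e\<close>.\<close>
    define f' where "f' x = f x - f e * counit x" for x
    have f': "lin scale (*) f'" "f' e = 0"
      unfolding f'_def by (auto intro!: linI simp: e_counit lin_add[OF f] lin_scale[OF f]
          lin_add[OF lin_eps] lin_scale[OF lin_eps] algebra_simps)
    obtain c where c: "lc f' w1 = scale c e" using le[OF f' w1W] by blast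
    have "c = counit (lc f' w1)" by (simp add: c lin_scale[OF lin_eps] e_counit)
    also have "\<dots> = f' (rc counit w1)" by (rule pairing[OF f'(1) lin_eps])
    also have "\<dots> = f w1" using right_counit w1W WC by (simp add: subset_iff f'_def cw1)
    finally have "lc f' w1 = scale (f w1) e" using c by simp
    moreover have "lc f' w1 =
        tsum (comult w1) (\<lambda>x y. scale (f x) y - scale (f e) (scale (counit x) y))"
      by (simp add: lcontr_def f'_def scale_left_diff_distrib)
    moreover have "\<dots> = lc f w1 - scale (f e) (lc counit w1)"
      unfolding lcontr_def tsum_minus
        lin_tsum_arg[OF lin_scale_const[OF vector_space_axioms lin_id]] ..
    ultimately show ?thesis using left_counit w1W WC by (simp add: subset_iff algebra_simps)
  qed
  have "tensor_eq scale scale (comult w1) {#(w1, e), (e, w1)#}"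
  proof (rule tensor_eqI[OF vector_space_axioms vector_space_axioms])
    fix f g assume fg: "lin scale (*) f" "lin scale (*) g"
    show "tsum (comult w1) (\<lambda>x y. f x * g y) = tsum {#(w1, e), (e, w1)#} (\<lambda>x y. f x * g y)"
      by (simp add: pairing_left[OF fg(2)] th[OF fg(1)] lin_add[OF fg(2)] lin_scale[OF fg(2)])
  qed
  then show ?thesis using w1W w1e WW0 by blast
qed

end

text \<open>
  If the primitive elements form a line, contraction by a functional \<open>t\<close> that is \<open>1\<close> on this line and
  \<open>0\<close> at \<open>e\<close> is nilpotent with kernel the line of \<open>e\<close>, that is, a single Jordan block.
\<close>

locale thin_coalgebra = connected_coalgebra +
  fixes y :: 'b and t :: "'b \<Rightarrow> 'a"
  assumes lin_t: "lin scale (*) t" and t_e: "t e = 0" and t_y: "t y = 1"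
    and primitives_line:
      "w \<in> C \<Longrightarrow> tensor_eq scale scale (comult w) {#(w, e), (e, w)#} \<Longrightarrow> w \<in> span {y}"
begin

lemma lin_lc_t: "lin scale scale (lc t ^^ n)"
  by (rule lin_funpow[OF lin_left[OF lin_t]])

lemma lc_t_closed: "c \<in> C \<Longrightarrow> (lc t ^^ n) c \<in> C"
  by (induction n) (auto simp: left_closed[OF lin_t])

lemma lc_t_e: "lc t e = 0"
  using left_e[OF lin_t] t_e by simp

text \<open>
  A primitive element of the kernel is a multiple \<open>c y\<close> with \<open>c = t(c y) = 0\<close>. So the kernel, which is a
  right coideal, contains no primitive elements outside the line of \<open>e\<close>.
\<close>

lemma lc_t_kernel:
  assumes "c \<in> C" "lc t c = 0"
  shows "c \<in> span {e}"
proof -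
  let ?W = "{c \<in> C. lc t c \<in> {0}}"
  have "coideal C"
    using C_subspace right_closed by (auto simp: coideal_def)
  then have W: "coideal ?W"
    by (rule coideal_preimage[OF _ lin_t subspace_single_0]) (use lin_zero[OF lin_right] in auto)
  have "?W = span {e}"
  proof (rule ccontr)
    assume "?W \<noteq> span {e}"
    then obtain w where w: "w \<in> ?W" "w \<notin> span {e}"
        "tensor_eq scale scale (comult w) {#(w, e), (e, w)#}"
      using coideal_contains_primitive[OF W] e_in lc_t_e by blast
    then obtain c where c: "w = scale c y"
      using primitives_line[of w] by (auto simp: span_singleton)
    have "bilin scale scale scale (\<lambda>a b. scale (t a) b)"
      by (intro bilinI lin_rules lin_t vector_space_axioms)
    from tensor_eq_tsum[OF w(3) this] have "lc t w = scale (t w) e + scale (t e) w"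
      by (simp add: lcontr_def)
    then have "c = 0" using w(1) e_nonzero by (simp add: t_e c lin_scale[OF lin_t] t_y)
    then show False using w(2) c span_zero by simp
  qed
  then show ?thesis using assms by blast
qed

text \<open>
  The images of the powers of \<open>D\<close> are right coideals. On the smallest one \<open>D\<close> is onto; if it is not
  zero, it contains \<open>e\<close>, hence elements \<open>v\<^sub>n\<close> with \<open>D\<^sup>n(v\<^sub>n) = e\<close> for all \<open>n\<close>, which are too many.
\<close>

lemma lc_t_nilpotent: "\<exists>k. \<forall>c\<in>C. (lc t ^^ k) c = 0"
proof -
  let ?V = "\<lambda>k. (lc t ^^ k) ` C"
  have V: "coideal (?V k)" for k
  proof (induction k)
    case 0
    then show ?case using C_subspace right_closed by (auto simp: coideal_def)
  next
    case (Suc k)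
    then show ?case using coideal_image[OF _ lin_t, of "?V k"] by (simp add: image_comp)
  qed
  have "\<exists>D\<in>range ?V. \<forall>E\<in>range ?V. E \<subseteq> D \<longrightarrow> E = D"
  proof (rule minimal_subspace_exists[OF finite_B])
    fix D assume "D \<in> range ?V"
    then have "coideal D" using V by blast
    then show "subspace D \<and> D \<subseteq> span B" using C_span unfolding coideal_def by blast
  qed (rule rangeI[of _ 0])
  then obtain D where D: "D \<in> range ?V" "\<forall>E\<in>range ?V. E \<subseteq> D \<longrightarrow> E = D"
    by (elim bexE)
  then obtain k where kD: "D = ?V k" by (elim rangeE)
  have k: "?V j = ?V k" if "?V j \<subseteq> ?V k" for j
    using bspec[OF D(2) rangeI[of ?V j]] that unfolding kD by simp
  have "?V (Suc k) \<subseteq> ?V k"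
    using left_closed[OF lin_t] by (auto simp: funpow_Suc_right simp del: funpow.simps)
  then have surj: "lc t ` ?V k = ?V k" using k[of "Suc k"] by (simp add: image_comp)
  have "?V k = {0}"
  proof (rule ccontr)
    assume "?V k \<noteq> {0}"
    then have eV: "e \<in> ?V k" by (rule coideal_contains_e[OF V])
    have "\<exists>v. \<forall>n. (v n \<in> ?V k \<and> (lc t ^^ n) (v n) = e \<and> (lc t ^^ Suc n) (v n) = 0)"
    proof (rule choice, rule allI)
      fix n
      show "\<exists>v. v \<in> ?V k \<and> (lc t ^^ n) v = e \<and> (lc t ^^ Suc n) v = 0"
      proof (induction n)
        case 0
        then show ?case using eV lc_t_e by (intro exI[of _ e]) auto
      next
        case (Suc n)
        then obtain v where v: "v \<in> ?V k" "(lc t ^^ n) v = e" "(lc t ^^ Suc n) v = 0" by blast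
        obtain w where "w \<in> ?V k" "v = lc t w" using v(1) surj by blast
        then show ?case using v by (intro exI[of _ w]) (simp add: funpow_Suc_right del: funpow.simps)
      qed
    qed
    then obtain v where v: "\<And>n. v n \<in> ?V k" "\<And>n. (lc t ^^ n) (v n) = e"
        "\<And>n. (lc t ^^ Suc n) (v n) = 0"
      by blast
    have "v n \<in> span B" for n 
      using v(1)[of n] V[of k] C_span unfolding coideal_def by (meson subsetD)
    then show False
      using no_infinite_ladder[OF vector_space_axioms finite_B _ lin_left[OF lin_t], of v] v e_nonzero
      by simp
  qed
  then show ?thesis by (intro exI[of _ k]) blast
qed

text \<open>
  The Jordan block provides a chain that ends in \<open>e\<close>. Once the counits of its other members are
  normalised to zero, it is dual to the functionals \<open>c \<mapsto> \<epsilon>(D\<^sup>i(c))\<close>, where \<open>D\<close> is contraction by \<open>t\<close>.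
\<close>

lemma divided_power_basis:
  "\<exists>E L. E 0 = e \<and> (\<forall>i\<le>L. E i \<in> C) \<and>
    (\<forall>i<L. lc t (E (Suc i)) = E i \<and> counit (E (Suc i)) = 0) \<and>
    (\<forall>c\<in>C. (lc t ^^ Suc L) c = 0 \<and> c = (\<Sum>i\<le>L. scale (counit ((lc t ^^ i) c)) (E i))) \<and>
    (\<forall>N. has_dim scale C N \<longrightarrow> N = Suc L)"
proof -
  obtain k where k: "\<And>c. c \<in> C \<Longrightarrow> (lc t ^^ k) c = 0" using lc_t_nilpotent by blast
  have kz: "(lc t ^^ j) c = 0" if "c \<in> C" "k \<le> j" for c j
  proof -
    have "(lc t ^^ j) c = (lc t ^^ (j - k)) ((lc t ^^ k) c)"
      using that(2) by (metis comp_apply funpow_add le_add_diff_inverse2)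
    then show ?thesis using k[OF that(1)] lin_zero[OF lin_lc_t] by simp
  qed
  \<comment> \<open>The length of the longest chain that ends in \<open>e\<close>.\<close>
  define L where "L = (GREATEST m. \<exists>d\<in>C. (lc t ^^ m) d = e)"
  have bound: "m \<le> k" if "\<exists>d\<in>C. (lc t ^^ m) d = e" for m
    using that kz e_nonzero by (metis linear)
  have "\<exists>d\<in>C. (lc t ^^ 0) d = e" using e_in by auto
  then have "\<exists>d\<in>C. (lc t ^^ L) d = e"
    unfolding L_def by (rule GreatestI_nat) (use bound in blast)
  then obtain d where d: "d \<in> C" "(lc t ^^ L) d = e" by blast
  have L: "m \<le> L" if "d \<in> C" "(lc t ^^ m) d = e" for m d
    unfolding L_def by (rule Greatest_le_nat[of _ _ k]) (use bound that in blast)+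
  \<comment> \<open>The last nonzero \<open>D\<^sup>m(x)\<close> is a multiple of
    \<open>e\<close>, which its counit detects.\<close>
  have vanish: "x = 0" if x: "x \<in> C" and j: "\<And>j. j \<le> L \<Longrightarrow> counit ((lc t ^^ j) x) = 0" for x
  proof (rule ccontr)
    assume "x \<noteq> 0"
    define m where "m = (LEAST m. (lc t ^^ m) x = 0)"
    have m: "(lc t ^^ m) x = 0" unfolding m_def by (rule LeastI[of _ k]) (rule k[OF x])
    then obtain i where i: "m = Suc i" using \<open>x \<noteq> 0\<close> by (cases m) auto
    have "(lc t ^^ i) x \<noteq> 0" using not_less_Least[of i "\<lambda>m. (lc t ^^ m) x = 0"] i by (auto simp: m_def)
    moreover have "(lc t ^^ i) x \<in> span {e}"
      using m i lc_t_closed[OF x] by (intro lc_t_kernel) auto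
    ultimately obtain a where a: "(lc t ^^ i) x = scale a e" "a \<noteq> 0" by (auto simp: span_singleton)
    then have "(lc t ^^ i) (scale (1 / a) x) = e" by (simp add: lin_scale[OF lin_lc_t])
    then have "i \<le> L" using x C_subspace by (intro L[of "scale (1 / a) x"]) (auto intro: subspace_scale)
    then show False using j[of i] a by (simp add: lin_scale[OF lin_eps] e_counit)
  qed
  have top: "(lc t ^^ Suc L) c = 0" if c: "c \<in> C" for c
  proof (rule vanish)
    show "(lc t ^^ Suc L) c \<in> C" by (rule lc_t_closed[OF c])
    fix j
    show "counit ((lc t ^^ j) ((lc t ^^ Suc L) c)) = 0"
    proof (rule ccontr)
      assume "\<not> ?thesis"
      then have nz: "(lc t ^^ (j + Suc L)) c \<noteq> 0"
        unfolding funpow_add o_apply using lin_zero[OF lin_eps] by metis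
      define m where "m = (LEAST m. (lc t ^^ m) c = 0)"
      have m: "(lc t ^^ m) c = 0" unfolding m_def by (rule LeastI[of _ k]) (rule k[OF c])
      have gt: "Suc L < m"
      proof (rule ccontr)
        assume "\<not> Suc L < m"
        then have "j + Suc L = (j + Suc L - m) + m" by simp
        then have "(lc t ^^ (j + Suc L)) c = (lc t ^^ (j + Suc L - m)) ((lc t ^^ m) c)"
          by (metis comp_apply funpow_add)
        then show False using nz m lin_zero[OF lin_lc_t] by simp
      qed
      then obtain i where i: "m = Suc i" by (cases m) auto
      have "(lc t ^^ i) c \<noteq> 0"
        using not_less_Least[of i "\<lambda>m. (lc t ^^ m) c = 0"] i by (auto simp: m_def)
      moreover have "(lc t ^^ i) c \<in> span {e}"
        using m i lc_t_closed[OF c] by (intro lc_t_kernel) auto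
      ultimately obtain a where a: "(lc t ^^ i) c = scale a e" "a \<noteq> 0" by (auto simp: span_singleton)
      then have "(lc t ^^ i) (scale (1 / a) c) = e" by (simp add: lin_scale[OF lin_lc_t])
      then have "i \<le> L" using c C_subspace by (intro L[of "scale (1 / a) c"]) (auto intro: subspace_scale)
      then show False using gt i by simp
    qed
  qed
  have "\<exists>E. E 0 = e \<and> (\<forall>i\<le>n. E i \<in> (lc t ^^ (L - i)) ` C) \<and>
      (\<forall>i<n. lc t (E (Suc i)) = E i \<and> counit (E (Suc i)) = 0)" if "n \<le> L" for n
    using that
  proof (induction n)
    case 0
    then show ?case using d by (intro exI[of _ "\<lambda>_. e"]) auto
  next
    case (Suc n)
    then obtain E where E: "E 0 = e" "\<forall>i\<le>n. E i \<in> (lc t ^^ (L - i)) ` C"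
        "\<forall>i<n. lc t (E (Suc i)) = E i \<and> counit (E (Suc i)) = 0"
      by auto
    obtain m where m: "L - n = Suc m" "L - Suc n = m" using Suc.prems by (metis Suc_diff_Suc Suc_le_eq)
    obtain u where u: "u \<in> C" "E n = (lc t ^^ Suc m) u" using E(2) m by auto
    have em: "(lc t ^^ m) ((lc t ^^ Suc n) d) = e"
    proof -
      have "L = m + Suc n" using m Suc.prems by simp
      then show ?thesis using d(2) by (simp only: funpow_add o_def)
    qed
    \<comment> \<open>Adding a multiple of \<open>e\<close>, which \<open>D\<close> kills, makes
      the counit of the new basis element zero.\<close>
    define u' where "u' = u - scale (counit ((lc t ^^ m) u)) ((lc t ^^ Suc n) d)"
    have u': "u' \<in> C"
      unfolding u'_def using u d lc_t_closed C_subspace by (intro subspace_diff subspace_scale)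
    have x: "(lc t ^^ m) u' = (lc t ^^ m) u - scale (counit ((lc t ^^ m) u)) e"
      unfolding u'_def using em by (simp add: lin_diff[OF lin_lc_t] lin_scale[OF lin_lc_t] del: funpow.simps)
    have 1: "lc t ((lc t ^^ m) u') = E n"
      unfolding x using u(2) lc_t_e
      by (simp add: lin_diff[OF lin_left[OF lin_t]] lin_scale[OF lin_left[OF lin_t]])
    have 2: "counit ((lc t ^^ m) u') = 0"
      unfolding x by (simp add: lin_diff[OF lin_eps] lin_scale[OF lin_eps] e_counit)
    define E' where "E' = E(Suc n := (lc t ^^ m) u')"
    have "E' 0 = e" "\<forall>i\<le>Suc n. E' i \<in> (lc t ^^ (L - i)) ` C"
      "\<forall>i<Suc n. lc t (E' (Suc i)) = E' i \<and> counit (E' (Suc i)) = 0"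
      unfolding E'_def using E 1 2 u' m(2) by (auto simp: le_Suc_eq less_Suc_eq)
    then show ?case by blast
  qed
  from this[OF order_refl] obtain E where E': "E 0 = e \<and> (\<forall>i\<le>L. E i \<in> (lc t ^^ (L - i)) ` C) \<and>
      (\<forall>i<L. lc t (E (Suc i)) = E i \<and> counit (E (Suc i)) = 0)"
    by (elim exE)
  have E: "E 0 = e" "\<And>i. i \<le> L \<Longrightarrow> E i \<in> (lc t ^^ (L - i)) ` C"
      "\<And>i. i < L \<Longrightarrow> lc t (E (Suc i)) = E i" "\<And>i. i < L \<Longrightarrow> counit (E (Suc i)) = 0"
    using E' by simp_all
  have EC: "E i \<in> C" if "i \<le> L" for i
    using E(2)[OF that] by (elim imageE) (simp add: lc_t_closed)
  have down: "(lc t ^^ j) (E i) = (if j \<le> i then E (i - j) else 0)" if "i \<le> L" for i j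
    using that
  proof (induction j arbitrary: i)
    case (Suc j)
    show ?case
    proof (cases i)
      case 0
      then show ?thesis
        using lin_zero[OF lin_lc_t] by (simp add: E(1) lc_t_e funpow_Suc_right del: funpow.simps)
    next
      case (Suc i')
      then show ?thesis
        using Suc.IH[of i'] Suc.prems E(3)[of i'] by (simp add: funpow_Suc_right del: funpow.simps)
    qed
  qed simp
  have dual: "counit ((lc t ^^ j) (E i)) = (if i = j then 1 else 0)" if "i \<le> L" for i j
  proof -
    consider "j > i" | "i = j" | "j < i" by linarith
    then show ?thesis
    proof cases
      case 3
      then have "i - j = Suc (i - Suc j)" "i - Suc j < L" using that by simp_all
      then have "counit (E (i - j)) = 0" using E(4)[of "i - Suc j"] by (simp only:)
      then show ?thesis using 3 by (simp add: down[OF that])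
    next
      case 2
      then show ?thesis using that down[of j j] by (simp add: E(1) e_counit)
    qed (simp add: down[OF that] lin_zero[OF lin_eps])
  qed
  have expand: "c = (\<Sum>i\<le>L. scale (counit ((lc t ^^ i) c)) (E i))" if c: "c \<in> C" for c
  proof -
    let ?x = "c - (\<Sum>i\<le>L. scale (counit ((lc t ^^ i) c)) (E i))"
    have "?x = 0"
    proof (rule vanish)
      show "?x \<in> C" using c EC C_subspace by (intro subspace_diff subspace_sum subspace_scale) auto
      fix j assume j: "j \<le> L"
      note l = lin_compose[OF lin_eps lin_lc_t[of j]]
      have "counit ((lc t ^^ j) ?x) = counit ((lc t ^^ j) c) -
          (\<Sum>i\<le>L. counit ((lc t ^^ i) c) * counit ((lc t ^^ j) (E i)))"
        by (simp add: lin_diff[OF l] lin_sum[OF l] lin_scale[OF l])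
      also have "(\<Sum>i\<le>L. counit ((lc t ^^ i) c) * counit ((lc t ^^ j) (E i))) =
          (\<Sum>i\<le>L. if i = j then counit ((lc t ^^ j) c) else 0)"
        by (intro sum.cong) (auto simp: dual)
      finally show "counit ((lc t ^^ j) ?x) = 0" using j by simp
    qed
    then show ?thesis by simp
  qed
  have dim: "N = Suc L" if N: "has_dim scale C N" for N
  proof -
    obtain bs where bs: "finite bs" "independent bs" "span bs = C" "card bs = N"
      using N by (auto simp: has_dim_def)
    have inj: "inj_on E {..L}"
    proof (rule inj_onI)
      fix i j assume "i \<in> {..L}" "j \<in> {..L}" "E i = E j"
      then show "i = j" using dual[of i j] dual[of j j] by (auto split: if_splits)
    qed
    have ind: "independent (E ` {..L})"
      unfolding independent_explicit_module
    proof (intro allI impI)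
      fix s u x assume s: "finite s" "s \<subseteq> E ` {..L}" "(\<Sum>v\<in>s. scale (u v) v) = 0" "x \<in> s"
      then obtain j where j: "x = E j" "j \<le> L" by auto
      note l = lin_compose[OF lin_eps lin_lc_t[of j]]
      have "0 = counit ((lc t ^^ j) (\<Sum>v\<in>s. scale (u v) v))"
        using s(3) lin_zero[OF l] by simp
      also have "\<dots> = (\<Sum>v\<in>s. u v * counit ((lc t ^^ j) v))"
        by (simp add: lin_sum[OF l] lin_scale[OF l])
      also have "\<dots> = (\<Sum>v\<in>s. if v = x then u x else 0)"
      proof (rule sum.cong[OF HOL.refl])
        fix v assume "v \<in> s"
        then obtain i where "v = E i" "i \<le> L" using s(2) by auto
        then show "u v * counit ((lc t ^^ j) v) = (if v = x then u x else 0)"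
          using dual[of i j] j inj_on_eq_iff[OF inj, of i j] by auto
      qed
      finally show "u x = 0" using s by simp
    qed
    have "span (E ` {..L}) = C"
    proof
      show "span (E ` {..L}) \<subseteq> C" using EC C_subspace by (intro span_minimal) auto
      show "C \<subseteq> span (E ` {..L})"
      proof
        fix c assume "c \<in> C"
        then show "c \<in> span (E ` {..L})"
          by (subst expand) (auto intro: span_sum span_scale span_base)
      qed
    qed
    moreover have sC: "span C = C" using C_subspace by (simp only: span_eq_iff)
    ultimately have "dim C = Suc L"
      using dim_eq_card[of "E ` {..L}" C] ind card_image[OF inj] sC by simp
    moreover have "dim C = N" using dim_eq_card[of bs C] bs sC by simp
    ultimately show ?thesis by simp
  qed
  show ?thesis
    by (intro exI[of _ E] exI[of _ L] conjI allI ballI impI E(1) EC E(3,4) top expand dim)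
qed

end


section \<open>The coalgebra of coinvariants\<close>

locale bialgebra_projection =
  H: hopf_algebra sH \<Delta>H \<epsilon>H S + A: bialgebra sA \<Delta>A \<epsilon>A
  for sH :: "'k::field_char_0 \<Rightarrow> 'h::ring_1 \<Rightarrow> 'h" and \<Delta>H \<epsilon>H S
    and sA :: "'k \<Rightarrow> 'a::ring_1 \<Rightarrow> 'a" and \<Delta>A \<epsilon>A +
  fixes \<sigma> :: "'h \<Rightarrow> 'a" and \<pi> :: "'a \<Rightarrow> 'h"
  assumes sigma_hom: "bialgebra_hom sH \<Delta>H \<epsilon>H sA \<Delta>A \<epsilon>A \<sigma>"
    and pi_sigma [simp]: "\<And>h. \<pi> (\<sigma> h) = h"
    and pi_hom: "coalgebra_hom sA \<Delta>A \<epsilon>A sH \<Delta>H \<epsilon>H \<pi>"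
    and pi_left [simp]: "\<And>h a. \<pi> (\<sigma> h * a) = h * \<pi> a"
    and pi_right [simp]: "\<And>a h. \<pi> (a * \<sigma> h) = \<pi> a * h"
begin

abbreviation R :: "'a set" where "R \<equiv> proj_R sA \<Delta>A sH \<pi>"
abbreviation \<tau> :: "'a \<Rightarrow> 'a" where "\<tau> \<equiv> proj_tau \<Delta>A S \<sigma> \<pi>"
abbreviation \<delta> :: "'a \<Rightarrow> ('a \<times> 'a) multiset" where "\<delta> \<equiv> proj_delta \<Delta>A S \<sigma> \<pi>"

lemmas vs = H.vector_space_axioms A.vector_space_axioms
declare vs [lin_rules] vector_space_mult [lin_rules]

lemma lin_sigma [lin_rules]: "lin s1 sH f \<Longrightarrow> lin s1 sA (\<lambda>x. \<sigma> (f x))"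
  using sigma_hom lin_iff_linear[OF vs] lin_compose
  by (auto simp: bialgebra_hom_def coalgebra_hom_def)

lemma lin_pi [lin_rules]: "lin s1 sA f \<Longrightarrow> lin s1 sH (\<lambda>x. \<pi> (f x))"
  using pi_hom lin_iff_linear[OF vs(2,1)] lin_compose
  by (auto simp: coalgebra_hom_def)

lemma sigma_mult: "\<sigma> (x * y) = \<sigma> x * \<sigma> y" and sigma_one [simp]: "\<sigma> 1 = 1"
  and sigma_counit [simp]: "\<epsilon>A (\<sigma> h) = \<epsilon>H h"
  using sigma_hom by (auto simp: bialgebra_hom_def coalgebra_hom_def)

lemma pi_counit [simp]: "\<epsilon>H (\<pi> a) = \<epsilon>A a"
  using pi_hom by (auto simp: coalgebra_hom_def)

lemma pi_one [simp]: "\<pi> 1 = 1"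
  using pi_sigma[of 1] by simp

lemma sigma_scale: "\<sigma> (sH c h) = sA c (\<sigma> h)"
  by (rule lin_scale[OF lin_sigma[OF lin_id]])

lemma sweedler_sigma:
  "bilin sA sA s3 F \<Longrightarrow> tsum (\<Delta>A (\<sigma> h)) F = tsum (\<Delta>H h) (\<lambda>x y. F (\<sigma> x) (\<sigma> y))"
  using sigma_hom tensor_eq_tsum[of sA sA "\<Delta>A (\<sigma> h)" "image_mset (map_prod \<sigma> \<sigma>) (\<Delta>H h)"]
  by (auto simp: bialgebra_hom_def coalgebra_hom_def tsum_map)

lemma sweedler_pi:
  "bilin sH sH s3 F \<Longrightarrow> tsum (\<Delta>H (\<pi> a)) F = tsum (\<Delta>A a) (\<lambda>x y. F (\<pi> x) (\<pi> y))"
  using pi_hom tensor_eq_tsum[of sH sH "\<Delta>H (\<pi> a)" "image_mset (map_prod \<pi> \<pi>) (\<Delta>A a)"]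
  by (auto simp: coalgebra_hom_def tsum_map)

lemma coinvariant: "r \<in> R \<Longrightarrow> bilin sA sH s3 F \<Longrightarrow> tsum (\<Delta>A r) (\<lambda>x y. F x (\<pi> y)) = F r 1"
  using tensor_eq_tsum[of sA sH "image_mset (map_prod id \<pi>) (\<Delta>A r)" "{#(r, 1)#}"]
  by (simp add: proj_R_def tsum_map)

lemma coinvariantI:
  assumes "\<And>F. bilin sA sH (*) F \<Longrightarrow> tsum (\<Delta>A r) (\<lambda>x y. F x (\<pi> y)) = F r 1"
  shows "r \<in> R"
  unfolding proj_R_def mem_Collect_eq
proof (rule tensor_eqI[OF vs(2,1)])
  fix f :: "'a \<Rightarrow> 'k" and g :: "'h \<Rightarrow> 'k"
  assume "lin sA (*) f" "lin sH (*) g"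
  then have "bilin sA sH (*) (\<lambda>x y. f x * g y)" by (intro bilinI lin_rules)
  then show "tsum (image_mset (map_prod id \<pi>) (\<Delta>A r)) (\<lambda>x y. f x * g y) =
      tsum {#(r, 1)#} (\<lambda>x y. f x * g y)"
    using assms by (simp add: tsum_map)
qed

lemma coinvariants_subspace: "A.subspace R"
proof (rule A.subspaceI)
  have l: "lin sA (*) (\<lambda>r. tsum (\<Delta>A r) (\<lambda>x y. F x (\<pi> y)))" if F: "bilin sA sH (*) F" for F
  proof -
    note [lin_rules] = lin_compose[OF bilin1[OF F]] lin_compose[OF bilin2[OF F]]
    show ?thesis by (intro lin_rules bilinI)
  qed
  show "0 \<in> R"
    by (rule coinvariantI) (metis l lin_zero bilin1)
  show "x + y \<in> R" if "x \<in> R" "y \<in> R" for x y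
    by (rule coinvariantI) (simp add: that lin_add[OF l] lin_add[OF bilin1] coinvariant)
  show "sA c x \<in> R" if "x \<in> R" for c x
    by (rule coinvariantI) (simp add: that lin_scale[OF l] lin_scale[OF bilin1] coinvariant)
qed

lemma one_coinvariant: "1 \<in> R"
proof (rule coinvariantI)
  fix F :: "'a \<Rightarrow> 'h \<Rightarrow> 'k"
  assume F: "bilin sA sH (*) F"
  note [lin_rules] = lin_compose[OF bilin1[OF F]] lin_compose[OF bilin2[OF F]]
  have "bilin sA sA (*) (\<lambda>x y. F x (\<pi> y))" by (intro lin_rules bilinI)
  then show "tsum (\<Delta>A 1) (\<lambda>x y. F x (\<pi> y)) = F 1 1" by (simp add: A.sweedler_one)
qed

lemma pi_coinvariant:
  assumes "r \<in> R"
  shows "\<pi> r = sH (\<epsilon>A r) 1"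
proof -
  have "bilin sA sH sH (\<lambda>x h. sH (\<epsilon>A x) h)" by (intro bilinI lin_rules)
  from coinvariant[OF assms this] show ?thesis
    using A.sweedler_counit_left[OF lin_pi[OF lin_id], of r] by simp
qed

lemma tau_eq: "\<tau> a = tsum (\<Delta>A a) (\<lambda>x y. x * \<sigma> (S (\<pi> y)))"
  by (simp add: proj_tau_def tsum_def)

lemma lin_tau [lin_rules]: "lin s1 sA f \<Longrightarrow> lin s1 sA (\<lambda>x. \<tau> (f x))"
  unfolding tau_eq by (intro lin_rules bilinI)

text \<open>
  Writing out \<open>\<Delta>(a\<^sub>1 \<sigma>(S(\<pi>(a\<^sub>2))))\<close> and applying \<open>\<pi>\<close> to the second factor leaves
  \<open>\<Sum> S(h\<^sub>2)\<^sub>1 \<otimes> h\<^sub>1 S(h\<^sub>2)\<^sub>2\<close> for \<open>h = \<pi>(a\<^sub>2)\<close>, which is \<open>S(h) \<otimes> 1\<close>.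
\<close>

lemma tau_coinvariant: "\<tau> a \<in> R"
proof (rule coinvariantI)
  fix F :: "'a \<Rightarrow> 'h \<Rightarrow> 'k"
  assume F: "bilin sA sH (*) F"
  note [lin_rules] = lin_compose[OF bilin1[OF F]] lin_compose[OF bilin2[OF F]]
  have b1: "bilin sA sA (*) (\<lambda>x y. F x (\<pi> y))" by (intro lin_rules bilinI)
  have b2: "bilin sA sA (*) (\<lambda>b1 b2. F (x1 * b1) (\<pi> (x2 * b2)))" for x1 x2
    by (intro lin_rules bilinI)
  have b3: "bilin sH sH (*) (\<lambda>p q. F (x * \<sigma> p) q)" for x
    by (intro lin_rules bilinI)
  have b4: "bilin sH sH (*) (\<lambda>c d. tsum (\<Delta>H (S d)) (\<lambda>p q. F (x * \<sigma> p) (c * q)))" for x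
    by (intro lin_rules bilinI)
  have "tsum (\<Delta>A (\<tau> a)) (\<lambda>x y. F x (\<pi> y)) =
      tsum (\<Delta>A a) (\<lambda>x y. tsum (\<Delta>A x) (\<lambda>x1 x2. tsum (\<Delta>H (S (\<pi> y))) (\<lambda>p q. F (x1 * \<sigma> p) (\<pi> x2 * q))))"
    unfolding tau_eq A.comult_tsum[OF vector_space_mult b1] A.sweedler_mult[OF b1]
      sweedler_sigma[OF b2] by simp
  also have "\<dots> = tsum (\<Delta>A a) (\<lambda>x w. tsum (\<Delta>A w) (\<lambda>x2 y. tsum (\<Delta>H (S (\<pi> y))) (\<lambda>p q. F (x * \<sigma> p) (\<pi> x2 * q))))"
    by (rule A.sweedler_coassoc[where sU = "(*)"]) (intro lin_rules bilinI)+
  also have "\<dots> = tsum (\<Delta>A a) (\<lambda>x w. F (x * \<sigma> (S (\<pi> w))) 1)"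
    by (simp add: sweedler_pi[OF b4, symmetric] H.sweedler_comult_antipode[OF vector_space_mult b3])
  also have "\<dots> = F (\<tau> a) 1"
    unfolding tau_eq by (rule lin_tsum_arg[OF bilin1[OF F], symmetric])
  finally show "tsum (\<Delta>A (\<tau> a)) (\<lambda>x y. F x (\<pi> y)) = F (\<tau> a) 1" .
qed

lemma tau_expansion: "tsum (\<Delta>A a) (\<lambda>x y. \<tau> x * \<sigma> (\<pi> y)) = a"
proof -
  have b: "bilin sH sH sH (\<lambda>p q. S p * q)" by (intro lin_rules bilinI)
  have "tsum (\<Delta>A a) (\<lambda>x y. \<tau> x * \<sigma> (\<pi> y)) =
      tsum (\<Delta>A a) (\<lambda>x y. tsum (\<Delta>A x) (\<lambda>x1 x2. x1 * \<sigma> (S (\<pi> x2)) * \<sigma> (\<pi> y)))"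
    unfolding tau_eq by (simp add: lin_tsum_arg[OF A.lin_mult_left[OF lin_id]])
  also have "\<dots> = tsum (\<Delta>A a) (\<lambda>x w. tsum (\<Delta>A w) (\<lambda>x2 y. x * \<sigma> (S (\<pi> x2)) * \<sigma> (\<pi> y)))"
    by (rule A.sweedler_coassoc[where sU = sA]) (intro lin_rules bilinI)+
  also have "\<dots> = tsum (\<Delta>A a) (\<lambda>x w. x * \<sigma> (tsum (\<Delta>A w) (\<lambda>x2 y. S (\<pi> x2) * \<pi> y)))"
    by (simp add: lin_tsum_arg[OF A.lin_mult_right[OF lin_sigma[OF lin_id]]] sigma_mult mult.assoc)
  also have "\<dots> = tsum (\<Delta>A a) (\<lambda>x w. sA (\<epsilon>A w) x)"
    by (simp add: sweedler_pi[OF b, symmetric] H.sweedler_antipode_left sigma_scale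
        A.scale_mult_right)
  also have "\<dots> = a" by (rule A.sweedler_counit_right[OF lin_id])
  finally show ?thesis .
qed

text \<open>Since \<open>a = \<Sum> \<tau>(a\<^sub>1) \<sigma>(\<pi>(a\<^sub>2))\<close>, linear maps on \<open>A\<close> are determined on the products \<open>r \<sigma>(h)\<close>.\<close>

lemma lin_eq_on_products:
  assumes f: "lin sA sU f" and g: "lin sA sU g"
    and eq: "\<And>r h. r \<in> R \<Longrightarrow> f (r * \<sigma> h) = g (r * \<sigma> h)"
  shows "f a = g a"
proof -
  have "f a = tsum (\<Delta>A a) (\<lambda>x y. f (\<tau> x * \<sigma> (\<pi> y)))"
    unfolding lin_tsum_arg[OF f, symmetric] tau_expansion ..
  also have "\<dots> = g (tsum (\<Delta>A a) (\<lambda>x y. \<tau> x * \<sigma> (\<pi> y)))"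
    unfolding lin_tsum_arg[OF g] by (simp add: eq tau_coinvariant)
  finally show ?thesis by (simp add: tau_expansion)
qed

lemma tau_coinvariant_mult:
  assumes r: "r \<in> R"
  shows "\<tau> (r * \<sigma> h) = sA (\<epsilon>H h) r"
proof -
  have b1: "bilin sA sA sA (\<lambda>x y. x * \<sigma> (S (\<pi> y)))" by (intro lin_rules bilinI)
  have b2: "bilin sA sA sA (\<lambda>b1 b2. x * b1 * \<sigma> (S (\<pi> (y * b2))))" for x y
    by (intro lin_rules bilinI)
  have b3: "bilin sA sH sA (\<lambda>x k. tsum (\<Delta>H h) (\<lambda>h1 h2. x * \<sigma> h1 * \<sigma> (S (k * h2))))"
    by (intro lin_rules bilinI)
  have "\<tau> (r * \<sigma> h) = tsum (\<Delta>A r) (\<lambda>x y. tsum (\<Delta>H h) (\<lambda>h1 h2. x * \<sigma> h1 * \<sigma> (S (\<pi> y * h2))))"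
    unfolding tau_eq A.sweedler_mult[OF b1] sweedler_sigma[OF b2] by simp
  also have "\<dots> = tsum (\<Delta>H h) (\<lambda>h1 h2. r * \<sigma> h1 * \<sigma> (S (1 * h2)))"
    by (rule coinvariant[OF r b3])
  also have "\<dots> = r * \<sigma> (tsum (\<Delta>H h) (\<lambda>h1 h2. h1 * S h2))"
    by (simp add: lin_tsum_arg[OF A.lin_mult_right[OF lin_sigma[OF lin_id]]] sigma_mult mult.assoc)
  also have "\<dots> = sA (\<epsilon>H h) r"
    by (simp add: H.sweedler_antipode_right sigma_scale A.scale_mult_right)
  finally show ?thesis .
qed

lemma tau_id: "r \<in> R \<Longrightarrow> \<tau> r = r"
  using tau_coinvariant_mult[of r 1] by (simp add: H.counit_one)

lemma tau_sigma: "\<tau> (\<sigma> h) = sA (\<epsilon>H h) 1"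
  using tau_coinvariant_mult[OF one_coinvariant, of h] by simp

lemma tau_mult_sigma: "\<tau> (a * \<sigma> h) = sA (\<epsilon>H h) (\<tau> a)"
proof (rule lin_eq_on_products[where sU = sA and f = "\<lambda>a. \<tau> (a * \<sigma> h)" and g = "\<lambda>a. sA (\<epsilon>H h) (\<tau> a)"])
  fix r k assume "r \<in> R"
  then show "\<tau> (r * \<sigma> k * \<sigma> h) = sA (\<epsilon>H h) (\<tau> (r * \<sigma> k))"
    by (simp add: tau_coinvariant_mult mult.assoc H.counit_mult mult.commute flip: sigma_mult)
qed (intro lin_rules)+

lemma counit_tau: "\<epsilon>A (\<tau> a) = \<epsilon>A a"
  by (rule lin_eq_on_products[where sU = "(*)" and f = "\<lambda>a. \<epsilon>A (\<tau> a)" and g = \<epsilon>A])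
    (intro lin_rules, simp_all add: tau_coinvariant_mult A.counit_mult
      lin_scale[OF A.lin_counit[OF lin_id]] mult.commute A.lin_counit[OF lin_id])

text \<open>By coassociativity the second tensor factor of \<open>\<Delta>(r)\<close> consists of coinvariants, which \<open>\<tau>\<close> fixes.\<close>

lemma comult_coinvariant_right:
  assumes v3: "vector_space s3" and F: "bilin sA sA s3 F" and r: "r \<in> R"
  shows "tsum (\<Delta>A r) (\<lambda>x y. F x (\<tau> y)) = tsum (\<Delta>A r) F"
proof -
  note [lin_rules] = lin_compose[OF bilin1[OF F]] lin_compose[OF bilin2[OF F]] v3
  have b: "bilin sA sH s3 (\<lambda>w k. tsum (\<Delta>A w) (\<lambda>x y. F x (y * \<sigma> (S k))))"
    by (intro lin_rules bilinI)
  have "tsum (\<Delta>A r) (\<lambda>x y. F x (\<tau> y)) =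
      tsum (\<Delta>A r) (\<lambda>x y. tsum (\<Delta>A y) (\<lambda>y1 y2. F x (y1 * \<sigma> (S (\<pi> y2)))))"
    unfolding tau_eq by (simp add: lin_tsum_arg[OF bilin2[OF F]])
  also have "\<dots> = tsum (\<Delta>A r) (\<lambda>w y. tsum (\<Delta>A w) (\<lambda>x y1. F x (y1 * \<sigma> (S (\<pi> y)))))"
    by (rule A.sweedler_coassoc[where sU = s3, symmetric]) (intro lin_rules bilinI)+
  also have "\<dots> = tsum (\<Delta>A r) (\<lambda>x y. F x (y * \<sigma> (S 1)))"
    by (rule coinvariant[OF r b])
  finally show ?thesis by (simp add: H.antipode_one)
qed

text \<open>
  The statement that \<open>\<tau>\<close> is a coalgebra map from \<open>A\<close> to \<open>R\<close>, from which the coassociativity of \<open>\<delta>\<close>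
  on \<open>R\<close> follows.
\<close>

lemma comult_tau:
  assumes v3: "vector_space s3" and F: "bilin sA sA s3 F"
  shows "tsum (\<Delta>A (\<tau> a)) (\<lambda>x y. F (\<tau> x) y) = tsum (\<Delta>A a) (\<lambda>x y. F (\<tau> x) (\<tau> y))"
proof (rule lin_eq_on_products[where sU = s3 and f = "\<lambda>a. tsum (\<Delta>A (\<tau> a)) (\<lambda>x y. F (\<tau> x) y)"])
  note [lin_rules] = lin_compose[OF bilin1[OF F]] lin_compose[OF bilin2[OF F]] v3
  have b0: "bilin sA sA s3 (\<lambda>x y. F (\<tau> x) y)" and b1: "bilin sA sA s3 (\<lambda>x y. F (\<tau> x) (\<tau> y))"
    by (intro lin_rules bilinI)+
  show "lin sA s3 (\<lambda>a. tsum (\<Delta>A (\<tau> a)) (\<lambda>x y. F (\<tau> x) y))"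
    "lin sA s3 (\<lambda>a. tsum (\<Delta>A a) (\<lambda>x y. F (\<tau> x) (\<tau> y)))"
    by (intro lin_rules bilinI)+
  have b2: "bilin sA sA s3 (\<lambda>c d. F (\<tau> (x * c)) (\<tau> (y * d)))" for x y
    by (intro lin_rules bilinI)
  fix r h assume r: "r \<in> R"
  have l: "lin sH s3 (\<lambda>h. s3 (\<epsilon>H h) (F (\<tau> x) (\<tau> y)))" for x y by (intro lin_rules)
  have "tsum (\<Delta>A (r * \<sigma> h)) (\<lambda>x y. F (\<tau> x) (\<tau> y)) =
      tsum (\<Delta>A r) (\<lambda>x y. tsum (\<Delta>H h) (\<lambda>h1 h2. s3 (\<epsilon>H h2) (s3 (\<epsilon>H h1) (F (\<tau> x) (\<tau> y)))))"
    unfolding A.sweedler_mult[OF b1] sweedler_sigma[OF b2]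
    by (simp add: tau_mult_sigma lin_scale[OF bilin2[OF F]] lin_scale[OF bilin1[OF F]])
  also have "\<dots> = tsum (\<Delta>A r) (\<lambda>x y. s3 (\<epsilon>H h) (F (\<tau> x) (\<tau> y)))"
    by (simp add: H.sweedler_counit_right[OF l])
  also have "\<dots> = s3 (\<epsilon>H h) (tsum (\<Delta>A r) (\<lambda>x y. F (\<tau> x) y))"
    unfolding lin_tsum_arg[OF lin_scale_const[OF v3 lin_id], symmetric]
      comult_coinvariant_right[OF v3 b0 r] ..
  also have "\<dots> = tsum (\<Delta>A (\<tau> (r * \<sigma> h))) (\<lambda>x y. F (\<tau> x) y)"
    unfolding tau_coinvariant_mult[OF r]
    by (rule lin_scale[OF A.lin_comult[OF v3 lin_id b0], symmetric])
  finally show "tsum (\<Delta>A (\<tau> (r * \<sigma> h))) (\<lambda>x y. F (\<tau> x) y) =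
    tsum (\<Delta>A (r * \<sigma> h)) (\<lambda>x y. F (\<tau> x) (\<tau> y))" ..
qed

lemma tsum_delta: "tsum (\<delta> a) F = tsum (\<Delta>A a) (\<lambda>x y. F (\<tau> x) y)"
  by (simp add: proj_delta_def tsum_map)

lemma lcontr_coinvariant:
  assumes f: "lin sA (*) f" and r: "r \<in> R"
  shows "lcontr sA \<Delta>A f r \<in> R"
proof (rule coinvariantI)
  fix F :: "'a \<Rightarrow> 'h \<Rightarrow> 'k"
  assume F: "bilin sA sH (*) F"
  note [lin_rules] = lin_compose[OF bilin1[OF F]] lin_compose[OF bilin2[OF F]] f
  have b1: "bilin sA sA (*) (\<lambda>x y. F x (\<pi> y))" by (intro lin_rules bilinI)
  have b2: "bilin sA sH (*) (\<lambda>x k. F (lcontr sA \<Delta>A f x) k)" by (intro lin_rules bilinI)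
  show "tsum (\<Delta>A (lcontr sA \<Delta>A f r)) (\<lambda>x y. F x (\<pi> y)) = F (lcontr sA \<Delta>A f r) 1"
    unfolding A.comult_lcontr[OF vector_space_mult f b1] by (rule coinvariant[OF r b2])
qed

lemma lcontr_delta: "lcontr sA \<delta> f = lcontr sA \<Delta>A (\<lambda>x. f (\<tau> x))"
  by (rule ext) (simp add: lcontr_def tsum_delta)

lemma rcontr_delta: "rcontr sA \<delta> g a = tsum (\<Delta>A a) (\<lambda>x y. sA (g y) (\<tau> x))"
  by (simp add: rcontr_def tsum_delta)

lemma coinvariants_coalgebra: "subspace_coalgebra sA \<delta> \<epsilon>A R"
proof
  show "A.subspace R" by (rule coinvariants_subspace)
  show "lin sA (*) \<epsilon>A" by (rule A.lin_counit[OF lin_id])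
  fix f :: "'a \<Rightarrow> 'k" assume f: "lin sA (*) f"
  note [lin_rules] = f lin_compose[OF f]
  have lf: "lin sA (*) (\<lambda>x. f (\<tau> x))" by (intro lin_rules)
  show "lin sA sA (lcontr sA \<delta> f)"
    unfolding lcontr_delta by (rule A.lin_lcontr[OF lf lin_id])
  show "lin sA sA (rcontr sA \<delta> f)"
    unfolding rcontr_delta by (intro lin_rules bilinI)
  fix c assume c: "c \<in> R"
  show "lcontr sA \<delta> f c \<in> R"
    unfolding lcontr_delta by (rule lcontr_coinvariant[OF lf c])
  show "rcontr sA \<delta> f c \<in> R"
    unfolding rcontr_delta
    by (rule tsum_in[OF coinvariants_subspace A.module_axioms])
      (rule A.subspace_scale[OF coinvariants_subspace tau_coinvariant])
  fix g :: "'a \<Rightarrow> 'k" assume g: "lin sA (*) g"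
  note [lin_rules] = g lin_compose[OF g]
  have lA: "lin sA sA (lcontr sA \<Delta>A (\<lambda>x. f (\<tau> x)))" by (intro lin_rules)
  have b1: "bilin sA sA sA (\<lambda>x y. sA (f x) y)" by (intro lin_rules bilinI)
  have b2: "bilin sA sA sA (\<lambda>x y. sA (g y) (\<tau> x))" by (intro lin_rules bilinI)
  have "lcontr sA \<delta> f (rcontr sA \<delta> g c) =
      tsum (\<Delta>A c) (\<lambda>x y. sA (g y) (tsum (\<Delta>A (\<tau> x)) (\<lambda>u v. sA (f (\<tau> u)) v)))"
    unfolding lcontr_delta rcontr_delta lin_tsum_arg[OF lA] lin_scale[OF lA]
    by (simp add: lcontr_def)
  also have "\<dots> = tsum (\<Delta>A c) (\<lambda>x y. tsum (\<Delta>A x) (\<lambda>u v. sA (g y) (sA (f (\<tau> u)) (\<tau> v))))"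
    unfolding comult_tau[OF vs(2) b1] lin_tsum_arg[OF lin_scale_const[OF vs(2) lin_id]] ..
  also have "\<dots> = tsum (\<Delta>A c) (\<lambda>u w. tsum (\<Delta>A w) (\<lambda>v y. sA (g y) (sA (f (\<tau> u)) (\<tau> v))))"
    by (rule A.sweedler_coassoc[where sU = sA]) (intro lin_rules bilinI)+
  also have "\<dots> = tsum (\<Delta>A c) (\<lambda>u w. sA (f (\<tau> u)) (tsum (\<Delta>A w) (\<lambda>v y. sA (g y) (\<tau> v))))"
    by (simp add: lin_tsum_arg[OF lin_scale_const[OF vs(2) lin_id]] mult.commute)
  also have "\<dots> = rcontr sA \<delta> g (lcontr sA \<delta> f c)"
    unfolding lcontr_delta rcontr_delta lcontr_def
    by (simp add: A.comult_tsum[OF vs(2) b2] lin_scale[OF A.lin_comult[OF vs(2) lin_id b2]])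
  finally show "lcontr sA \<delta> f (rcontr sA \<delta> g c) = rcontr sA \<delta> g (lcontr sA \<delta> f c)" .
next
  fix c assume c: "c \<in> R"
  show "lcontr sA \<delta> \<epsilon>A c = c"
    unfolding lcontr_delta lcontr_def counit_tau by (rule A.sweedler_counit_left[OF lin_id])
  show "rcontr sA \<delta> \<epsilon>A c = c"
    unfolding rcontr_delta using A.sweedler_counit_right[OF lin_tau[OF lin_id], of c] tau_id[OF c]
    by simp
qed

lemma delta_one:
  assumes F: "bilin sA sA s3 F"
  shows "tsum (\<delta> 1) F = F 1 1"
proof -
  note [lin_rules] = lin_compose[OF bilin1[OF F]] lin_compose[OF bilin2[OF F]]
  have "bilin sA sA s3 (\<lambda>x y. F (\<tau> x) y)" by (intro lin_rules bilinI)
  then show ?thesis by (simp add: tsum_delta A.sweedler_one tau_id[OF one_coinvariant])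
qed

text \<open>
  Expanding the first factor of \<open>\<Delta>(a)\<close> by \<open>a = \<Sum> \<tau>(a\<^sub>1) \<sigma>(\<pi>(a\<^sub>2))\<close> turns \<open>\<delta>\<close> and the coaction of \<open>H\<close> back
  into \<open>\<Delta>\<close>.
\<close>

lemma comult_from_delta:
  assumes v3: "vector_space s3" and F: "bilin sA sA s3 F"
  shows "tsum (\<Delta>A a) F = tsum (\<delta> a) (\<lambda>u v. tsum (\<Delta>A v) (\<lambda>p q. F (u * \<sigma> (\<pi> p)) q))"
proof -
  note [lin_rules] = lin_compose[OF bilin1[OF F]] lin_compose[OF bilin2[OF F]] v3
  have "tsum (\<delta> a) (\<lambda>u v. tsum (\<Delta>A v) (\<lambda>p q. F (u * \<sigma> (\<pi> p)) q)) =
      tsum (\<Delta>A a) (\<lambda>w q. tsum (\<Delta>A w) (\<lambda>x p. F (\<tau> x * \<sigma> (\<pi> p)) q))"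
    unfolding tsum_delta
    by (rule A.sweedler_coassoc[where sU = s3, symmetric]) (intro lin_rules bilinI)+
  also have "\<dots> = tsum (\<Delta>A a) F"
    unfolding lin_tsum_arg[OF bilin1[OF F], symmetric] tau_expansion ..
  finally show ?thesis ..
qed

end


section \<open>Projections with a thin coalgebra of coinvariants\<close>

text \<open>
  The data that a thin space of coinvariants provides: a spanning primitive element \<open>y\<close>, a functional
  \<open>T\<close> dual to \<open>y\<close> that factors through \<open>\<tau>\<close>, and a basis \<open>d\<close> of \<open>R\<close> on which contraction by \<open>T\<close> is the
  shift. In the model case \<open>d i\<close> is the divided power \<open>y\<^sup>i / (i)\<^sub>q!\<close>.
\<close>

locale thin_projection = bialgebra_projection sH \<Delta>H \<epsilon>H S sA \<Delta>A \<epsilon>A \<sigma> \<pi>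
  for sH :: "'k::field_char_0 \<Rightarrow> 'h::ring_1 \<Rightarrow> 'h" and \<Delta>H \<epsilon>H S
    and sA :: "'k \<Rightarrow> 'a::ring_1 \<Rightarrow> 'a" and \<Delta>A \<epsilon>A \<sigma> \<pi> +
  fixes N :: nat and y :: 'a and T :: "'a \<Rightarrow> 'k" and d :: "nat \<Rightarrow> 'a"
  assumes y_R: "y \<in> R" and y_primitive: "tensor_eq sA sA (\<delta> y) {#(y, 1), (1, y)#}"
    and primitive_line:
      "w \<in> R \<Longrightarrow> tensor_eq sA sA (\<delta> w) {#(w, 1), (1, w)#} \<Longrightarrow> \<exists>c. w = sA c y"
    and lin_T: "lin sA (*) T" and T_sigma: "T (a * \<sigma> h) = T a * \<epsilon>H h"
    and T_one: "T 1 = 0" and T_y: "T y = 1"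
    and d_0: "d 0 = 1" and d_R: "i < N \<Longrightarrow> d i \<in> R"
    and d_Suc: "Suc i < N \<Longrightarrow> lcontr sA \<Delta>A T (d (Suc i)) = d i"
    and d_counit: "Suc i < N \<Longrightarrow> \<epsilon>A (d (Suc i)) = 0"
    and D_nil_R: "r \<in> R \<Longrightarrow> (lcontr sA \<Delta>A T ^^ N) r = 0"
    and R_expansion: "r \<in> R \<Longrightarrow> r = (\<Sum>i<N. sA (\<epsilon>A ((lcontr sA \<Delta>A T ^^ i) r)) (d i))"
begin

abbreviation D :: "'a \<Rightarrow> 'a" where "D \<equiv> lcontr sA \<Delta>A T"
abbreviation coact :: "('h \<Rightarrow> 'k) \<Rightarrow> 'a \<Rightarrow> 'a"
  where "coact f \<equiv> lcontr sA \<Delta>A (\<lambda>a. f (\<pi> a))"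

lemmas lin_T_comp [lin_rules] = lin_compose[OF lin_T]

lemma lin_D: "lin sA sA (D ^^ n)"
  by (rule lin_funpow) (intro lin_rules lin_T)

lemmas lin_D1 = lin_D[of 1, simplified]
lemmas lin_D_comp [lin_rules] = lin_compose[OF lin_D]

lemma T_of_sigma: "T (\<sigma> h) = 0"
  using T_sigma[of 1 h] T_one by simp

lemma D_sigma: "(D ^^ n) (a * \<sigma> h) = (D ^^ n) a * \<sigma> h"
proof (induction n arbitrary: a)
  case (Suc n)
  have "D (a * \<sigma> h) = D a * \<sigma> h" for a
  proof -
    have b1: "bilin sA sA sA (\<lambda>x z. sA (T x) z)" by (intro lin_rules bilinI)
    have b2: "bilin sA sA sA (\<lambda>u v. sA (T (x * u)) (z * v))" for x z by (intro lin_rules bilinI)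
    have l: "lin sH sA (\<lambda>k. sA (T x) (z * \<sigma> k))" for x z by (intro lin_rules)
    have "D (a * \<sigma> h) = tsum (\<Delta>A a) (\<lambda>x z. tsum (\<Delta>H h) (\<lambda>h1 h2. sA (\<epsilon>H h1) (sA (T x) (z * \<sigma> h2))))"
      unfolding lcontr_def A.sweedler_mult[OF b1] sweedler_sigma[OF b2]
      by (simp add: T_sigma mult.commute)
    also have "\<dots> = D a * \<sigma> h"
      unfolding lcontr_def lin_tsum_arg[OF A.lin_mult_left[OF lin_id]] H.sweedler_counit_left[OF l]
      by (simp add: A.scale_mult_left)
    finally show ?thesis .
  qed
  then show ?case using Suc by simp
qed simp

lemma D_R: "r \<in> R \<Longrightarrow> (D ^^ n) r \<in> R"
  by (induction n) (auto intro: lcontr_coinvariant lin_T)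

lemma comult_D:
  assumes "vector_space s3" "bilin sA sA s3 F"
  shows "tsum (\<Delta>A ((D ^^ n) a)) F = tsum (\<Delta>A a) (\<lambda>x z. F ((D ^^ n) x) z)"
proof (induction n arbitrary: a)
  case (Suc n)
  have b: "bilin sA sA s3 (\<lambda>x z. F ((D ^^ n) x) z)"
    using assms(2) lin_compose[OF bilin1[OF assms(2)] lin_D] by (auto simp: bilin_def)
  show ?case
    unfolding funpow_Suc_right o_apply Suc A.comult_lcontr[OF assms(1) lin_T b] ..
qed simp

text \<open>
  On \<open>R\<close>, where \<open>\<pi>(r) = \<epsilon>(r) 1\<close>, this is the expansion in the basis \<open>d\<close>. Both sides are linear over \<open>H\<close>
  on the right, which extends it to \<open>A\<close>.
\<close>

lemma taylor: "a = (\<Sum>k<N. d k * \<sigma> (\<pi> ((D ^^ k) a)))"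
proof (rule lin_eq_on_products[where sU = sA and f = "\<lambda>a. a"])
  fix r h assume r: "r \<in> R"
  have "(\<Sum>k<N. d k * \<sigma> (\<pi> ((D ^^ k) (r * \<sigma> h)))) = (\<Sum>k<N. sA (\<epsilon>A ((D ^^ k) r)) (d k)) * \<sigma> h"
    by (simp add: D_sigma pi_coinvariant[OF D_R[OF r]] sigma_mult sigma_scale sum_distrib_right
        A.scale_mult_left A.scale_mult_right mult.assoc)
  then show "r * \<sigma> h = (\<Sum>k<N. d k * \<sigma> (\<pi> ((D ^^ k) (r * \<sigma> h))))"
    using R_expansion[OF r] by simp
qed (intro lin_rules)+

lemma D_nil: "N \<le> n \<Longrightarrow> (D ^^ n) a = 0"
proof -
  have N: "(D ^^ N) a = 0" for a
    by (rule lin_eq_on_products[where sU = sA and f = "D ^^ N" and g = "\<lambda>a. 0"])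
      (simp_all add: D_sigma D_nil_R lin_D lin_rules)
  assume "N \<le> n"
  then have "(D ^^ n) a = (D ^^ N) ((D ^^ (n - N)) a)"
    by (metis comp_apply funpow_add le_add_diff_inverse)
  then show ?thesis using N by simp
qed

lemma y_counit: "\<epsilon>A y = 0"
proof -
  have "bilin sA sA (*) (\<lambda>u v. \<epsilon>A u * \<epsilon>A v)" by (intro lin_rules bilinI)
  from tensor_eq_tsum[OF y_primitive this]
  have "tsum (\<Delta>A y) (\<lambda>u v. \<epsilon>A u * \<epsilon>A v) = \<epsilon>A y + \<epsilon>A y"
    by (simp add: tsum_delta counit_tau A.counit_one)
  then show ?thesis
    using A.sweedler_counit_left[OF A.lin_counit[OF lin_id], of y] by (metis add_cancel_right_right)
qed

lemma pi_y: "\<pi> y = 0"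
  using pi_coinvariant[OF y_R] y_counit by simp

lemma T_tau: "T (\<tau> a) = T a"
  by (rule lin_eq_on_products[where sU = "(*)" and f = "\<lambda>a. T (\<tau> a)"])
    (intro lin_rules lin_T, rule lin_T,
      simp add: tau_coinvariant_mult T_sigma lin_scale[OF lin_T] mult.commute)

lemma D_y: "D y = 1"
proof -
  have b: "bilin sA sA sA (\<lambda>u v. sA (T u) v)" and b2: "bilin sA sA sA (\<lambda>u v. sA (T (\<tau> u)) v)"
    by (intro lin_rules bilinI)+
  have "D a = lcontr sA \<delta> T a" for a
    by (simp add: lcontr_def tsum_delta T_tau)
  then show ?thesis
    using tensor_eq_tsum[OF y_primitive b] by (simp add: lcontr_def T_one T_y)
qed

lemma one_nonzero: "(1 :: 'a) \<noteq> 0"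
  using A.counit_one lin_zero[OF A.lin_counit[OF lin_id]] by auto

lemma N_ge_2: "2 \<le> N"
proof (rule ccontr)
  assume "\<not> 2 \<le> N"
  then have "(D ^^ 1) y = 0" by (intro D_nil) simp
  then show False using D_y one_nonzero by simp
qed

text \<open>
  In the Taylor expansion of an element killed by \<open>D\<close> only the term with \<open>k = 0\<close> survives.
\<close>

lemma D_kernel: "D a = 0 \<Longrightarrow> a = \<sigma> (\<pi> a)"
proof -
  assume a: "D a = 0"
  have z: "(D ^^ k) a = 0" if "k \<noteq> 0" for k
    using that a lin_zero[OF lin_D] by (cases k) (auto simp: funpow_Suc_right simp del: funpow.simps)
  have "a = (\<Sum>k<N. d k * \<sigma> (\<pi> ((D ^^ k) a)))" by (rule taylor)
  also have "\<dots> = (\<Sum>k\<in>{0}. d k * \<sigma> (\<pi> ((D ^^ k) a)))"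
    using N_ge_2 z
    by (intro sum.mono_neutral_right) (auto simp: lin_zero[OF lin_sigma[OF lin_pi[OF lin_id]]])
  finally show ?thesis by (simp add: d_0)
qed

lemma d_1: "d (Suc 0) = y"
proof -
  have N: "Suc 0 < N" using N_ge_2 by simp
  have "D (d (Suc 0) - y) = 0" using d_Suc[OF N] by (simp add: lin_diff[OF lin_D1] D_y d_0)
  moreover have "\<pi> (d (Suc 0) - y) = 0"
    using d_counit[OF N] pi_coinvariant[OF d_R[OF N]] pi_y by (simp add: lin_diff[OF lin_pi[OF lin_id]])
  ultimately have "d (Suc 0) - y = 0"
    using D_kernel[of "d (Suc 0) - y"] lin_zero[OF lin_sigma[OF lin_id]] by simp
  then show ?thesis by simp
qed


subsection \<open>The group-like element and the character\<close>

text \<open>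
  The functional \<open>T\<close> is \<open>1\<close> at \<open>y\<close>, so this is \<open>g\<close> if the coaction of \<open>y\<close> is \<open>g \<otimes> y\<close>.
\<close>

definition g :: 'h where "g = tsum (\<Delta>A y) (\<lambda>x z. sH (T z) (\<pi> x))"

definition \<chi> :: "'h \<Rightarrow> 'k" where "\<chi> h = T (\<sigma> h * y)"

definition q :: 'k where "q = \<chi> g"

lemma lin_coact [lin_rules]: "lin sH (*) f \<Longrightarrow> lin s1 sA u \<Longrightarrow> lin s1 sA (\<lambda>a. coact f (u a))"
  by (intro A.lin_lcontr) (rule lin_compose[OF _ lin_pi[OF lin_id]])

lemma coact_R: "lin sH (*) f \<Longrightarrow> r \<in> R \<Longrightarrow> coact f r \<in> R"
  by (rule lcontr_coinvariant[OF lin_compose[OF _ lin_pi[OF lin_id]]])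

lemma comult_y_coaction:
  assumes v3: "vector_space s3" and F: "bilin sA sA s3 F"
  shows "tsum (\<Delta>A y) F = F y 1 + tsum (\<Delta>A y) (\<lambda>p z. F (\<sigma> (\<pi> p)) z)"
proof -
  note [lin_rules] = lin_compose[OF bilin1[OF F]] lin_compose[OF bilin2[OF F]] v3
  have b: "bilin sA sA s3 (\<lambda>u v. tsum (\<Delta>A v) (\<lambda>p z. F (u * \<sigma> (\<pi> p)) z))"
    and b1: "bilin sA sA s3 (\<lambda>p z. F (y * \<sigma> (\<pi> p)) z)"
    by (intro lin_rules bilinI)+
  show ?thesis
    unfolding comult_from_delta[OF v3 F] using tensor_eq_tsum[OF y_primitive b]
    by (simp add: A.sweedler_one[OF b1])
qed

lemma coact_sigma:
  assumes f: "lin sH (*) f"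
  shows "coact f (\<sigma> h) = tsum (\<Delta>H h) (\<lambda>h1 h2. sA (f h1) (\<sigma> h2))"
proof -
  note [lin_rules] = lin_compose[OF f]
  have "bilin sA sA sA (\<lambda>x z. sA (f (\<pi> x)) z)" by (intro lin_rules bilinI)
  then show ?thesis by (simp add: lcontr_def sweedler_sigma)
qed

text \<open>The space of primitive elements of \<open>R\<close> is a subcomodule, so \<open>H\<close> coacts on it through a
  group-like element.\<close>

lemma coact_y:
  assumes f: "lin sH (*) f"
  shows "coact f y = sA (f g) y"
proof -
  note [lin_rules] = lin_compose[OF f]
  have fp: "lin sA (*) (\<lambda>a. f (\<pi> a))" by (intro lin_rules)
  let ?w = "coact f y"
  have wR: "?w \<in> R" by (rule coact_R[OF f y_R])
  have "tensor_eq sA sA (\<delta> ?w) {#(?w, 1), (1, ?w)#}"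
  proof (rule tensor_eqI[OF vs(2) vs(2)])
    fix u v :: "'a \<Rightarrow> 'k" assume uv: "lin sA (*) u" "lin sA (*) v"
    note [lin_rules] = lin_compose[OF uv(1)] lin_compose[OF uv(2)]
    have b1: "bilin sA sA (*) (\<lambda>x z. u (\<tau> x) * v z)" by (intro lin_rules bilinI)
    have b2: "bilin sA sA (*) (\<lambda>x z. u (\<tau> (coact f x)) * v z)" by (intro lin_rules bilinI f)
    have l: "lin sH (*) (\<lambda>h. f h * u 1)" by (intro lin_rules f)
    have t: "u (\<tau> (coact f (\<sigma> h))) = f h * u 1" for h
    proof -
      have "u (\<tau> (coact f (\<sigma> h))) = tsum (\<Delta>H h) (\<lambda>h1 h2. \<epsilon>H h2 * (f h1 * u 1))"
        unfolding coact_sigma[OF f] by (simp add: lin_tsum_arg[OF lin_compose[OF uv(1) lin_tau[OF lin_id]]]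
            lin_scale[OF lin_compose[OF uv(1) lin_tau[OF lin_id]]] tau_sigma lin_scale[OF uv(1)]
            mult.left_commute)
      then show ?thesis using H.sweedler_counit_right[OF l, of h] by simp
    qed
    have "tsum (\<delta> ?w) (\<lambda>x z. u x * v z) = tsum (\<Delta>A y) (\<lambda>x z. u (\<tau> (coact f x)) * v z)"
      unfolding tsum_delta by (rule A.comult_lcontr[OF vector_space_mult fp b1])
    also have "\<dots> = u ?w * v 1 + tsum (\<Delta>A y) (\<lambda>p z. f (\<pi> p) * u 1 * v z)"
      unfolding comult_y_coaction[OF vector_space_mult b2] t tau_id[OF wR] ..
    also have "tsum (\<Delta>A y) (\<lambda>p z. f (\<pi> p) * u 1 * v z) = u 1 * v ?w"
      unfolding lcontr_def
      by (simp add: lin_tsum_arg[OF uv(2)] lin_scale[OF uv(2)] ac_simps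
          lin_tsum_arg[OF lin_const_mult[OF lin_id, of "u 1"]])
    finally show "tsum (\<delta> ?w) (\<lambda>x z. u x * v z) = tsum {#(?w, 1), (1, ?w)#} (\<lambda>x z. u x * v z)"
      by simp
  qed
  then obtain c where c: "?w = sA c y" using primitive_line[OF wR] by blast
  have "c = T ?w" using c T_y by (simp add: lin_scale[OF lin_T])
  also have "\<dots> = f g"
    unfolding lcontr_def g_def by (simp add: lin_tsum_arg[OF lin_T] lin_scale[OF lin_T]
        lin_tsum_arg[OF f] lin_scale[OF f] mult.commute)
  finally show ?thesis using c by simp
qed

lemma comult_y: "tensor_eq sA sA (\<Delta>A y) {#(y, 1), (\<sigma> g, y)#}"
proof (rule tensor_eqI[OF vs(2) vs(2)])
  fix u v :: "'a \<Rightarrow> 'k" assume uv: "lin sA (*) u" "lin sA (*) v"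
  have b: "bilin sA sA (*) (\<lambda>x z. u x * v z)" by (intro lin_rules bilinI uv)
  have l: "lin sH (*) (\<lambda>h. u (\<sigma> h))" by (rule lin_compose[OF uv(1) lin_sigma[OF lin_id]])
  have "tsum (\<Delta>A y) (\<lambda>p z. u (\<sigma> (\<pi> p)) * v z) = v (coact (\<lambda>h. u (\<sigma> h)) y)"
    by (simp add: lcontr_def lin_tsum_arg[OF uv(2)] lin_scale[OF uv(2)])
  also have "\<dots> = u (\<sigma> g) * v y" by (simp add: coact_y[OF l] lin_scale[OF uv(2)])
  finally show "tsum (\<Delta>A y) (\<lambda>x z. u x * v z) = tsum {#(y, 1), (\<sigma> g, y)#} (\<lambda>x z. u x * v z)"
    using comult_y_coaction[OF vector_space_mult b] by simp
qed

text \<open>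
  The two properties express that the coaction on the line of \<open>y\<close> is coassociative and counital.
\<close>

lemma grouplike_g: "grouplike sH \<Delta>H \<epsilon>H g"
  unfolding grouplike_def
proof
  show "tensor_eq sH sH (\<Delta>H g) {#(g, g)#}"
  proof (rule tensor_eqI[OF vs(1) vs(1)])
    fix f f' :: "'h \<Rightarrow> 'k" assume f: "lin sH (*) f" "lin sH (*) f'"
    note [lin_rules] = lin_compose[OF f(1)] lin_compose[OF f(2)]
    let ?k = "\<lambda>h. tsum (\<Delta>H h) (\<lambda>a b. f a * f' b)"
    have b: "bilin sH sH (*) (\<lambda>a b. f a * f' b)" by (intro lin_rules bilinI)
    have lk: "lin sH (*) ?k" by (intro lin_rules b)
    have b2: "bilin sA sA sA (\<lambda>x z. sA (f' (\<pi> x)) z)" by (intro lin_rules bilinI)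
    have fp: "lin sA (*) (\<lambda>a. f (\<pi> a))" by (intro lin_rules)
    have fp': "lin sA (*) (\<lambda>a. f' (\<pi> a))" by (intro lin_rules)
    have 1: "coact f' (coact f y) = coact ?k y"
      unfolding lcontr_def[of sA \<Delta>A "\<lambda>a. f' (\<pi> a)"] A.comult_lcontr[OF vs(2) fp b2]
      unfolding lcontr_def sweedler_pi[OF b]
      by (simp add: lin_tsum_arg[OF fp'] lin_scale[OF fp'])
    have 2: "coact f' (coact f y) = sA (f' g) (sA (f g) y)"
      using lin_scale[OF lin_coact[OF f(2) lin_id], of "f g" y]
      by (simp add: coact_y f mult.commute)
    have "T (sA (?k g) y) = T (sA (f' g) (sA (f g) y))"
      unfolding coact_y[OF lk, symmetric] 1[symmetric] 2 ..
    then show "?k g = tsum {#(g, g)#} (\<lambda>a b. f a * f' b)"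
      by (simp add: lin_scale[OF lin_T] T_y mult.commute)
  qed
  have "coact \<epsilon>H y = y"
    unfolding lcontr_def by (simp add: A.sweedler_counit_left[OF lin_id])
  then have "T y = T (sA (\<epsilon>H g) y)" using coact_y[OF H.lin_counit[OF lin_id]] by simp
  then show "\<epsilon>H g = 1" by (simp add: lin_scale[OF lin_T] T_y)
qed

lemma T_g: "T (a * \<sigma> g) = T a"
  using grouplike_g by (simp add: T_sigma grouplike_def)

lemma lin_chi: "lin sH (*) \<chi>"
  unfolding \<chi>_def by (intro lin_rules)

lemmas lin_chi_comp [lin_rules] = lin_compose[OF lin_chi]

lemma sweedler_sigma_y:
  assumes v3: "vector_space s3" and F: "bilin sA sA s3 F"
  shows "tsum (\<Delta>A (\<sigma> h * y)) F =
    tsum (\<Delta>H h) (\<lambda>h1 h2. F (\<sigma> h1 * y) (\<sigma> h2) + F (\<sigma> h1 * \<sigma> g) (\<sigma> h2 * y))"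
proof -
  note [lin_rules] = lin_compose[OF bilin1[OF F]] lin_compose[OF bilin2[OF F]] v3
  have b: "bilin sA sA s3 (\<lambda>b1 b2. F (a1 * b1) (a2 * b2))" for a1 a2
    by (intro lin_rules bilinI)
  have b1: "bilin sA sA s3 (\<lambda>a1 a2. F (a1 * y) (a2 * 1) + F (a1 * \<sigma> g) (a2 * y))"
    by (intro lin_rules bilinI)
  show ?thesis
    unfolding A.sweedler_mult[OF F] tensor_eq_tsum[OF comult_y b]
    using sweedler_sigma[OF b1] by simp
qed

text \<open>
  Up to the identification of \<open>A\<close> modulo \<open>H\<close> with \<open>R\<close>, the element \<open>\<tau>(\<sigma>(h) y)\<close> is the image of \<open>y\<close> under
  the adjoint action of \<open>h\<close>. It is again primitive and hence a multiple of \<open>y\<close>.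
\<close>

lemma tau_sigma_y: "\<tau> (\<sigma> h * y) = sA (\<chi> h) y"
proof -
  let ?w = "\<tau> (\<sigma> h * y)"
  have "tensor_eq sA sA (\<delta> ?w) {#(?w, 1), (1, ?w)#}"
  proof (rule tensor_eqI[OF vs(2) vs(2)])
    fix u v :: "'a \<Rightarrow> 'k" assume uv: "lin sA (*) u" "lin sA (*) v"
    note [lin_rules] = lin_compose[OF uv(1)] lin_compose[OF uv(2)]
    have b0: "bilin sA sA (*) (\<lambda>x z. u x * v z)" by (intro lin_rules bilinI)
    have b1: "bilin sA sA (*) (\<lambda>x z. u (\<tau> x) * v (\<tau> z))" by (intro lin_rules bilinI)
    have l1: "lin sH (*) (\<lambda>h. u (\<tau> (\<sigma> h * y)) * v 1)"
      and l2: "lin sH (*) (\<lambda>h. u 1 * v (\<tau> (\<sigma> h * y)))"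
      by (intro lin_rules)+
    have g1: "\<epsilon>H g = 1" using grouplike_g by (simp add: grouplike_def)
    have "tsum (\<delta> ?w) (\<lambda>x z. u x * v z) = tsum (\<Delta>A (\<sigma> h * y)) (\<lambda>x z. u (\<tau> x) * v (\<tau> z))"
      unfolding tsum_delta by (rule comult_tau[OF vector_space_mult b0])
    also have "\<dots> = tsum (\<Delta>H h) (\<lambda>h1 h2. \<epsilon>H h2 * (u (\<tau> (\<sigma> h1 * y)) * v 1)) +
        tsum (\<Delta>H h) (\<lambda>h1 h2. \<epsilon>H h1 * (u 1 * v (\<tau> (\<sigma> h2 * y))))"
      unfolding sweedler_sigma_y[OF vector_space_mult b1] tsum_plus
      by (simp add: tau_sigma tau_mult_sigma g1 lin_scale[OF uv(1)] lin_scale[OF uv(2)] ac_simps)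
    also have "\<dots> = u ?w * v 1 + u 1 * v ?w"
      using H.sweedler_counit_right[OF l1, of h] H.sweedler_counit_left[OF l2, of h] by simp
    finally show "tsum (\<delta> ?w) (\<lambda>x z. u x * v z) = tsum {#(?w, 1), (1, ?w)#} (\<lambda>x z. u x * v z)"
      by simp
  qed
  then obtain c where c: "?w = sA c y" using primitive_line[OF tau_coinvariant] by blast
  have "\<chi> h = T ?w" by (simp add: \<chi>_def T_tau)
  then show ?thesis using c T_y by (simp add: lin_scale[OF lin_T])
qed

lemma sigma_y: "\<sigma> h * y = tsum (\<Delta>H h) (\<lambda>h1 h2. sA (\<chi> h1) (y * \<sigma> h2))"
proof -
  have b: "bilin sA sA sA (\<lambda>x z. \<tau> x * \<sigma> (\<pi> z))" by (intro lin_rules bilinI)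
  have "\<sigma> h * y = tsum (\<Delta>A (\<sigma> h * y)) (\<lambda>x z. \<tau> x * \<sigma> (\<pi> z))"
    by (rule tau_expansion[symmetric])
  also have "\<dots> = tsum (\<Delta>H h) (\<lambda>h1 h2. sA (\<chi> h1) (y * \<sigma> h2))"
    unfolding sweedler_sigma_y[OF vs(2) b]
    by (simp add: tau_sigma_y pi_y A.scale_mult_left lin_zero[OF lin_sigma[OF lin_id]])
  finally show ?thesis .
qed

text \<open>
  Both sides are read off by applying \<open>T\<close> to \<open>\<sigma>(h) \<sigma>(k) y\<close>.
\<close>

lemma chi_mult: "\<chi> (h * k) = \<chi> h * \<chi> k"
proof -
  have l: "lin sA (*) (\<lambda>a. T (\<sigma> h * a))" by (intro lin_rules)
  have l2: "lin sH (*) (\<lambda>k. \<chi> h * \<chi> k)" by (intro lin_rules)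
  have "\<chi> (h * k) = T (\<sigma> h * (\<sigma> k * y))" by (simp add: \<chi>_def sigma_mult mult.assoc)
  also have "\<dots> = tsum (\<Delta>H k) (\<lambda>k1 k2. \<chi> k1 * T (\<sigma> h * y * \<sigma> k2))"
    unfolding sigma_y[of k] lin_tsum_arg[OF l] lin_scale[OF l] by (simp add: mult.assoc)
  also have "\<dots> = tsum (\<Delta>H k) (\<lambda>k1 k2. \<epsilon>H k2 * (\<chi> h * \<chi> k1))"
    by (simp add: T_sigma \<chi>_def mult.commute mult.left_commute)
  also have "\<dots> = \<chi> h * \<chi> k" using H.sweedler_counit_right[OF l2, of k] by simp
  finally show ?thesis .
qed

lemma chi_one: "\<chi> 1 = 1"
  by (simp add: \<chi>_def T_y)

lemma algebra_character_chi: "algebra_character sH \<chi>"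
  unfolding algebra_character_def
  using lin_iff_linear[OF vs(1) vector_space_mult] lin_chi chi_mult chi_one by blast

lemma g_y: "\<sigma> g * y = sA q (y * \<sigma> g)"
proof -
  have "bilin sH sH sA (\<lambda>h1 h2. sA (\<chi> h1) (y * \<sigma> h2))" by (intro lin_rules bilinI)
  from H.sweedler_grouplike[OF grouplike_g this] show ?thesis by (simp add: sigma_y q_def)
qed

text \<open>
  Applying \<open>\<Delta>\<close> to both sides of \<open>\<sigma>(h) y = \<Sum> \<chi>(h\<^sub>1) y \<sigma>(h\<^sub>2)\<close> and then \<open>\<pi> \<otimes> T\<close> yields the
  compatibility of \<open>g\<close> and \<open>\<chi>\<close>.
\<close>

lemma yetter_drinfeld: "yetter_drinfeld_datum sH \<Delta>H \<epsilon>H q g \<chi>"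
proof -
  have "g * tsum (\<Delta>H h) (\<lambda>x z. sH (\<chi> x) z) = tsum (\<Delta>H h) (\<lambda>x z. sH (\<chi> z) x) * g" for h
  proof -
    have b: "bilin sA sA sH (\<lambda>x z. sH (T z) (\<pi> x))" by (intro lin_rules bilinI)
    have lb: "lin sA sH (\<lambda>a. tsum (\<Delta>A a) (\<lambda>x z. sH (T z) (\<pi> x)))" by (intro lin_rules b)
    have b1: "bilin sA sA sH (\<lambda>a1 a2. tsum (\<Delta>A (\<sigma> k)) (\<lambda>b1 b2. sH (T (a2 * b2)) (\<pi> (a1 * b1))))" for k
      by (intro lin_rules bilinI)
    have b2: "bilin sA sA sH (\<lambda>b1 b2. sH (T (a2 * b2)) (\<pi> (a1 * b1)))" for a1 a2
      by (intro lin_rules bilinI)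
    have l: "lin sH sH (\<lambda>k. g * k)" by (intro lin_rules)
    have ysig: "tsum (\<Delta>A (y * \<sigma> k)) (\<lambda>x z. sH (T z) (\<pi> x)) = g * k" for k
      unfolding A.sweedler_mult[OF b]
      unfolding tensor_eq_tsum[OF comult_y b1]
      using H.sweedler_counit_right[OF l, of k]
      by (simp add: sweedler_sigma[OF b2] pi_y T_of_sigma T_sigma T_y flip: sigma_mult)
    have "tsum (\<Delta>A (\<sigma> h * y)) (\<lambda>x z. sH (T z) (\<pi> x)) =
        tsum (\<Delta>H h) (\<lambda>x z. sH (\<chi> z) (x * g))"
      unfolding sweedler_sigma_y[OF vs(1) b] by (simp add: T_of_sigma pi_y \<chi>_def)
    moreover have "tsum (\<Delta>A (\<sigma> h * y)) (\<lambda>x z. sH (T z) (\<pi> x)) =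
        tsum (\<Delta>H h) (\<lambda>x z. sH (\<chi> x) (g * z))"
      unfolding sigma_y lin_tsum_arg[OF lb] lin_scale[OF lb] ysig ..
    ultimately show ?thesis
      unfolding lin_tsum_arg[OF l] lin_tsum_arg[OF H.lin_mult_left[OF lin_id, of g]]
      by (simp add: H.scale_mult_left H.scale_mult_right)
  qed
  then show ?thesis
    unfolding yetter_drinfeld_datum_def
    by (simp add: grouplike_g algebra_character_chi q_def tsum_def)
qed

end


context thin_projection
begin

subsection \<open>The order of \<open>q\<close>\<close>

lemma D_y_power: "(D ^^ m) (y ^ m) = sA (qfact q m) 1" "(D ^^ Suc m) (y ^ m) = 0"
  by (rule A.lcontr_skew_primitive_power[OF comult_y g_y lin_T T_one T_y T_g])+

text \<open>
  The order of \<open>q\<close>. In characteristic zero some \<open>(i)\<^sub>q\<close> with \<open>i > 0\<close> vanishes only if \<open>q \<noteq> 1\<close> is a root of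
  unity; here one vanishes because \<open>D\<close> is nilpotent.
\<close>

definition n :: nat where "n = (LEAST i. 0 < i \<and> qint q i = 0)"

lemma n_props: "0 < n" "n \<le> N" "qint q n = 0" "\<And>i. 0 < i \<Longrightarrow> i < n \<Longrightarrow> qint q i \<noteq> 0"
proof -
  have "sA (qfact q N) 1 = 0" using D_y_power(1)[of N] D_nil[of N] by simp
  then have "qfact q N = 0" using one_nonzero by simp
  then obtain i where i: "0 < i" "i \<le> N" "qint q i = 0" by (auto simp: qfact_def Suc_le_eq)
  then have ex: "\<exists>i. 0 < i \<and> qint q i = 0" by blast
  show "0 < n" "qint q n = 0" using LeastI_ex[OF ex] by (auto simp: n_def)
  show "n \<le> N" using i Least_le[of "\<lambda>i. 0 < i \<and> qint q i = 0" i] by (simp add: n_def)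
  show "qint q i \<noteq> 0" if "0 < i" "i < n" for i
    using not_less_Least[of i "\<lambda>i. 0 < i \<and> qint q i = 0"] that by (auto simp: n_def)
qed

lemma q_not_1: "q \<noteq> 1"
proof
  assume "q = 1"
  then have "qint q n = of_nat n" by (simp add: qint_def)
  then show False using n_props by simp
qed

lemma q_power_n: "q ^ i = 1 \<longleftrightarrow> qint q i = 0"
proof -
  have "(q - 1) * qint q i = q ^ i - 1"
    unfolding qint_def by (rule power_diff_1_eq[symmetric])
  then show ?thesis using q_not_1 by auto
qed

lemma primitive_root: "primitive_root_of_unity n q"
  unfolding primitive_root_of_unity_def q_power_n using n_props by blast

lemma qfact_nonzero: "m < n \<Longrightarrow> qfact q m \<noteq> 0"
  using n_props(4) by (auto simp: qfact_def)

lemma qbinom_n: "0 < k \<Longrightarrow> k < n \<Longrightarrow> qbinom q n k = 0"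
  by (rule qbinom_root_of_unity[OF n_props(4,3)])

lemma sum_qbinom_n:
  assumes "vector_space s3"
  shows "(\<Sum>k\<le>n. s3 (qbinom q n k) (f k)) = f 0 + f n"
proof -
  interpret V: vector_space s3 by fact
  have "(\<Sum>k\<le>n. s3 (qbinom q n k) (f k)) = (\<Sum>k\<in>{0, n}. s3 (qbinom q n k) (f k))"
    by (rule sum.mono_neutral_right) (auto simp: qbinom_n)
  then show ?thesis using n_props(1) by (simp add: qbinom_self)
qed

text \<open>
  The derivative of \<open>y\<^sup>n\<close> is a scalar \<open>c\<close>, so \<open>y\<^sup>n - c y\<close> lies in \<open>H\<close>. Conjugation by \<open>g\<close> fixes \<open>y\<^sup>n\<close> and
  multiplies \<open>y\<close> by \<open>q \<noteq> 1\<close>, so \<open>c = 0\<close>.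
\<close>

lemma y_power_n: "y ^ n = \<sigma> (\<pi> (y ^ n))"
proof -
  have z: "(\<Sum>k\<le>n. sA (qbinom q n k) (sA (T (y ^ k)) (y ^ (n - k)))) = sA (T (y ^ n)) 1"
    unfolding sum_qbinom_n[OF vs(2)] by (simp add: T_one)
  define c where "c = T (y ^ n)"
  have "D (y ^ n) = sA c 1"
    using A.lcontr_skew_primitive_power(3)[OF comult_y g_y lin_T T_one T_y T_g, of n] z
    by (simp add: c_def)
  then have "D (y ^ n - sA c y) = 0"
    by (simp add: lin_diff[OF lin_D1] lin_scale[OF lin_D1] D_y)
  then obtain x where x: "y ^ n = sA c y + \<sigma> x"
    using D_kernel by (metis add.commute diff_add_cancel)
  have "qint q n = 0 \<longleftrightarrow> q ^ n = 1" by (simp add: q_power_n)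
  then have "\<sigma> g * y ^ n = y ^ n * \<sigma> g"
    using A.lin_commute_power(1)[OF g_y, of n] n_props(3) by simp
  then have "D (\<sigma> g * y ^ n) = D (y ^ n * \<sigma> g)" by simp
  moreover have "D (\<sigma> h) = 0" for h using D_sigma[of 1 1 h] D_y_power(2)[of 0] by simp
  moreover have "D (a * \<sigma> h) = D a * \<sigma> h" for a h using D_sigma[of 1 a h] by simp
  ultimately have "sA (c * q) (\<sigma> g) = sA c (\<sigma> g)"
    unfolding x
    by (simp add: distrib_left distrib_right A.scale_mult_left A.scale_mult_right g_y
        lin_add[OF lin_D1] lin_scale[OF lin_D1] D_y flip: sigma_mult)
  then have "\<epsilon>A (sA (c * q) (\<sigma> g)) = \<epsilon>A (sA c (\<sigma> g))" by (rule arg_cong)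
  then have "c * q = c"
    using grouplike_g by (simp add: lin_scale[OF A.lin_counit[OF lin_id]] grouplike_def)
  then have "c = 0" using q_not_1 by simp
  then show ?thesis using x by simp
qed

lemma sigma_power: "\<sigma> (h ^ m) = \<sigma> h ^ m"
  by (induction m) (auto simp: sigma_mult)

text \<open>
  In \<open>\<Delta>(y\<^sup>n)\<close> only the two outer terms of the \<open>q\<close>-binomial formula remain, so \<open>\<pi>(y\<^sup>n)\<close> is skew-primitive.
\<close>

lemma y_power_n_trivial:
  assumes "finite_dimensional sH \<or> cosemisimple sH \<Delta>H"
  shows "\<exists>l. y ^ n = \<sigma> (sH l (1 - g ^ n))"
proof -
  let ?x = "\<pi> (y ^ n)"
  have "tensor_eq sH sH (\<Delta>H ?x) {#(?x, 1), (g ^ n, ?x)#}"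
  proof (rule tensor_eqI[OF vs(1) vs(1)])
    fix f h :: "'h \<Rightarrow> 'k" assume fh: "lin sH (*) f" "lin sH (*) h"
    note [lin_rules] = lin_compose[OF fh(1)] lin_compose[OF fh(2)]
    have b: "bilin sH sH (*) (\<lambda>a b. f a * h b)" by (intro lin_rules bilinI)
    have b2: "bilin sA sA (*) (\<lambda>a b. f (\<pi> a) * h (\<pi> b))" by (intro lin_rules bilinI)
    show "tsum (\<Delta>H ?x) (\<lambda>a b. f a * h b) = tsum {#(?x, 1), (g ^ n, ?x)#} (\<lambda>a b. f a * h b)"
      unfolding sweedler_pi[OF b]
        A.sweedler_skew_primitive_power[OF vector_space_mult b2 comult_y g_y]
        sum_qbinom_n[OF vector_space_mult]
      by (simp flip: sigma_power)
  qed
  moreover have "g * ?x = ?x * g"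
  proof -
    have "\<sigma> g * y ^ n = y ^ n * \<sigma> g"
      using A.lin_commute_power(1)[OF g_y, of n] n_props(3) by (simp add: q_power_n[THEN iffD2])
    then have "\<pi> (\<sigma> g * y ^ n) = \<pi> (y ^ n * \<sigma> g)" by simp
    then show ?thesis by simp
  qed
  then have "g ^ n * ?x = ?x * g ^ n"
    using H.lin_commute_power(2)[of g ?x 1 n] by simp
  ultimately obtain l where "?x = sH l (1 - g ^ n)"
    using H.skew_primitive_trivial[OF assms _ H.grouplike_power[OF grouplike_g]] by auto
  then show ?thesis using y_power_n by metis
qed


subsection \<open>The filtration by the order of nilpotency\<close>

text \<open>
  The elements of filtration degree at most \<open>i\<close> form \<open>F (Suc i)\<close>; in particular \<open>F 1\<close> is \<open>\<sigma>(H)\<close> and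
  \<open>F 0\<close> is zero.
\<close>

definition F :: "nat \<Rightarrow> 'a set" where "F i = {a. (D ^^ i) a = 0}"

lemma F_subspace: "A.subspace (F i)"
  unfolding F_def
  by (rule A.subspaceI) (auto simp: lin_zero[OF lin_D] lin_add[OF lin_D] lin_scale[OF lin_D])

lemma F_mono: "i \<le> j \<Longrightarrow> a \<in> F i \<Longrightarrow> a \<in> F j"
proof -
  assume "i \<le> j" "a \<in> F i"
  then have "(D ^^ j) a = (D ^^ (j - i)) ((D ^^ i) a)"
    by (metis comp_apply funpow_add le_add_diff_inverse2)
  then show ?thesis using \<open>a \<in> F i\<close> lin_zero[OF lin_D] by (simp add: F_def)
qed

lemma F_0: "a \<in> F 0 \<longleftrightarrow> a = 0"
  by (simp add: F_def)

lemma F_D: "(D ^^ k) a \<in> F i \<longleftrightarrow> a \<in> F (i + k)"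
  by (simp add: F_def funpow_add)

lemma F_Suc: "D a \<in> F i \<longleftrightarrow> a \<in> F (Suc i)"
  using F_D[of 1 a i] by simp

lemma zero_in_F: "0 \<in> F i"
  by (rule A.subspace_0[OF F_subspace])

lemma D_power_in_F: "a \<in> F i \<Longrightarrow> (D ^^ k) a \<in> F (i - k)"
  by (rule F_D[THEN iffD2]) (rule F_mono[rotated], auto)

text \<open>Expanding the functional \<open>T \<circ> coact f\<close> by the Taylor formula moves \<open>D\<close> past the coaction.\<close>

lemma D_coact:
  assumes f: "lin sH (*) f"
  shows "D (coact f a) = (\<Sum>k<N. coact (\<lambda>h. T (coact f (d k * \<sigma> h))) ((D ^^ k) a))"
proof -
  have fp: "lin sA (*) (\<lambda>a. f (\<pi> a))" by (rule lin_compose[OF f lin_pi[OF lin_id]])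
  have l: "lin sA (*) (\<lambda>x. T (coact f x))" by (intro lin_rules f)
  have b: "bilin sA sA sA (\<lambda>x z. sA (T x) z)" by (intro lin_rules bilinI)
  have bk: "bilin sA sA sA (\<lambda>x z. sA (T (coact f (d k * \<sigma> (\<pi> x)))) z)" for k
    by (intro lin_rules bilinI f)
  have t: "T (coact f x) = (\<Sum>k<N. T (coact f (d k * \<sigma> (\<pi> ((D ^^ k) x)))))" for x
    by (subst taylor[of x]) (rule lin_sum[OF l])
  have "D (coact f a) = tsum (\<Delta>A (coact f a)) (\<lambda>x z. sA (T x) z)"
    by (rule lcontr_def)
  also have "\<dots> = tsum (\<Delta>A a) (\<lambda>x z. sA (T (coact f x)) z)"
    by (rule A.comult_lcontr[OF vs(2) fp b])
  also have "\<dots> = tsum (\<Delta>A a) (\<lambda>x z. \<Sum>k<N. sA (T (coact f (d k * \<sigma> (\<pi> ((D ^^ k) x))))) z)"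
    by (intro tsum_cong) (subst t, rule A.scale_sum_left)
  also have "\<dots> = (\<Sum>k<N. coact (\<lambda>h. T (coact f (d k * \<sigma> h))) ((D ^^ k) a))"
    unfolding tsum_sum lcontr_def[of sA \<Delta>A "\<lambda>a. T (coact f (d _ * \<sigma> (\<pi> a)))"]
      comult_D[OF vs(2) bk] ..
  finally show ?thesis .
qed

lemma lin_taylor_coeff: "lin sH (*) f \<Longrightarrow> lin sH (*) (\<lambda>h. T (coact f (d k * \<sigma> h)))"
  by (intro lin_rules)

lemma taylor_coeff_0:
  assumes f: "lin sH (*) f"
  shows "T (coact f (d 0 * \<sigma> h)) = 0"
  by (simp add: d_0 coact_sigma[OF f] lin_tsum_arg[OF lin_T] lin_scale[OF lin_T] T_of_sigma)

lemma coact_0: "coact (\<lambda>h. 0) a = 0"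
  by (simp add: lcontr_def)

lemma coact_in_F: "lin sH (*) f \<Longrightarrow> a \<in> F i \<Longrightarrow> coact f a \<in> F i"
proof (induction i arbitrary: f a)
  case 0
  then show ?case using lin_zero[OF lin_coact[OF 0(1) lin_id]] by (simp add: F_0)
next
  case (Suc i)
  have "coact (\<lambda>h. T (coact f (d k * \<sigma> h))) ((D ^^ k) a) \<in> F i" for k
  proof (cases k)
    case 0
    then show ?thesis by (simp add: taylor_coeff_0[OF Suc.prems(1)] coact_0 zero_in_F)
  next
    case (Suc j)
    have "(D ^^ k) a \<in> F i" using D_power_in_F[OF Suc.prems(2), of k] Suc F_mono[of "i - j" i] by simp
    then show ?thesis by (rule Suc.IH[OF lin_taylor_coeff[OF Suc.prems(1)]])
  qed
  then have "D (coact f a) \<in> F i"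
    unfolding D_coact[OF Suc.prems(1)] by (intro A.subspace_sum[OF F_subspace])
  then show ?case by (simp add: F_Suc)
qed

text \<open>Hence the coaction of an element of \<open>F i\<close> lies in \<open>H \<otimes> F i\<close>.\<close>

lemma coaction_in_F:
  assumes a: "a \<in> F i"
  shows "\<exists>t. (\<forall>h x. (h, x) \<in># t \<longrightarrow> x \<in> F i) \<and>
    (\<forall>G. bilin sH sA sA G \<longrightarrow> tsum (\<Delta>A a) (\<lambda>x z. G (\<pi> x) z) = tsum t G)"
proof -
  have "F i \<inter> {0} \<subseteq> {0}" by blast
  then obtain p where p: "lin sA sA p" "\<And>x. p x \<in> F i" "\<And>x. x \<in> F i \<Longrightarrow> p x = x"
    by (rule projection_onto[OF vs(2) F_subspace A.subspace_single_0]) iprover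
  define t where "t = image_mset (map_prod \<pi> p) (\<Delta>A a)"
  have "tensor_eq sH sA (image_mset (map_prod \<pi> (\<lambda>x. x)) (\<Delta>A a)) t"
  proof (rule tensor_eqI[OF vs])
    fix f and u :: "'a \<Rightarrow> 'k" assume f: "lin sH (*) f" and u: "lin sA (*) u"
    note up = lin_compose[OF u p(1)]
    have "tsum t (\<lambda>h x. f h * u x) = u (p (coact f a))"
      unfolding t_def tsum_map lcontr_def by (simp add: lin_tsum_arg[OF up] lin_scale[OF up])
    also have "\<dots> = u (coact f a)" using coact_in_F[OF f a] p(3) by simp
    also have "\<dots> = tsum (image_mset (map_prod \<pi> (\<lambda>x. x)) (\<Delta>A a)) (\<lambda>h x. f h * u x)"
      unfolding tsum_map lcontr_def by (simp add: lin_tsum_arg[OF u] lin_scale[OF u])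
    finally show "tsum (image_mset (map_prod \<pi> (\<lambda>x. x)) (\<Delta>A a)) (\<lambda>h x. f h * u x) =
        tsum t (\<lambda>h x. f h * u x)" ..
  qed
  from tensor_eq_tsum[OF this]
  have "tsum (\<Delta>A a) (\<lambda>x z. G (\<pi> x) z) = tsum t G" if "bilin sH sA sA G" for G
    using that by (simp add: tsum_map)
  moreover have "x \<in> F i" if "(h, x) \<in># t" for h x
    using that p(2) by (auto simp: t_def)
  ultimately show ?thesis by blast
qed

text \<open>The coefficient of \<open>d\<^sub>k \<otimes> d\<^sub>l\<close> in \<open>D\<close> of a product, and the corresponding summand of \<open>D (a b)\<close>.\<close>

definition coeff :: "nat \<Rightarrow> nat \<Rightarrow> 'h \<Rightarrow> 'h \<Rightarrow> 'k"
  where "coeff k l h h' = T ((d k * \<sigma> h) * (d l * \<sigma> h'))"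

definition summand :: "nat \<Rightarrow> nat \<Rightarrow> 'a \<Rightarrow> 'a \<Rightarrow> 'a"
  where "summand k l a b = tsum (\<Delta>A a) (\<lambda>x x'. tsum (\<Delta>A b)
    (\<lambda>z z'. sA (coeff k l (\<pi> x) (\<pi> z)) (x' * z')))"

lemma lin_coeff [lin_rules]:
  "lin s1 sH f \<Longrightarrow> lin s1 (*) (\<lambda>x. coeff k l (f x) h')"
  "lin s1 sH f \<Longrightarrow> lin s1 (*) (\<lambda>x. coeff k l h (f x))"
  unfolding coeff_def by (intro lin_rules, assumption)+

lemma D_mult: "D (a * b) = (\<Sum>k<N. \<Sum>l<N. summand k l ((D ^^ k) a) ((D ^^ l) b))"
proof -
  have b0: "bilin sA sA sA (\<lambda>x z. sA (T x) z)" by (intro lin_rules bilinI)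
  have b1: "bilin sA sA sA (\<lambda>z z'. sA (coeff k l h (\<pi> z)) (x' * z'))" for k l h x'
    by (intro lin_rules bilinI)
  have b2: "bilin sA sA sA (\<lambda>x x'. tsum (\<Delta>A b)
      (\<lambda>z z'. sA (coeff k l (\<pi> x) (\<pi> z)) (x' * z')))" for k l b
    by (intro lin_rules bilinI)
  have T2: "T (x * z) = (\<Sum>k<N. \<Sum>l<N. coeff k l (\<pi> ((D ^^ k) x)) (\<pi> ((D ^^ l) z)))" for x z
  proof -
    have "T (x * z) = T ((\<Sum>k<N. d k * \<sigma> (\<pi> ((D ^^ k) x))) * (\<Sum>l<N. d l * \<sigma> (\<pi> ((D ^^ l) z))))"
      by (simp flip: taylor)
    then show ?thesis by (simp add: coeff_def sum_product lin_sum[OF lin_T])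
  qed
  have "D (a * b) = tsum (\<Delta>A a) (\<lambda>x x'. tsum (\<Delta>A b) (\<lambda>z z'. sA (T (x * z)) (x' * z')))"
    unfolding lcontr_def A.sweedler_mult[OF b0] ..
  also have "\<dots> = (\<Sum>k<N. \<Sum>l<N. tsum (\<Delta>A a) (\<lambda>x x'. tsum (\<Delta>A b)
      (\<lambda>z z'. sA (coeff k l (\<pi> ((D ^^ k) x)) (\<pi> ((D ^^ l) z))) (x' * z'))))"
    unfolding T2 A.scale_sum_left tsum_sum ..
  also have "\<dots> = (\<Sum>k<N. \<Sum>l<N. summand k l ((D ^^ k) a) ((D ^^ l) b))"
    unfolding summand_def
    unfolding comult_D[OF vs(2) b2]
    unfolding comult_D[OF vs(2) b1] ..
  finally show ?thesis .
qed

lemma summand_zero: "summand k l 0 b = 0" "summand k l a 0 = 0"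
proof -
  have b1: "bilin sA sA sA (\<lambda>z z'. sA (coeff k l h (\<pi> z)) (x' * z'))" for h x'
    by (intro lin_rules bilinI)
  have b2: "bilin sA sA sA (\<lambda>x x'. tsum (\<Delta>A b)
      (\<lambda>z z'. sA (coeff k l (\<pi> x) (\<pi> z)) (x' * z')))" for b
    by (intro lin_rules bilinI)
  show "summand k l 0 b = 0" "summand k l a 0 = 0"
    unfolding summand_def
    by (simp_all add: lin_zero[OF A.lin_comult[OF vs(2) lin_id b1]]
        lin_zero[OF A.lin_comult[OF vs(2) lin_id b2]])
qed

lemma summand_in:
  assumes a: "a \<in> F i" and b: "b \<in> F j" and V: "A.subspace V"
    and prod: "\<And>x z. x \<in> F i \<Longrightarrow> z \<in> F j \<Longrightarrow> x * z \<in> V"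
  shows "summand k l a b \<in> V"
proof -
  obtain t where t: "\<And>h x. (h, x) \<in># t \<Longrightarrow> x \<in> F i"
    "\<And>G. bilin sH sA sA G \<Longrightarrow> tsum (\<Delta>A a) (\<lambda>x z. G (\<pi> x) z) = tsum t G"
    using coaction_in_F[OF a] by blast
  obtain u where u: "\<And>h x. (h, x) \<in># u \<Longrightarrow> x \<in> F j"
    "\<And>G. bilin sH sA sA G \<Longrightarrow> tsum (\<Delta>A b) (\<lambda>x z. G (\<pi> x) z) = tsum u G"
    using coaction_in_F[OF b] by blast
  have b1: "bilin sH sA sA (\<lambda>h' z'. sA (coeff k l h h') (x' * z'))" for h x'
    by (intro lin_rules bilinI)
  have b2: "bilin sH sA sA (\<lambda>h x'. tsum u (\<lambda>h' z'. sA (coeff k l h h') (x' * z')))"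
    by (intro lin_rules bilinI)
  show ?thesis
    unfolding summand_def u(2)[OF b1] t(2)[OF b2]
    by (intro tsum_in[OF V A.module_axioms] A.subspace_scale[OF V] prod t(1) u(1))
qed

lemma summand_00: "summand 0 0 a b = 0"
  unfolding summand_def coeff_def by (simp add: d_0 T_of_sigma flip: sigma_mult)

text \<open>
  In the expansion of \<open>D (a b)\<close> the term without derivatives vanishes, and all others are products of
  elements of smaller total degree.
\<close>

lemma F_mult_Suc: "a \<in> F (Suc i) \<Longrightarrow> b \<in> F (Suc j) \<Longrightarrow> a * b \<in> F (Suc (i + j))"
proof (induction "i + j" arbitrary: i j a b rule: less_induct)
  case less
  have "summand k l ((D ^^ k) a) ((D ^^ l) b) \<in> F (i + j)" for k l
  proof -
    consider "k = 0 \<and> l = 0" | "k > i" | "l > j" | "k \<le> i" "l \<le> j" "k + l > 0" by linarith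
    then show ?thesis
    proof cases
      case 1
      then show ?thesis by (simp add: summand_00 zero_in_F)
    next
      case 2
      then have "(D ^^ k) a = 0" using D_power_in_F[OF less.prems(1), of k] by (simp add: F_0)
      then show ?thesis by (simp add: summand_zero zero_in_F)
    next
      case 3
      then have "(D ^^ l) b = 0" using D_power_in_F[OF less.prems(2), of l] by (simp add: F_0)
      then show ?thesis by (simp add: summand_zero zero_in_F)
    next
      case 4
      have "(D ^^ k) a \<in> F (Suc (i - k))" "(D ^^ l) b \<in> F (Suc (j - l))"
        using D_power_in_F[OF less.prems(1), of k] D_power_in_F[OF less.prems(2), of l] 4
        by (simp_all add: Suc_diff_le)
      then show ?thesis
      proof (rule summand_in[OF _ _ F_subspace])
        fix x z assume "x \<in> F (Suc (i - k))" "z \<in> F (Suc (j - l))"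
        then have "x * z \<in> F (Suc (i - k + (j - l)))"
          using 4 by (intro less.hyps) auto
        then show "x * z \<in> F (i + j)" by (rule F_mono[rotated]) (use 4 in auto)
      qed
    qed
  qed
  then have "D (a * b) \<in> F (i + j)"
    unfolding D_mult by (intro A.subspace_sum[OF F_subspace])
  then show ?case by (simp add: F_Suc)
qed

text \<open>
  For \<open>i = 0\<close> or \<open>j = 0\<close> one factor is zero, which makes the truncated difference harmless.
\<close>

lemma F_mult: "a \<in> F i \<Longrightarrow> b \<in> F j \<Longrightarrow> a * b \<in> F (i + j - 1)"
proof -
  assume a: "a \<in> F i" and b: "b \<in> F j"
  show ?thesis
  proof (cases "i = 0 \<or> j = 0")
    case True
    then have "a * b = 0" using a b by (auto simp: F_0)
    then show ?thesis by (simp add: zero_in_F)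
  next
    case False
    then obtain i' j' where "i = Suc i'" "j = Suc j'" by (metis not0_implies_Suc)
    then show ?thesis using F_mult_Suc[of a i' b j'] a b by simp
  qed
qed

lemma summand_10: "summand (Suc 0) 0 a b = tsum (\<Delta>A a) (\<lambda>x x'. sA (\<epsilon>A x) x') * b"
proof -
  have c: "coeff (Suc 0) 0 h h' = \<epsilon>H h * \<epsilon>H h'" for h h'
    using T_sigma[of y "h * h'"] by (simp add: coeff_def d_0 d_1 T_y H.counit_mult mult.assoc sigma_mult)
  have l: "lin sA sA (\<lambda>z'. sA c (x' * z'))" for c x' by (intro lin_rules)
  have "tsum (\<Delta>A b) (\<lambda>z z'. sA (c * \<epsilon>A z) (x' * z')) = sA c (x' * b)" for c x'
    using A.sweedler_counit_left[OF l, of b c x'] by (simp add: mult.commute)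
  then show ?thesis
    unfolding summand_def c lin_tsum_arg[OF A.lin_mult_left[OF lin_id]]
    by (simp add: A.scale_mult_left)
qed

lemma summand_01: "summand 0 (Suc 0) a b = coact \<chi> a * b"
proof -
  have c: "coeff 0 (Suc 0) h h' = \<chi> h * \<epsilon>H h'" for h h'
    using T_sigma[of "\<sigma> h * y" h'] by (simp add: coeff_def d_0 d_1 \<chi>_def mult.assoc)
  have l: "lin sA sA (\<lambda>z'. sA c (x' * z'))" for c x' by (intro lin_rules)
  have "tsum (\<Delta>A b) (\<lambda>z z'. sA (c * \<epsilon>A z) (x' * z')) = sA c (x' * b)" for c x'
    using A.sweedler_counit_left[OF l, of b c x'] by (simp add: mult.commute)
  then show ?thesis
    unfolding summand_def c lcontr_def lin_tsum_arg[OF A.lin_mult_left[OF lin_id]]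
    by (simp add: A.scale_mult_left)
qed

text \<open>
  Only the summands with a single derivative reach the top filtration degree. They make \<open>D\<close> a
  derivation twisted by the coaction along \<open>\<chi>\<close>.
\<close>

lemma D_mult_leading:
  assumes a: "a \<in> F (Suc i)" and b: "b \<in> F (Suc j)"
  shows "D (a * b) - D a * b - coact \<chi> a * D b \<in> F (i + j - 1)"
proof -
  define f where "f = (\<lambda>(k, l). summand k l ((D ^^ k) a) ((D ^^ l) b))"
  \<comment> \<open>The pairs in \<open>?P\<close> give the leading terms; the others have at
    least two derivatives.\<close>
  let ?K = "{..<N} \<times> {..<N}" and ?P = "{(0, 0), (Suc 0, 0), (0, Suc 0)}"
  have "D (a * b) = sum f ?K"
    unfolding D_mult f_def by (simp add: sum.cartesian_product)
  also have "\<dots> = sum f (?K - ?P) + sum f ?P"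
    using N_ge_2 by (intro sum.subset_diff) auto
  also have "sum f ?P = D a * b + coact \<chi> a * D b"
    using A.sweedler_counit_left[OF lin_id] by (simp add: f_def summand_00 summand_10 summand_01)
  finally have "D (a * b) - D a * b - coact \<chi> a * D b = sum f (?K - ?P)" by simp
  also have "\<dots> \<in> F (i + j - 1)"
  proof (intro A.subspace_sum[OF F_subspace])
    fix p assume "p \<in> ?K - ?P"
    then obtain k l where p: "p = (k, l)" "(k, l) \<notin> ?P" by (cases p) auto
    then have kl: "2 \<le> k + l" by (cases k; cases l) auto
    consider "k > i" | "l > j" | "k \<le> i" "l \<le> j" by linarith
    then show "f p \<in> F (i + j - 1)"
    proof cases
      case 1
      then have "(D ^^ k) a = 0" using D_power_in_F[OF a, of k] by (simp add: F_0)
      then show ?thesis by (simp add: p f_def summand_zero zero_in_F)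
    next
      case 2
      then have "(D ^^ l) b = 0" using D_power_in_F[OF b, of l] by (simp add: F_0)
      then show ?thesis by (simp add: p f_def summand_zero zero_in_F)
    next
      case 3
      have "(D ^^ k) a \<in> F (Suc (i - k))" "(D ^^ l) b \<in> F (Suc (j - l))"
        using D_power_in_F[OF a, of k] D_power_in_F[OF b, of l] 3 by (simp_all add: Suc_diff_le)
      then have "summand k l ((D ^^ k) a) ((D ^^ l) b) \<in> F (i + j - 1)"
      proof (rule summand_in[OF _ _ F_subspace])
        fix x z assume "x \<in> F (Suc (i - k))" "z \<in> F (Suc (j - l))"
        then have "x * z \<in> F (Suc (i - k + (j - l)))" by (rule F_mult_Suc)
        then show "x * z \<in> F (i + j - 1)" by (rule F_mono[rotated]) (use 3 kl in auto)
      qed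
      then show ?thesis by (simp add: p f_def)
    qed
  qed
  finally show ?thesis .
qed

text \<open>
  The leading term of the coaction of a coinvariant \<open>a\<close> of degree \<open>i\<close> is \<open>g\<^sup>i \<otimes> a\<close>, by induction: passing
  \<open>D\<close> through the coaction costs one factor \<open>g\<close>.
\<close>

lemma coact_chi_leading: "a \<in> R \<Longrightarrow> a \<in> F (Suc i) \<Longrightarrow> coact \<chi> a - sA (q ^ i) a \<in> F i"
proof (induction i arbitrary: a)
  case 0
  then have "D a = 0" by (simp add: F_def)
  then have a: "a = \<sigma> (sH (\<epsilon>A a) 1)" using D_kernel[of a] pi_coinvariant[OF 0(1)] by simp
  have b: "bilin sH sH sA (\<lambda>h1 h2. sA (\<chi> h1) (\<sigma> h2))" by (intro lin_rules bilinI)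
  have "coact \<chi> (\<sigma> 1) = 1"
    unfolding coact_sigma[OF lin_chi] by (simp add: H.sweedler_one[OF b] chi_one)
  then have "coact \<chi> (\<sigma> (sH (\<epsilon>A a) 1)) = sA (\<epsilon>A a) 1"
    by (simp add: sigma_scale lin_scale[OF lin_coact[OF lin_chi lin_id]])
  then have "coact \<chi> a = a" by (metis a sigma_one sigma_scale)
  then show ?case by (simp add: F_0)
next
  case (Suc i)
  \<comment> \<open>The coefficient of \<open>D\<close> in \<open>D \<circ> coact \<chi>\<close>
    is \<open>q (coact \<chi>)\<close>; the higher ones only contribute lower terms.\<close>
  have c1: "T (coact \<chi> (d (Suc 0) * \<sigma> h)) = q * \<chi> h" for h
  proof -
    have chip: "lin sA (*) (\<lambda>a. \<chi> (\<pi> a))" by (intro lin_rules)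
    have b0: "bilin sA sA (*) (\<lambda>x z. \<chi> (\<pi> x) * T z)" by (intro lin_rules bilinI)
    have b1: "bilin sA sA (*) (\<lambda>a1 a2. tsum (\<Delta>A (\<sigma> h)) (\<lambda>b1 b2. \<chi> (\<pi> (a1 * b1)) * T (a2 * b2)))"
      by (intro lin_rules bilinI)
    have b2: "bilin sA sA (*) (\<lambda>b1 b2. \<chi> (\<pi> (a1 * b1)) * T (a2 * b2))" for a1 a2
      by (intro lin_rules bilinI)
    have l: "lin sH (*) (\<lambda>h. q * \<chi> h)" by (intro lin_rules)
    have "T (coact \<chi> (y * \<sigma> h)) = tsum (\<Delta>A (y * \<sigma> h)) (\<lambda>x z. \<chi> (\<pi> x) * T z)"
      by (simp add: lcontr_def lin_tsum_arg[OF lin_T] lin_scale[OF lin_T])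
    also have "\<dots> = tsum (\<Delta>H h) (\<lambda>h1 h2. \<chi> (g * h1) * \<epsilon>H h2)"
      unfolding A.sweedler_mult[OF b0]
      unfolding tensor_eq_tsum[OF comult_y b1]
      by (simp add: sweedler_sigma[OF b2] T_of_sigma T_one T_sigma T_y flip: sigma_mult)
    also have "\<dots> = q * \<chi> h"
      using H.sweedler_counit_right[OF l, of h] by (simp add: chi_mult q_def ac_simps)
    finally show ?thesis by (simp add: d_1)
  qed
  let ?f = "\<lambda>k. coact (\<lambda>h. T (coact \<chi> (d k * \<sigma> h))) ((D ^^ k) a)"
  have f1: "?f (Suc 0) = sA q (coact \<chi> (D a))"
    unfolding c1 by (simp add: lcontr_def lin_tsum_arg[OF lin_scale_const[OF vs(2) lin_id]])
  have f0: "?f 0 = 0"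
    unfolding taylor_coeff_0[OF lin_chi] by (rule coact_0)
  have "D (coact \<chi> a) = sum ?f {..<N}" by (rule D_coact[OF lin_chi])
  also have "\<dots> = sum ?f ({..<N} - {0, Suc 0}) + sum ?f {0, Suc 0}"
    using N_ge_2 by (intro sum.subset_diff) auto
  also have "sum ?f {0, Suc 0} = ?f 0 + ?f (Suc 0)" by simp
  finally have e: "D (coact \<chi> a) - sA q (coact \<chi> (D a)) = sum ?f ({..<N} - {0, Suc 0})"
    unfolding f0 f1 by simp
  have 1: "D (coact \<chi> a) - sA q (coact \<chi> (D a)) \<in> F i"
    unfolding e
  proof (intro A.subspace_sum[OF F_subspace])
    fix k assume "k \<in> {..<N} - {0, Suc 0}"
    then have "k \<ge> 2" by (cases k) auto
    then have "(D ^^ k) a \<in> F i"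
      using D_power_in_F[OF Suc.prems(2), of k] by (auto intro: F_mono[rotated])
    then show "?f k \<in> F i" by (rule coact_in_F[OF lin_taylor_coeff[OF lin_chi]])
  qed
  have "coact \<chi> (D a) - sA (q ^ i) (D a) \<in> F i"
    by (rule Suc.IH) (use D_R[OF Suc.prems(1), of 1] Suc.prems(2) in \<open>auto simp: F_Suc\<close>)
  then have "sA q (coact \<chi> (D a) - sA (q ^ i) (D a)) \<in> F i"
    by (rule A.subspace_scale[OF F_subspace])
  from A.subspace_add[OF F_subspace 1 this]
  have "D (coact \<chi> a - sA (q ^ Suc i) a) \<in> F i"
    by (simp add: lin_diff[OF lin_D1] lin_scale[OF lin_D1] A.scale_right_diff_distrib)
  then show ?case by (simp add: F_Suc)
qed

text \<open>
  For coinvariants of degree \<open>i\<close> the twist is the scalar \<open>q\<^sup>i\<close>, up to lower terms.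
\<close>

lemma D_mult_coinvariant:
  assumes a: "a \<in> R" "a \<in> F (Suc i)" and b: "b \<in> F (Suc j)"
  shows "D (a * b) - D a * b - sA (q ^ i) (a * D b) \<in> F (i + j - 1)"
proof -
  have "(coact \<chi> a - sA (q ^ i) a) * D b \<in> F (i + j - 1)"
    using F_mult[OF coact_chi_leading[OF a], of "D b" j] b by (simp add: F_Suc)
  from A.subspace_add[OF F_subspace D_mult_leading[OF a(2) b] this]
  show ?thesis by (simp add: left_diff_distrib A.scale_mult_left)
qed


subsection \<open>The dimension of the coinvariants\<close>

lemma d_in_F: "i < N \<Longrightarrow> d i \<in> F (Suc i)"
proof (induction i)
  case 0
  have "D 1 = 0" using D_y_power(2)[of 0] by simp
  then show ?case by (simp add: F_def d_0)
next
  case (Suc i)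
  then show ?case using d_Suc[of i] by (simp add: F_Suc[symmetric, of "d (Suc i)"])
qed

text \<open>
  If \<open>n < N\<close>, then \<open>D\<^sup>n (d\<^sub>n b)\<close> is \<open>b + d\<^sub>n D\<^sup>n(b)\<close> up to lower terms: the mixed terms of the
  \<open>q\<close>-Leibniz rule carry Gaussian binomial coefficients that vanish because \<open>q\<close> has order \<open>n\<close>.
\<close>

lemma D_power_mult:
  assumes n: "n < N" and b: "b \<in> F (Suc j)" and m: "m \<le> n"
  shows "(D ^^ m) (d n * b) - (\<Sum>k\<le>m. sA (qbinom (inverse q) m k) (d (n - k) * (D ^^ (m - k)) b))
    \<in> F (n + j - m)"
  using m
proof (induction m)
  case 0
  then show ?case by (simp add: zero_in_F)
next
  case (Suc m)
  have q0: "q \<noteq> 0"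
    using primitive_root n_props(1) by (auto simp: primitive_root_of_unity_def power_0_left)
  let ?r = "inverse q"
  \<comment> \<open>\<open>V k\<close> is a term of the sum, and \<open>Y k\<close> and \<open>Z
    k\<close> are the two terms of its derivative.\<close>
  define V where "V k = d (n - k) * (D ^^ (m - k)) b" for k
  define Y where "Y k = d (n - Suc k) * (D ^^ (m - k)) b" for k
  define Z where "Z k = d (n - k) * (D ^^ (Suc m - k)) b" for k
  have step: "D (V k) - Y k - sA (?r ^ k) (Z k) \<in> F (n + j - Suc m)" if k: "k \<le> m" for k
  proof (cases "m - k \<le> j")
    case True
    have "q ^ (n - k) * q ^ k = 1"
      using primitive_root k Suc.prems by (simp add: primitive_root_of_unity_def flip: power_add)
    then have qk: "q ^ (n - k) = ?r ^ k" using q0 by (simp add: field_simps)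
    have D1: "D (d (n - k)) = d (n - Suc k)"
      using d_Suc[of "n - Suc k"] k Suc.prems n by (simp add: Suc_diff_Suc)
    have Z: "Z k = d (n - k) * D ((D ^^ (m - k)) b)"
      using k by (simp add: Z_def Suc_diff_le)
    have "D (V k) - D (d (n - k)) * (D ^^ (m - k)) b -
        sA (q ^ (n - k)) (d (n - k) * D ((D ^^ (m - k)) b)) \<in> F ((n - k) + (j - (m - k)) - 1)"
      unfolding V_def
    proof (rule D_mult_coinvariant)
      show "d (n - k) \<in> R" "d (n - k) \<in> F (Suc (n - k))" using n d_R d_in_F by auto
      show "(D ^^ (m - k)) b \<in> F (Suc (j - (m - k)))"
        using D_power_in_F[OF b, of "m - k"] True by (simp add: Suc_diff_le)
    qed
    then have "D (V k) - Y k - sA (?r ^ k) (Z k) \<in> F ((n - k) + (j - (m - k)) - 1)"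
      by (simp add: D1 Y_def Z qk)
    then show ?thesis
      by (rule F_mono[rotated]) (use True k Suc.prems in auto)
  next
    case False
    have "(D ^^ i) b = 0" if "i > j" for i
      using D_power_in_F[OF b, of i] that by (simp add: F_0)
    then show ?thesis
      using False k by (simp add: V_def Y_def Z_def lin_zero[OF lin_D1] zero_in_F Suc_diff_le)
  qed
  have 1: "(D ^^ Suc m) (d n * b) - (\<Sum>k\<le>m. sA (qbinom ?r m k) (D (V k))) \<in> F (n + j - Suc m)"
  proof -
    have "(D ^^ m) (d n * b) - (\<Sum>k\<le>m. sA (qbinom ?r m k) (V k)) \<in> F (Suc (n + j - Suc m))"
    proof -
      have "Suc (n + j - Suc m) = n + j - m" using Suc.prems by simp
      then show ?thesis using Suc by (simp only: V_def)
    qed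
    from F_Suc[THEN iffD2, OF this] show ?thesis
      by (simp add: lin_diff[OF lin_D1] lin_sum[OF lin_D1] lin_scale[OF lin_D1])
  qed
  have 2: "(\<Sum>k\<le>m. sA (qbinom ?r m k) (D (V k) - Y k - sA (?r ^ k) (Z k))) \<in> F (n + j - Suc m)"
    by (intro A.subspace_sum[OF F_subspace] A.subspace_scale[OF F_subspace] step) auto
  have "(\<Sum>k\<le>Suc m. sA (qbinom ?r (Suc m) k) (Z k)) =
      Z 0 + (\<Sum>k\<le>m. sA (qbinom ?r m k) (Z (Suc k))) +
      (\<Sum>k\<le>m. sA (qbinom ?r m (Suc k) * ?r ^ Suc k) (Z (Suc k)))"
    by (subst sum.atMost_Suc_shift) (simp add: sum.distrib A.scale_left_distrib mult.commute ac_simps)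
  also have "\<dots> = (\<Sum>k\<le>m. sA (qbinom ?r m k) (Y k)) +
      (Z 0 + (\<Sum>k\<le>m. sA (qbinom ?r m (Suc k) * ?r ^ Suc k) (Z (Suc k))))"
    by (simp add: Y_def Z_def)
  also have "Z 0 + (\<Sum>k\<le>m. sA (qbinom ?r m (Suc k) * ?r ^ Suc k) (Z (Suc k))) =
      (\<Sum>k\<le>Suc m. sA (qbinom ?r m k * ?r ^ k) (Z k))"
    by (subst sum.atMost_Suc_shift) simp
  also have "\<dots> = (\<Sum>k\<le>m. sA (qbinom ?r m k) (sA (?r ^ k) (Z k)))"
    by (simp add: qbinom_eq_0)
  finally have "(\<Sum>k\<le>Suc m. sA (qbinom ?r (Suc m) k) (Z k)) =
      (\<Sum>k\<le>m. sA (qbinom ?r m k) (Y k)) + (\<Sum>k\<le>m. sA (qbinom ?r m k) (sA (?r ^ k) (Z k)))" .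
  then have eq: "(D ^^ Suc m) (d n * b) - (\<Sum>k\<le>Suc m. sA (qbinom ?r (Suc m) k) (Z k)) =
     ((D ^^ Suc m) (d n * b) - (\<Sum>k\<le>m. sA (qbinom ?r m k) (D (V k)))) +
     (\<Sum>k\<le>m. sA (qbinom ?r m k) (D (V k) - Y k - sA (?r ^ k) (Z k)))"
    by (simp add: A.scale_right_diff_distrib sum_subtractf)
  show ?case using A.subspace_add[OF F_subspace 1 2] unfolding eq[symmetric] unfolding Z_def .
qed

lemma D_n_mult:
  assumes n: "n < N" and b: "b \<in> F (Suc j)"
  shows "(D ^^ n) (d n * b) - d n * (D ^^ n) b - b \<in> F j"
proof -
  let ?r = "inverse q"
  have r1: "?r \<noteq> 1" using q_not_1 by simp
  have "qint ?r i = 0 \<longleftrightarrow> qint q i = 0" for i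
  proof -
    have "(?r - 1) * qint ?r i = ?r ^ i - 1"
      unfolding qint_def by (rule power_diff_1_eq[symmetric])
    then have "qint ?r i = 0 \<longleftrightarrow> ?r ^ i = 1" using r1 by auto
    then show ?thesis using q_power_n[of i] by (simp add: power_inverse)
  qed
  then have "qbinom ?r n k = 0" if "0 < k" "k < n" for k
    using n_props by (intro qbinom_root_of_unity that) auto
  then have "(\<Sum>k\<le>n. sA (qbinom ?r n k) (d (n - k) * (D ^^ (n - k)) b)) =
      (\<Sum>k\<in>{0, n}. sA (qbinom ?r n k) (d (n - k) * (D ^^ (n - k)) b))"
    by (intro sum.mono_neutral_right) auto
  also have "\<dots> = d n * (D ^^ n) b + b" using n_props(1) by (simp add: qbinom_self d_0)
  finally show ?thesis
    using D_power_mult[OF n b order_refl] by (simp add: diff_diff_eq)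
qed

text \<open>If \<open>n < N\<close>, then \<open>D\<^sup>n\<close> acts on the powers of \<open>d\<^sub>n\<close> like an ordinary derivation with respect to
  \<open>d\<^sub>n\<close>, so in characteristic zero none of these powers vanishes, whereas \<open>D\<close> is nilpotent.\<close>

lemma n_eq_N: "n = N"
proof (rule ccontr)
  assume "n \<noteq> N"
  then have n: "n < N" using n_props(2) by simp
  let ?z = "d n"
  have z: "?z ^ s \<in> F (Suc (n * s))" for s
  proof (induction s)
    case 0
    have "D 1 = 0" using D_y_power(2)[of 0] by simp
    then show ?case by (simp add: F_def)
  next
    case (Suc s)
    then show ?case using F_mult_Suc[OF d_in_F[OF n]] by simp
  qed
  have deriv: "(D ^^ n) (?z ^ Suc s) - sA (of_nat (Suc s)) (?z ^ s) \<in> F (n * s)" for s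
  proof (induction s)
    case 0
    have "(D ^^ i) (d i) = 1" if "i < N" for i
      using that by (induction i) (auto simp: d_0 funpow_Suc_right d_Suc simp del: funpow.simps)
    then show ?case using n by (simp add: zero_in_F)
  next
    case (Suc s)
    let ?b = "?z ^ Suc s"
    have 1: "(D ^^ n) (?z * ?b) - ?z * (D ^^ n) ?b - ?b \<in> F (n * Suc s)"
      by (rule D_n_mult[OF n z])
    have "?z * ((D ^^ n) ?b - sA (of_nat (Suc s)) (?z ^ s)) \<in> F (Suc n + n * s - 1)"
      by (rule F_mult[OF d_in_F[OF n] Suc.IH])
    then have 2: "?z * ((D ^^ n) ?b - sA (of_nat (Suc s)) (?z ^ s)) \<in> F (n * Suc s)"
      by simp
    have "sA (of_nat (Suc (Suc s))) ?b = ?b + sA (of_nat (Suc s)) ?b"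
      unfolding of_nat_Suc[of "Suc s"] A.scale_left_distrib by simp
    with A.subspace_add[OF F_subspace 1 2] show ?case
      by (simp add: right_diff_distrib A.scale_mult_right diff_diff_eq del: of_nat_Suc)
  qed
  have "(D ^^ (n * s)) (?z ^ s) = sA (fact s) 1" for s
  proof (induction s)
    case (Suc s)
    have "(D ^^ (n * s)) ((D ^^ n) (?z ^ Suc s) - sA (of_nat (Suc s)) (?z ^ s)) = 0"
      using deriv[of s] by (simp add: F_def)
    then have "(D ^^ (n * s)) ((D ^^ n) (?z ^ Suc s)) = sA (of_nat (Suc s)) (sA (fact s) 1)"
      by (simp only: lin_diff[OF lin_D] lin_scale[OF lin_D] Suc.IH right_minus_eq)
    moreover have "n * Suc s = n * s + n" by simp
    ultimately show ?case by (simp only: funpow_add o_apply A.scale_scale fact_Suc of_nat_mult)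
  qed simp
  moreover have "(D ^^ (n * N)) (?z ^ N) = 0"
    using n_props(1) by (intro D_nil) simp
  ultimately show False using one_nonzero by simp
qed


subsection \<open>The powers of \<open>y\<close> as a basis over \<open>H\<close>\<close>

text \<open>
  The operator \<open>D\<^sup>m\<close> isolates the top coefficient, with the factor \<open>(m)\<^sub>q! \<noteq> 0\<close>.
\<close>

lemma y_power_expansion_unique:
  assumes "m \<le> N" "(\<Sum>i<m. y ^ i * \<sigma> (c i)) = 0" "i < m"
  shows "c i = 0"
  using assms
proof (induction m)
  case (Suc m)
  have z: "(D ^^ m) (y ^ i * \<sigma> h) = 0" if "i < m" for i h
  proof -
    have "m = (m - Suc i) + Suc i" using that by simp
    then have "(D ^^ m) (y ^ i) = (D ^^ (m - Suc i)) ((D ^^ Suc i) (y ^ i))"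
      by (metis comp_apply funpow_add)
    then have "(D ^^ m) (y ^ i) = 0" using D_y_power(2)[of i] lin_zero[OF lin_D] by simp
    then show ?thesis by (simp add: D_sigma)
  qed
  have "0 = (D ^^ m) (\<Sum>i<Suc m. y ^ i * \<sigma> (c i))"
    using Suc.prems(2) lin_zero[OF lin_D] by simp
  also have "\<dots> = sA (qfact q m) (\<sigma> (c m))"
    by (simp add: lin_add[OF lin_D] lin_sum[OF lin_D] z)
      (simp add: D_sigma D_y_power(1) A.scale_mult_left)
  finally have "\<sigma> (c m) = 0"
    using qfact_nonzero[of m] n_eq_N Suc.prems(1) by simp
  then have cm: "c m = 0" using pi_sigma[of "c m"] lin_zero[OF lin_pi[OF lin_id]] by simp
  then show ?case
    using Suc by (cases "i = m") (auto simp: lin_zero[OF lin_sigma[OF lin_id]])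
qed simp

text \<open>
  The top coefficient is \<open>D\<^sup>m(a) / (m)\<^sub>q!\<close>, which lies in the kernel \<open>\<sigma>(H)\<close> of \<open>D\<close>.
\<close>

lemma y_power_expansion_exists:
  "m \<le> N \<Longrightarrow> (D ^^ m) a = 0 \<Longrightarrow> \<exists>c. a = (\<Sum>i<m. y ^ i * \<sigma> (c i))"
proof (induction m arbitrary: a)
  case (Suc m)
  have "D ((D ^^ m) a) = 0" using Suc.prems by simp
  then obtain h where h: "(D ^^ m) a = \<sigma> h" using D_kernel by blast
  define h' where "h' = sH (inverse (qfact q m)) h"
  have "(D ^^ m) (y ^ m * \<sigma> h') = \<sigma> h"
    using qfact_nonzero[of m] n_eq_N Suc.prems(1)
    by (simp add: D_sigma D_y_power(1) A.scale_mult_left A.scale_mult_right h'_def sigma_scale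
        lin_scale[OF lin_D])
  then have "(D ^^ m) (a - y ^ m * \<sigma> h') = 0" by (simp add: lin_diff[OF lin_D] h)
  then obtain c where c: "a - y ^ m * \<sigma> h' = (\<Sum>i<m. y ^ i * \<sigma> (c i))"
    using Suc by auto
  then have "a = (\<Sum>i<m. y ^ i * \<sigma> (c i)) + y ^ m * \<sigma> h'" by (simp add: algebra_simps)
  then show ?case by (intro exI[of _ "c(m := h')"]) simp
qed simp

end


section \<open>Ore extensions\<close>

lemma ring_of_type_algebra_ring: "ring (ring_of_type_algebra :: 'a::ring_1 ring)"
proof (rule ringI)
  show "abelian_group (ring_of_type_algebra :: 'a ring)"
  proof (rule abelian_groupI)
    fix x :: 'a
    show "\<exists>z\<in>carrier ring_of_type_algebra. z \<oplus>\<^bsub>ring_of_type_algebra\<^esub> x = \<zero>\<^bsub>ring_of_type_algebra\<^esub>"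
      by (intro bexI[of _ "- x"]) (auto simp: ring_of_type_algebra_def)
  qed (auto simp: ring_of_type_algebra_def algebra_simps)
  show "Group.monoid (ring_of_type_algebra :: 'a ring)"
    by unfold_locales (auto simp: ring_of_type_algebra_def algebra_simps)
qed (auto simp: ring_of_type_algebra_def algebra_simps)

text \<open>
  The Ore multiplication is associative for every unital ring endomorphism \<open>\<phi>\<close>. Comparing coefficients
  reduces the ring axioms to reindexing of convolution sums.
\<close>

locale ring_endomorphism =
  fixes \<phi> :: "'h::ring_1 \<Rightarrow> 'h"
  assumes phi_add: "\<phi> (a + b) = \<phi> a + \<phi> b" and phi_mult: "\<phi> (a * b) = \<phi> a * \<phi> b"
    and phi_one: "\<phi> 1 = 1"
begin

lemma phi_power_add: "(\<phi> ^^ n) (a + b) = (\<phi> ^^ n) a + (\<phi> ^^ n) b"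
  and phi_power_mult: "(\<phi> ^^ n) (a * b) = (\<phi> ^^ n) a * (\<phi> ^^ n) b"
  and phi_power_one: "(\<phi> ^^ n) 1 = 1"
  by (induction n) (auto simp: phi_add phi_mult phi_one)

lemma phi_power_zero: "(\<phi> ^^ n) 0 = 0"
  using phi_power_add[of n 0 0] by simp

lemma phi_power_sum: "(\<phi> ^^ n) (sum f I) = (\<Sum>i\<in>I. (\<phi> ^^ n) (f i))"
  by (induction I rule: infinite_finite_induct) (auto simp: phi_power_zero phi_power_add)

lemma coeff_ore_mult:
  "Polynomial.coeff (ore_mult \<phi> p r) n =
    (\<Sum>i=0..n. (\<phi> ^^ (n - i)) (Polynomial.coeff p i) * Polynomial.coeff r (n - i))"
proof -
  let ?t = "\<lambda>i j. (\<phi> ^^ j) (Polynomial.coeff p i) * Polynomial.coeff r j"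
  let ?m = "Polynomial.degree p + Polynomial.degree r + n"
  have z: "?t i j = 0" if "i > Polynomial.degree p \<or> j > Polynomial.degree r" for i j
    using that by (auto simp: coeff_eq_0 phi_power_zero)
  have "Polynomial.coeff (ore_mult \<phi> p r) n =
      (\<Sum>i\<le>Polynomial.degree p. \<Sum>j\<le>Polynomial.degree r. if i + j = n then ?t i j else 0)"
    by (simp add: ore_mult_def coeff_sum)
  also have "\<dots> = (\<Sum>i\<le>?m. \<Sum>j\<le>?m. if i + j = n then ?t i j else 0)"
  proof -
    have "(\<Sum>j\<le>Polynomial.degree r. if i + j = n then ?t i j else 0) =
        (\<Sum>j\<le>?m. if i + j = n then ?t i j else 0)" for i
      by (rule sum.mono_neutral_left) (auto simp: z)
    moreover have "(\<Sum>i\<le>Polynomial.degree p. \<Sum>j\<le>?m. if i + j = n then ?t i j else 0) =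
        (\<Sum>i\<le>?m. \<Sum>j\<le>?m. if i + j = n then ?t i j else 0)"
      by (rule sum.mono_neutral_left) (auto simp: z intro!: sum.neutral)
    ultimately show ?thesis by simp
  qed
  also have "\<dots> = (\<Sum>i\<le>?m. if i \<le> n then ?t i (n - i) else 0)"
  proof (rule sum.cong[OF HOL.refl])
    fix i
    have "(\<Sum>j\<le>?m. if i + j = n then ?t i j else 0) =
        (\<Sum>j\<le>?m. if j = n - i then (if i \<le> n then ?t i (n - i) else 0) else 0)"
      by (rule sum.cong[OF HOL.refl]) auto
    moreover have "n - i \<le> ?m" by simp
    ultimately show "(\<Sum>j\<le>?m. if i + j = n then ?t i j else 0) = (if i \<le> n then ?t i (n - i) else 0)"
      by simp
  qed
  also have "\<dots> = (\<Sum>i=0..n. ?t i (n - i))"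
    by (rule sum.mono_neutral_cong_right) auto
  finally show ?thesis .
qed

lemma ore_mult_add_left: "ore_mult \<phi> (p + p') r = ore_mult \<phi> p r + ore_mult \<phi> p' r"
  and ore_mult_add_right: "ore_mult \<phi> r (p + p') = ore_mult \<phi> r p + ore_mult \<phi> r p'"
  by (rule poly_eqI, simp add: coeff_ore_mult phi_power_add distrib_right distrib_left sum.distrib)+

lemma ore_mult_assoc: "ore_mult \<phi> (ore_mult \<phi> p r) s = ore_mult \<phi> p (ore_mult \<phi> r s)"
proof (rule poly_eqI)
  fix n
  let ?f = "\<lambda>a b c. (\<phi> ^^ (b + c)) (Polynomial.coeff p a) * ((\<phi> ^^ c) (Polynomial.coeff r b) * Polynomial.coeff s c)"
  have "Polynomial.coeff (ore_mult \<phi> (ore_mult \<phi> p r) s) n = (\<Sum>j=0..n. \<Sum>i=0..j. ?f i (j - i) (n - j))"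
    unfolding coeff_ore_mult phi_power_sum sum_distrib_right
  proof (intro sum.cong HOL.refl)
    fix j i assume "j \<in> {0..n}" "i \<in> {0..j}"
    then have "j - i + (n - j) = (n - j) + (j - i)" "n - i = (n - j) + (j - i)" by auto
    then show "(\<phi> ^^ (n - j)) ((\<phi> ^^ (j - i)) (Polynomial.coeff p i) * Polynomial.coeff r (j - i)) *
        Polynomial.coeff s (n - j) = ?f i (j - i) (n - j)"
      by (simp only: phi_power_mult mult.assoc funpow_add o_apply)
  qed
  also have "\<dots> = (\<Sum>j=0..n. \<Sum>i=0..n - j. ?f j i (n - j - i))"
    by (rule fps_mult_assoc_lemma)
  also have "\<dots> = Polynomial.coeff (ore_mult \<phi> p (ore_mult \<phi> r s)) n"
    unfolding coeff_ore_mult sum_distrib_left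
    by (intro sum.cong HOL.refl) simp
  finally show "Polynomial.coeff (ore_mult \<phi> (ore_mult \<phi> p r) s) n =
    Polynomial.coeff (ore_mult \<phi> p (ore_mult \<phi> r s)) n" .
qed

lemma ore_mult_monom:
  "ore_mult \<phi> (Polynomial.monom a i) (Polynomial.monom b j) =
    Polynomial.monom ((\<phi> ^^ j) a * b) (i + j)"
proof (rule poly_eqI)
  fix n
  have "Polynomial.coeff (ore_mult \<phi> (Polynomial.monom a i) (Polynomial.monom b j)) n =
      (\<Sum>k=0..n. if k = i then (if n = i + j then (\<phi> ^^ j) a * b else 0) else 0)"
    unfolding coeff_ore_mult by (intro sum.cong HOL.refl) (auto simp: phi_power_zero)
  then show "Polynomial.coeff (ore_mult \<phi> (Polynomial.monom a i) (Polynomial.monom b j)) n =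
      Polynomial.coeff (Polynomial.monom ((\<phi> ^^ j) a * b) (i + j)) n"
    by auto
qed

lemma ore_mult_one: "ore_mult \<phi> (ore_const 1) p = p" "ore_mult \<phi> p (ore_const 1) = p"
proof -
  show "ore_mult \<phi> (ore_const 1) p = p"
  proof (rule poly_eqI)
    fix n
    have "Polynomial.coeff (ore_mult \<phi> (ore_const 1) p) n =
        (\<Sum>k=0..n. if k = 0 then Polynomial.coeff p n else 0)"
      unfolding coeff_ore_mult ore_const_def
      by (intro sum.cong HOL.refl) (auto simp: phi_power_zero phi_power_one)
    then show "Polynomial.coeff (ore_mult \<phi> (ore_const 1) p) n = Polynomial.coeff p n" by simp
  qed
  show "ore_mult \<phi> p (ore_const 1) = p"
  proof (rule poly_eqI)
    fix n
    have "Polynomial.coeff (ore_mult \<phi> p (ore_const 1)) n =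
        (\<Sum>k=0..n. if k = n then Polynomial.coeff p n else 0)"
      unfolding coeff_ore_mult ore_const_def by (intro sum.cong HOL.refl) auto
    then show "Polynomial.coeff (ore_mult \<phi> p (ore_const 1)) n = Polynomial.coeff p n" by simp
  qed
qed

lemma ore_ring_simps:
  "carrier (ore_ring \<phi>) = UNIV" "p \<otimes>\<^bsub>ore_ring \<phi>\<^esub> r = ore_mult \<phi> p r" "\<one>\<^bsub>ore_ring \<phi>\<^esub> = ore_const 1"
  "\<zero>\<^bsub>ore_ring \<phi>\<^esub> = 0" "p \<oplus>\<^bsub>ore_ring \<phi>\<^esub> r = p + r"
  by (simp_all add: ore_ring_def)

lemma ore_ring: "ring (ore_ring \<phi>)"
proof (rule ringI)
  show "abelian_group (ore_ring \<phi>)"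
  proof (rule abelian_groupI)
    fix p
    show "\<exists>r\<in>carrier (ore_ring \<phi>). r \<oplus>\<^bsub>ore_ring \<phi>\<^esub> p = \<zero>\<^bsub>ore_ring \<phi>\<^esub>"
      by (intro bexI[of _ "- p"]) (auto simp: ore_ring_simps)
  qed (auto simp: ore_ring_simps algebra_simps)
  show "Group.monoid (ore_ring \<phi>)"
    by unfold_locales (auto simp: ore_ring_simps ore_mult_assoc ore_mult_one)
qed (auto simp: ore_ring_simps ore_mult_add_left ore_mult_add_right)

lemma ore_X_power: "ore_X [^]\<^bsub>ore_ring \<phi>\<^esub> (n::nat) = Polynomial.monom 1 n"
proof -
  interpret ring "ore_ring \<phi>" by (rule ore_ring)
  show ?thesis
  proof (induction n)
    case 0
    show ?case by (simp add: ore_ring_simps ore_const_def)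
  next
    case (Suc n)
    then show ?case by (simp add: ore_ring_simps ore_X_def ore_mult_monom phi_one)
  qed
qed

text \<open>
  Division with remainder by \<open>X\<^sup>N - c\<close>, which replaces a monomial of degree \<open>m \<ge> N\<close> by one of degree
  \<open>m - N\<close>.
\<close>

lemma reduce_modulo:
  assumes N: "N > 0" and I: "ideal I (ore_ring \<phi>)"
    and c: "Polynomial.monom 1 N - ore_const c \<in> I"
  shows "\<exists>r. (\<forall>i\<ge>N. Polynomial.coeff r i = 0) \<and> p - r \<in> I"
proof -
  interpret I: ideal I "ore_ring \<phi>" by (rule I)
  have add: "a + b \<in> I" if "a \<in> I" "b \<in> I" for a b
    using additive_subgroup.a_closed[OF ideal.axioms(1)[OF I] that] by (simp add: ore_ring_simps)
  have zero: "0 \<in> I"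
    using additive_subgroup.zero_closed[OF ideal.axioms(1)[OF I]] by (simp add: ore_ring_simps)
  have monom: "\<exists>r. (\<forall>i\<ge>N. Polynomial.coeff r i = 0) \<and> Polynomial.monom h m - r \<in> I" for h m
  proof (induction m arbitrary: h rule: less_induct)
    case (less m)
    show ?case
    proof (cases "m < N")
      case True
      then show ?thesis using zero by (intro exI[of _ "Polynomial.monom h m"]) auto
    next
      case False
      let ?h = "(\<phi> ^^ (m - N)) c * h"
      obtain r where r: "\<forall>i\<ge>N. Polynomial.coeff r i = 0" "Polynomial.monom ?h (m - N) - r \<in> I"
        using less[of "m - N" ?h] N False by auto
      have "ore_mult \<phi> (Polynomial.monom 1 N - ore_const c) (Polynomial.monom h (m - N)) \<in> I"
        using I.I_r_closed[OF c, of "Polynomial.monom h (m - N)"] by (simp add: ore_ring_simps)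
      moreover have "ore_mult \<phi> (Polynomial.monom 1 N - ore_const c) (Polynomial.monom h (m - N)) =
          Polynomial.monom h m - Polynomial.monom ?h (m - N)"
      proof -
        have "ore_mult \<phi> (Polynomial.monom 1 N) (Polynomial.monom h (m - N)) =
            ore_mult \<phi> (Polynomial.monom 1 N - ore_const c) (Polynomial.monom h (m - N)) +
            ore_mult \<phi> (ore_const c) (Polynomial.monom h (m - N))"
          by (simp flip: ore_mult_add_left)
        then show ?thesis using False by (simp add: ore_const_def ore_mult_monom phi_power_one algebra_simps)
      qed
      ultimately have "Polynomial.monom h m - r \<in> I"
        using add[OF _ r(2)] by fastforce
      then show ?thesis using r(1) by blast
    qed
  qed
  have "\<exists>r. (\<forall>i\<ge>N. Polynomial.coeff r i = 0) \<and> (\<Sum>i\<in>A. Polynomial.monom (Polynomial.coeff p i) i) - r \<in> I"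
    if "finite A" for A
    using that
  proof (induction A rule: finite_induct)
    case empty
    then show ?case using zero by (intro exI[of _ 0]) auto
  next
    case (insert i A)
    then obtain r where r: "\<forall>i\<ge>N. Polynomial.coeff r i = 0"
      "(\<Sum>i\<in>A. Polynomial.monom (Polynomial.coeff p i) i) - r \<in> I" by blast
    obtain r' where r': "\<forall>i\<ge>N. Polynomial.coeff r' i = 0"
      "Polynomial.monom (Polynomial.coeff p i) i - r' \<in> I" using monom by blast
    show ?case
      using insert.hyps r r' add[OF r(2) r'(2)]
      by (intro exI[of _ "r + r'"]) (auto simp: algebra_simps)
  qed
  from this[of "{..Polynomial.degree p}"] show ?thesis
    by (simp add: poly_as_sum_of_monoms)
qed

end


section \<open>Evaluation at \<open>y\<close> as an isomorphism\<close>

lemma tsum_Sum: "tsum (\<Sum>i\<in>I. t i) G = (\<Sum>i\<in>I. tsum (t i) G)"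
  by (induction I rule: infinite_finite_induct) auto

context thin_projection
begin

abbreviation \<phi> :: "'h \<Rightarrow> 'h" where "\<phi> \<equiv> ore_phi sH \<Delta>H \<chi>"

lemma phi_eq: "\<phi> h = tsum (\<Delta>H h) (\<lambda>x z. sH (\<chi> x) z)"
  by (simp add: ore_phi_def tsum_def)

lemma sigma_y_phi: "\<sigma> h * y = y * \<sigma> (\<phi> h)"
  by (simp add: sigma_y phi_eq lin_tsum_arg[OF A.lin_mult_right[OF lin_sigma[OF lin_id]]] sigma_scale
      A.scale_mult_right)

lemma y_sigma_cancel: "y * \<sigma> h = y * \<sigma> k \<Longrightarrow> h = k"
  using arg_cong[of "y * \<sigma> h" "y * \<sigma> k" D] D_sigma[of 1 y h] D_sigma[of 1 y k]
  by (simp add: D_y) (metis pi_sigma)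

text \<open>
  Since \<open>\<sigma>(h) y = y \<sigma>(\<phi>(h))\<close> and left multiplication by \<open>y\<close> is injective on \<open>\<sigma>(H)\<close>, the multiplicativity
  of \<open>\<phi>\<close> is associativity in \<open>A\<close>.
\<close>

sublocale phi: ring_endomorphism \<phi>
proof
  fix a b
  have "y * \<sigma> (\<phi> (a * b)) = y * \<sigma> (\<phi> a * \<phi> b)"
    by (metis sigma_y_phi sigma_mult mult.assoc)
  then show "\<phi> (a * b) = \<phi> a * \<phi> b" by (rule y_sigma_cancel)
  have "lin sH sH (\<lambda>h. tsum (\<Delta>H h) (\<lambda>x z. sH (\<chi> x) z))" by (intro lin_rules bilinI)
  then show "\<phi> (a + b) = \<phi> a + \<phi> b" unfolding phi_eq by (rule lin_add)
  have "y * \<sigma> (\<phi> 1) = y * \<sigma> 1" by (simp flip: sigma_y_phi)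
  then show "\<phi> 1 = 1" by (rule y_sigma_cancel)
qed

lemma sigma_y_power: "\<sigma> h * y ^ j = y ^ j * \<sigma> ((\<phi> ^^ j) h)"
proof (induction j arbitrary: h)
  case (Suc j)
  have "\<sigma> h * y ^ Suc j = y * (\<sigma> (\<phi> h) * y ^ j)"
    by (simp add: sigma_y_phi flip: mult.assoc)
  then show ?case by (simp add: Suc mult.assoc funpow_Suc_right del: funpow.simps)
qed simp

text \<open>
  Evaluation of a polynomial with coefficients on the right at \<open>X = y\<close>.
\<close>

definition ore_eval :: "'h poly \<Rightarrow> 'a"
  where "ore_eval p = (\<Sum>i\<le>Polynomial.degree p. y ^ i * \<sigma> (Polynomial.coeff p i))"

lemma sigma_zero [simp]: "\<sigma> 0 = 0"
  by (rule lin_zero[OF lin_sigma[OF lin_id]])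

lemma ore_eval_bound: "Polynomial.degree p \<le> m \<Longrightarrow> ore_eval p = (\<Sum>i\<le>m. y ^ i * \<sigma> (Polynomial.coeff p i))"
  unfolding ore_eval_def by (rule sum.mono_neutral_left) (auto simp: coeff_eq_0)

lemma ore_eval_add: "ore_eval (p + r) = ore_eval p + ore_eval r"
proof -
  let ?m = "max (Polynomial.degree p) (Polynomial.degree r)"
  show ?thesis
    using ore_eval_bound[of p ?m] ore_eval_bound[of r ?m] ore_eval_bound[OF degree_add_le, of p ?m r]
    by (simp add: lin_add[OF lin_sigma[OF lin_id]] distrib_left sum.distrib)
qed

lemma ore_eval_monom: "ore_eval (Polynomial.monom h i) = y ^ i * \<sigma> h"
proof -
  have "ore_eval (Polynomial.monom h i) = (\<Sum>j\<le>i. if j = i then y ^ i * \<sigma> h else 0)"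
    unfolding ore_eval_bound[OF degree_monom_le] by (intro sum.cong HOL.refl) auto
  then show ?thesis by simp
qed

lemma ore_eval_zero: "ore_eval 0 = 0"
  using ore_eval_add[of 0 0] by simp

lemma ore_eval_sum: "ore_eval (sum f I) = (\<Sum>i\<in>I. ore_eval (f i))"
  by (induction I rule: infinite_finite_induct) (auto simp: ore_eval_zero ore_eval_add)

lemma ore_eval_const: "ore_eval (ore_const h) = \<sigma> h" and ore_eval_X: "ore_eval ore_X = y"
  by (simp_all add: ore_const_def ore_X_def ore_eval_monom)

lemma ore_eval_mult: "ore_eval (ore_mult \<phi> p r) = ore_eval p * ore_eval r"
proof -
  have "ore_eval (ore_mult \<phi> p r) = (\<Sum>i\<le>Polynomial.degree p. \<Sum>j\<le>Polynomial.degree r.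
      (y ^ i * \<sigma> (Polynomial.coeff p i)) * (y ^ j * \<sigma> (Polynomial.coeff r j)))"
    unfolding ore_mult_def ore_eval_sum ore_eval_monom
  proof (intro sum.cong HOL.refl)
    fix i j
    have "(y ^ i * \<sigma> (Polynomial.coeff p i)) * (y ^ j * \<sigma> (Polynomial.coeff r j)) =
        y ^ i * (\<sigma> (Polynomial.coeff p i) * y ^ j) * \<sigma> (Polynomial.coeff r j)"
      by (simp add: mult.assoc)
    then show "y ^ (i + j) * \<sigma> ((\<phi> ^^ j) (Polynomial.coeff p i) * Polynomial.coeff r j) =
        (y ^ i * \<sigma> (Polynomial.coeff p i)) * (y ^ j * \<sigma> (Polynomial.coeff r j))"
      by (simp add: sigma_y_power sigma_mult power_add mult.assoc)
  qed
  then show ?thesis by (simp add: ore_eval_def sum_product)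
qed

lemma ore_eval_ring_hom: "ring_hom_ring (ore_ring \<phi>) ring_of_type_algebra ore_eval"
proof (rule ring_hom_ringI[OF phi.ore_ring ring_of_type_algebra_ring])
qed (auto simp: phi.ore_ring_simps ring_of_type_algebra_def ore_eval_mult ore_eval_add ore_eval_const)

lemma ore_eval_surj: "range ore_eval = UNIV"
proof -
  have "\<exists>p. ore_eval p = a" for a
  proof -
    obtain c where "a = (\<Sum>i<N. y ^ i * \<sigma> (c i))"
      using y_power_expansion_exists[OF order_refl D_nil[OF order_refl]] by blast
    then have "a = ore_eval (\<Sum>i<N. Polynomial.monom (c i) i)" by (simp add: ore_eval_sum ore_eval_monom)
    then show ?thesis by metis
  qed
  then show ?thesis by (metis surj_def)
qed

lemma ore_eval_injective_low_degree:
  assumes "ore_eval p = 0" "\<forall>i\<ge>N. Polynomial.coeff p i = 0"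
  shows "p = 0"
proof (rule poly_eqI)
  fix i
  have "ore_eval p = (\<Sum>i\<le>Polynomial.degree p + N. y ^ i * \<sigma> (Polynomial.coeff p i))"
    by (rule ore_eval_bound) simp
  also have "\<dots> = (\<Sum>i<N. y ^ i * \<sigma> (Polynomial.coeff p i))"
    by (rule sum.mono_neutral_right) (use assms(2) in auto)
  finally have "(\<Sum>i<N. y ^ i * \<sigma> (Polynomial.coeff p i)) = 0" using assms(1) by simp
  from y_power_expansion_unique[OF order_refl this, of i]
  show "Polynomial.coeff p i = Polynomial.coeff 0 i"
    using assms(2) by (cases "i < N") auto
qed

lemma kernel_eval_eq: "a_kernel (ore_ring \<phi>) ring_of_type_algebra ore_eval = {p. ore_eval p = 0}"
  unfolding a_kernel_def' by (simp add: phi.ore_ring_simps(1) ring_of_type_algebra_def)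

text \<open>
  An element of the kernel is congruent modulo the ideal to one of degree less than \<open>N\<close>, which is zero
  because the powers of \<open>y\<close> below \<open>N\<close> are independent over \<open>H\<close>.
\<close>

lemma kernel_eval:
  assumes l: "y ^ N = \<sigma> (sH l (1 - g ^ N))"
  shows "O_ideal sH \<Delta>H N g \<chi> l = a_kernel (ore_ring \<phi>) ring_of_type_algebra ore_eval"
proof -
  interpret O: ring "ore_ring \<phi>" by (rule phi.ore_ring)
  interpret E: ring_hom_ring "ore_ring \<phi>" ring_of_type_algebra ore_eval by (rule ore_eval_ring_hom)
  define c where "c = sH l (1 - g ^ N)"
  let ?r = "Polynomial.monom 1 N - ore_const c"
  have I: "O_ideal sH \<Delta>H N g \<chi> l = genideal (ore_ring \<phi>) {?r}"
    by (simp add: O_ideal_def Let_def phi.ore_X_power c_def)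
  note ker = kernel_eval_eq
  have "ore_eval (?r + ore_const c) = \<sigma> c" using l by (simp add: ore_eval_monom c_def)
  then have r0: "ore_eval ?r = 0" by (simp only: ore_eval_add ore_eval_const) simp
  have ideal: "ideal (genideal (ore_ring \<phi>) {?r}) (ore_ring \<phi>)"
    by (rule O.genideal_ideal) (simp add: phi.ore_ring_simps)
  have mem: "?r \<in> genideal (ore_ring \<phi>) {?r}"
    using O.genideal_self[of "{?r}"] by (simp add: phi.ore_ring_simps)
  show ?thesis
    unfolding I
  proof
    show "genideal (ore_ring \<phi>) {?r} \<subseteq> a_kernel (ore_ring \<phi>) ring_of_type_algebra ore_eval"
      by (rule O.genideal_minimal[OF E.kernel_is_ideal]) (simp add: ker r0)
    then have sub: "ore_eval p = 0" if "p \<in> genideal (ore_ring \<phi>) {?r}" for p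
      using that ker by blast
    show "a_kernel (ore_ring \<phi>) ring_of_type_algebra ore_eval \<subseteq> genideal (ore_ring \<phi>) {?r}"
    proof
      fix p assume "p \<in> a_kernel (ore_ring \<phi>) ring_of_type_algebra ore_eval"
      then have p: "ore_eval p = 0" by (simp add: ker)
      obtain s where s: "\<forall>i\<ge>N. Polynomial.coeff s i = 0" "p - s \<in> genideal (ore_ring \<phi>) {?r}"
        using phi.reduce_modulo[OF _ ideal mem, of p] N_ge_2 by auto
      have "ore_eval s = 0" using ore_eval_add[of "p - s" s] sub[OF s(2)] p by simp
      then have "s = 0" using s(1) by (rule ore_eval_injective_low_degree)
      then show "p \<in> genideal (ore_ring \<phi>) {?r}" using s(2) by simp
    qed
  qed
qed

text \<open>
  Multiplying by \<open>X \<otimes> 1 + g \<otimes> X\<close> in the Ore extension corresponds to multiplying by \<open>\<Delta>(y)\<close> in \<open>A \<otimes> A\<close>.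
\<close>

lemma ore_eval_comult:
  assumes G: "bilin sA sA (*) G"
  shows "tsum (\<Delta>A (ore_eval p)) G = tsum (ore_comult \<Delta>H \<phi> g p) (\<lambda>a b. G (ore_eval a) (ore_eval b))"
proof -
  let ?op = "tensor_mult (ore_mult \<phi>) {#(ore_X, ore_const 1), (ore_const g, ore_X)#}"
  let ?t = "\<lambda>h. image_mset (map_prod ore_const ore_const) (\<Delta>H h)"
  have main: "tsum ((?op ^^ i) (?t h)) (\<lambda>a b. G (ore_eval a) (ore_eval b)) = tsum (\<Delta>A (y ^ i * \<sigma> h)) G"
    if "bilin sA sA (*) G" for G :: "'a \<Rightarrow> 'a \<Rightarrow> 'k" and i h
    using that
  proof (induction i arbitrary: G)
    case 0
    then show ?case by (simp add: tsum_map ore_eval_const sweedler_sigma)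
  next
    case (Suc i)
    note G = Suc.prems
    note [lin_rules] = lin_compose[OF bilin1[OF G]] lin_compose[OF bilin2[OF G]]
    have b: "bilin sA sA (*) (\<lambda>u v. G (y * u) v + G (\<sigma> g * u) (y * v))"
      by (intro lin_rules bilinI)
    have b2: "bilin sA sA (*) (\<lambda>a1 a2. tsum (\<Delta>A (y ^ i * \<sigma> h)) (\<lambda>b1 b2. G (a1 * b1) (a2 * b2)))"
      by (intro lin_rules bilinI)
    have "tsum ((?op ^^ Suc i) (?t h)) (\<lambda>a b. G (ore_eval a) (ore_eval b)) =
        tsum ((?op ^^ i) (?t h)) (\<lambda>a b. G (y * ore_eval a) (ore_eval b) + G (\<sigma> g * ore_eval a) (y * ore_eval b))"
      by (simp add: A.tsum_tensor_mult ore_eval_mult ore_eval_const ore_eval_X tsum_plus)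
    also have "\<dots> = tsum (\<Delta>A (y ^ i * \<sigma> h)) (\<lambda>u v. G (y * u) v + G (\<sigma> g * u) (y * v))"
      by (rule Suc.IH[OF b])
    also have "\<dots> = tsum (\<Delta>A (y * (y ^ i * \<sigma> h))) G"
      unfolding A.sweedler_mult[OF G] tensor_eq_tsum[OF comult_y b2] by (simp add: tsum_plus)
    finally show ?case by (simp add: mult.assoc)
  qed
  have l: "lin sA (*) (\<lambda>a. tsum (\<Delta>A a) G)" by (intro lin_rules G)
  have "tsum (\<Delta>A (ore_eval p)) G =
      (\<Sum>i\<le>Polynomial.degree p. tsum (\<Delta>A (y ^ i * \<sigma> (Polynomial.coeff p i))) G)"
    unfolding ore_eval_def by (rule lin_sum[OF l])
  then show ?thesis unfolding ore_comult_def tsum_Sum main[OF G] .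
qed

lemma ore_eval_counit: "\<epsilon>A (ore_eval p) = ore_counit \<epsilon>H p"
proof -
  have l: "lin sA (*) \<epsilon>A" by (rule A.lin_counit[OF lin_id])
  have z: "\<epsilon>A (y ^ i * \<sigma> h) = (if i = 0 then \<epsilon>H h else 0)" for i h
    by (cases i) (auto simp: A.counit_mult y_counit)
  have "\<epsilon>A (ore_eval p) = (\<Sum>i\<le>Polynomial.degree p. if i = 0 then \<epsilon>H (Polynomial.coeff p 0) else 0)"
    unfolding ore_eval_def lin_sum[OF l] z by (intro sum.cong HOL.refl) auto
  then show ?thesis by (simp add: ore_counit_def)
qed

lemma ore_eval_scale: "ore_eval (map_poly (sH c) p) = sA c (ore_eval p)"
proof -
  have "Polynomial.degree (map_poly (sH c) p) \<le> Polynomial.degree p"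
    by (rule degree_le) (simp add: coeff_map_poly coeff_eq_0)
  from ore_eval_bound[OF this] show ?thesis
    by (simp add: coeff_map_poly ore_eval_def A.scale_sum_right sigma_scale A.scale_mult_right)
qed

text \<open>
  Evaluation is constant on the cosets of its kernel, so the operations of the quotient may be computed
  on any representative.
\<close>

lemma ore_eval_isomorphism:
  assumes l: "y ^ N = \<sigma> (sH l (1 - g ^ N))"
  shows "\<exists>f. bialgebra_iso (O_bialgebra sH \<Delta>H \<epsilon>H N g \<chi> l) sA \<Delta>A \<epsilon>A f \<and>
    (\<forall>h. f (O_sigma sH \<Delta>H N g \<chi> l h) = \<sigma> h)"
proof -
  interpret E: ring_hom_ring "ore_ring \<phi>" ring_of_type_algebra ore_eval by (rule ore_eval_ring_hom)
  define I where "I = O_ideal sH \<Delta>H N g \<chi> l"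
  have ker: "I = a_kernel (ore_ring \<phi>) ring_of_type_algebra ore_eval"
    unfolding I_def by (rule kernel_eval[OF l])
  have I0: "p \<in> I \<longleftrightarrow> ore_eval p = 0" for p
    unfolding ker kernel_eval_eq by simp
  define cls where "cls = O_class sH \<Delta>H N g \<chi> l"
  have cls: "cls p = {i + p |i. i \<in> I}" for p
    unfolding cls_def O_class_def I_def[symmetric] by (auto simp: a_r_coset_def' phi.ore_ring_simps)
  define f where "f C = the_elem (ore_eval ` C)" for C
  have self: "p \<in> cls p" for p
    unfolding cls by (intro CollectI exI[of _ 0]) (simp add: I0 ore_eval_zero)
  have img: "ore_eval ` cls p = {ore_eval p}" for p
  proof -
    have "ore_eval p \<in> ore_eval ` cls p" by (rule imageI[OF self])
    moreover have "ore_eval ` cls p \<subseteq> {ore_eval p}" unfolding cls using I0 by (auto simp: ore_eval_add)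
    ultimately show ?thesis by blast
  qed
  have f_cls: "f (cls p) = ore_eval p" for p by (simp add: f_def img)
  define rep where "rep C = (SOME p. p \<in> C)" for C :: "'h poly set"
  have rep: "ore_eval (rep (cls p)) = ore_eval p" for p
  proof -
    have "rep (cls p) \<in> cls p" 
      unfolding rep_def by (rule someI[where P = "\<lambda>r. r \<in> cls p", OF self])
    then have "ore_eval (rep (cls p)) \<in> ore_eval ` cls p" by (rule imageI)
    then show ?thesis by (simp add: img)
  qed
  let ?B = "O_bialgebra sH \<Delta>H \<epsilon>H N g \<chi> l" and ?Q = "ore_ring \<phi> Quot I"
  have B: "carrier ?B = carrier ?Q" "monoid.mult ?B = monoid.mult ?Q" "one ?B = one ?Q"
    "add ?B = add ?Q" "scal ?B = (\<lambda>c C. cls (map_poly (sH c) (rep C)))"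
    "comul ?B = (\<lambda>C. image_mset (map_prod cls cls) (ore_comult \<Delta>H \<phi> g (rep C)))"
    "couni ?B = (\<lambda>C. ore_counit \<epsilon>H (rep C))"
    by (simp_all add: O_bialgebra_def Let_def ring.defs bialgebra_struct.defs I_def cls_def rep_def)
  have carrier: "\<exists>p. C = cls p" if "C \<in> carrier ?B" for C
    using that unfolding B FactRing_def A_RCOSETS_defs
    by (auto simp: phi.ore_ring_simps cls_def O_class_def I_def a_r_coset_def)
  have "ore_eval ` carrier (ore_ring \<phi>) = carrier ring_of_type_algebra"
    using ore_eval_surj by (simp add: phi.ore_ring_simps ring_of_type_algebra_def)
  then have "f \<in> ring_iso ?Q ring_of_type_algebra"
    unfolding f_def ker by (rule E.FactRing_iso_set)
  then have iso: "f \<in> ring_iso ?B ring_of_type_algebra"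
    by (simp add: ring_iso_def ring_hom_def B)
  have "bialgebra_iso ?B sA \<Delta>A \<epsilon>A f"
    unfolding bialgebra_iso_def
  proof (intro conjI allI ballI iso)
    fix c C assume "C \<in> carrier ?B"
    then obtain p where "C = cls p" using carrier by blast
    then show "f (scal ?B c C) = sA c (f C)" by (simp add: B f_cls ore_eval_scale rep)
  next
    fix C assume "C \<in> carrier ?B"
    then obtain p where C: "C = cls p" using carrier by blast
    show "tensor_eq sA sA (\<Delta>A (f C)) (image_mset (map_prod f f) (comul ?B C))"
    proof (rule tensor_eqI[OF vs(2) vs(2)])
      fix u v :: "'a \<Rightarrow> 'k" assume uv: "lin sA (*) u" "lin sA (*) v"
      have b: "bilin sA sA (*) (\<lambda>a b. u a * v b)" by (intro lin_rules bilinI uv)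
      have "f C = ore_eval (rep C)" by (simp add: C f_cls rep)
      then show "tsum (\<Delta>A (f C)) (\<lambda>a b. u a * v b) =
          tsum (image_mset (map_prod f f) (comul ?B C)) (\<lambda>a b. u a * v b)"
        by (simp add: B tsum_map f_cls ore_eval_comult[OF b])
    qed
    show "\<epsilon>A (f C) = couni ?B C" using ore_eval_counit[of "rep C"] by (simp add: B C f_cls rep)
  qed
  moreover have "f (O_sigma sH \<Delta>H N g \<chi> l h) = \<sigma> h" for h
    using f_cls[of "ore_const h"] by (simp add: O_sigma_def cls_def ore_eval_const)
  ultimately show ?thesis by blast
qed

lemma lin_conv_power: "lin sH (*) (conv_power \<Delta>H \<epsilon>H \<chi> m)"
proof (induction m)
  case 0
  then show ?case using H.lin_counit[OF lin_id] by simp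
next
  case (Suc m)
  note [lin_rules] = Suc.IH
  have "lin sH (*) (\<lambda>h. tsum (\<Delta>H h) (\<lambda>x z. \<chi> x * conv_power \<Delta>H \<epsilon>H \<chi> m z))"
    by (intro lin_rules bilinI)
  then show ?case by (simp add: tsum_def)
qed

lemmas lin_conv_power_comp [lin_rules] = lin_compose[OF lin_conv_power]

lemma sigma_y_power_conv:
  "\<sigma> h * y ^ m = tsum (\<Delta>H h) (\<lambda>h1 h2. sA (conv_power \<Delta>H \<epsilon>H \<chi> m h1) (y ^ m * \<sigma> h2))"
proof (induction m arbitrary: h)
  case 0
  show ?case using H.sweedler_counit_left[OF lin_sigma[OF lin_id], of h] by simp
next
  case (Suc m)
  let ?c = "conv_power \<Delta>H \<epsilon>H \<chi>"
  have "\<sigma> h * y ^ Suc m = tsum (\<Delta>H h) (\<lambda>h1 h2. sA (\<chi> h1) (y * (\<sigma> h2 * y ^ m)))"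
    by (simp add: sigma_y lin_tsum_arg[OF A.lin_mult_left[OF lin_id]] A.scale_mult_left mult.assoc
        flip: mult.assoc[of "\<sigma> h"])
  also have "\<dots> = tsum (\<Delta>H h) (\<lambda>h1 w. tsum (\<Delta>H w) (\<lambda>h2 h3. sA (\<chi> h1 * ?c m h2) (y ^ Suc m * \<sigma> h3)))"
    unfolding Suc lin_tsum_arg[OF A.lin_mult_right[OF lin_id]] lin_tsum_arg[OF lin_scale_const[OF vs(2) lin_id]]
    by (simp add: A.scale_mult_right mult.assoc)
  also have "\<dots> = tsum (\<Delta>H h) (\<lambda>w h3. tsum (\<Delta>H w) (\<lambda>h1 h2. sA (\<chi> h1 * ?c m h2) (y ^ Suc m * \<sigma> h3)))"
    by (rule H.sweedler_coassoc[where sU = sA, symmetric]) (intro lin_rules)+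
  also have "\<dots> = tsum (\<Delta>H h) (\<lambda>w h3. sA (?c (Suc m) w) (y ^ Suc m * \<sigma> h3))"
  proof (intro tsum_cong)
    fix w h3
    have "lin (*) sA (\<lambda>c. sA c v)" for v by (intro lin_rules)
    note l = lin_tsum_arg[OF this]
    have c: "?c (Suc m) w = tsum (\<Delta>H w) (\<lambda>x z. \<chi> x * ?c m z)" by (simp add: tsum_def)
    show "tsum (\<Delta>H w) (\<lambda>h1 h2. sA (\<chi> h1 * ?c m h2) (y ^ Suc m * \<sigma> h3)) =
        sA (?c (Suc m) w) (y ^ Suc m * \<sigma> h3)"
      unfolding c l ..
  qed
  finally show ?case .
qed

text \<open>
  Comparing \<open>\<sigma>(h) y\<^sup>N\<close> with \<open>\<Sum> \<chi>\<^sup>N(h\<^sub>1) y\<^sup>N \<sigma>(h\<^sub>2)\<close> for \<open>y\<^sup>N = \<sigma>(w)\<close> shows that \<open>w\<close> is an eigenvector with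
  character \<open>\<chi>\<^sup>N\<close> under the adjoint action, which is the condition on a nonzero \<open>\<lambda>\<close>.
\<close>

lemma compatible_datum_exists:
  assumes "finite_dimensional sH \<or> cosemisimple sH \<Delta>H"
  shows "\<exists>l. y ^ N = \<sigma> (sH l (1 - g ^ N)) \<and> compatible_datum sH \<Delta>H \<epsilon>H S N q g \<chi> l"
proof -
  obtain l0 where l0: "y ^ N = \<sigma> (sH l0 (1 - g ^ N))"
    using y_power_n_trivial[OF assms] n_eq_N by auto
  \<comment> \<open>The coefficient must be zero when \<open>g\<^sup>N = 1\<close>, where
    \<open>l0\<close> is arbitrary.\<close>
  define l where "l = (if sH l0 (1 - g ^ N) = 0 then 0 else l0)"
  define w where "w = 1 - g ^ N"
  have l: "y ^ N = \<sigma> (sH l w)" using l0 by (simp add: l_def w_def)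
  let ?c = "conv_power \<Delta>H \<epsilon>H \<chi> N"
  have ad: "sH (?c h) w = tsum (\<Delta>H h) (\<lambda>x z. x * w * S z)" if "l \<noteq> 0" for h
  proof -
    have hw: "h * w = tsum (\<Delta>H h) (\<lambda>h1 h2. sH (?c h1) (w * h2))" for h
    proof -
      have "\<sigma> (sH l (h * w)) = \<sigma> h * y ^ N"
        by (simp add: l sigma_mult H.scale_mult_right flip: sigma_mult)
      also have "\<dots> = tsum (\<Delta>H h) (\<lambda>h1 h2. \<sigma> (sH l (sH (?c h1) (w * h2))))"
        unfolding sigma_y_power_conv
        by (simp add: l sigma_scale H.scale_mult_left mult.commute A.scale_mult_left sigma_mult)
      also have "\<dots> = \<sigma> (sH l (tsum (\<Delta>H h) (\<lambda>h1 h2. sH (?c h1) (w * h2))))"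
        by (rule lin_tsum_arg[where ?s1.0 = sH and ?s2.0 = sA, symmetric]) (intro lin_rules)
      finally have "sH l (h * w) = sH l (tsum (\<Delta>H h) (\<lambda>h1 h2. sH (?c h1) (w * h2)))"
        by (metis pi_sigma)
      then show ?thesis using that by simp
    qed
    have "tsum (\<Delta>H h) (\<lambda>x z. x * w * S z) =
        tsum (\<Delta>H h) (\<lambda>x z. tsum (\<Delta>H x) (\<lambda>h1 h2. sH (?c h1) (w * (h2 * S z))))"
      unfolding hw lin_tsum_arg[OF H.lin_mult_left[OF lin_id]]
      by (simp add: H.scale_mult_left mult.assoc)
    also have "\<dots> = tsum (\<Delta>H h) (\<lambda>h1 v. tsum (\<Delta>H v) (\<lambda>h2 z. sH (?c h1) (w * (h2 * S z))))"
      by (rule H.sweedler_coassoc[where sU = sH]) (intro lin_rules)+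
    also have "\<dots> = tsum (\<Delta>H h) (\<lambda>h1 v. sH (?c h1) (w * tsum (\<Delta>H v) (\<lambda>h2 z. h2 * S z)))"
      unfolding lin_tsum_arg[OF H.lin_mult_right[OF lin_id]] lin_tsum_arg[OF lin_scale_const[OF vs(1) lin_id]] ..
    also have "\<dots> = tsum (\<Delta>H h) (\<lambda>h1 v. sH (\<epsilon>H v) (sH (?c h1) w))"
      by (simp add: H.sweedler_antipode_right H.scale_mult_right mult.commute)
    also have "\<dots> = sH (?c h) w"
      by (rule H.sweedler_counit_right) (intro lin_rules)
    finally show ?thesis ..
  qed
  have "compatible_datum sH \<Delta>H \<epsilon>H S N q g \<chi> l"
    unfolding compatible_datum_def
  proof (intro conjI impI yetter_drinfeld)
    assume a: "g ^ N = 1 \<or> (\<exists>h. sH (?c h) (1 - g ^ N) \<noteq> (\<Sum>(x, y)\<in>#\<Delta>H h. x * (1 - g ^ N) * S y))"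
    show "l = 0"
    proof (rule ccontr)
      assume "l \<noteq> 0"
      then have "g ^ N \<noteq> 1" by (auto simp: l_def)
      then show False using a ad[OF \<open>l \<noteq> 0\<close>] by (auto simp: w_def tsum_def)
    qed
  qed
  then show ?thesis using l by (auto simp: w_def)
qed

end


section \<open>Bialgebras with a projection and a thin coalgebra of coinvariants\<close>

text \<open>
  The line of a group-like element is a simple subcoalgebra and therefore contained in the coradical.
\<close>

lemma (in subspace_coalgebra) one_dimensional_coradical:
  assumes dim: "has_dim scale (coradical scale comult C) 1"
    and e: "grouplike scale comult counit e" "e \<in> C"
  shows "coradical scale comult C = span {e}"
proof -
  have e0: "e \<noteq> 0" using e(1) lin_zero[OF lin_eps] by (auto simp: grouplike_def)
  have sub: "span {e} \<subseteq> C" using e(2) C_subspace by (simp add: span_minimal)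
  have "biinvariant (span {e})"
    unfolding biinvariant_def
  proof (intro conjI allI impI sub subspace_span)
    fix f d assume f: "lin scale (*) f" and "d \<in> span {e}"
    then obtain c where d: "d = scale c e" by (auto simp: span_singleton)
    show "lc f d \<in> span {e}" "rc f d \<in> span {e}"
      unfolding d lin_scale[OF lin_left[OF f]] lin_scale[OF lin_right[OF f]] lcontr_grouplike[OF e(1) f]
      by (intro span_scale span_base; simp)+
  qed
  then have "subcoalgebra scale comult (span {e})" by (simp add: biinvariant_iff_subcoalgebra)
  moreover have "E = {0} \<or> E = span {e}" if E: "subspace E" "E \<subseteq> span {e}" for E
  proof (cases "E \<subseteq> {0}")
    case True
    then show ?thesis using subspace_0[OF E(1)] by blast
  next
    case False
    then obtain v where "v \<in> E" "v \<noteq> 0" by blast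
    then obtain c where "v = scale c e" "c \<noteq> 0" using E(2) by (auto simp: span_singleton)
    then have "e = scale (1 / c) v" by simp
    then have "e \<in> E" using \<open>v \<in> E\<close> subspace_scale[OF E(1)] by metis
    then show ?thesis using E by (simp add: span_minimal subset_antisym)
  qed
  moreover have "e \<in> span {e}" by (rule span_base) simp
  ultimately have "simple_subcoalgebra scale comult (span {e})"
    unfolding simple_subcoalgebra_def using e0 by (metis singletonD subcoalgebra_def)
  then have "e \<in> coradical scale comult C"
    unfolding coradical_def using sub \<open>e \<in> span {e}\<close> by (intro span_base) blast
  moreover obtain bs where "finite bs" "span bs = coradical scale comult C" "card bs = 1"
    using dim by (auto simp: has_dim_def)
  then obtain b where b: "span {b} = coradical scale comult C" by (metis card_1_singletonE)
  ultimately obtain c where c: "e = scale c b" by (auto simp: span_singleton simp flip: b)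
  then have "b = scale (1 / c) e" using e0 by auto
  then have "b \<in> span {e}" using span_scale[OF \<open>e \<in> span {e}\<close>] by metis
  moreover have "e \<in> span {b}" unfolding c by (intro span_scale span_base) simp
  ultimately show ?thesis unfolding b[symmetric] by (simp add: span_minimal subset_antisym)
qed

text \<open>
  The element \<open>1\<close> is group-like in \<open>R\<close>, so the group-like element with respect to which primitive
  elements are formed is \<open>1\<close>. The functional \<open>T\<close> is \<open>t \<circ> \<tau>\<close> for a functional \<open>t\<close> that separates \<open>y\<close>
  from \<open>1\<close>.
\<close>

lemma (in bialgebra_projection) thin_projection_exists:
  assumes dim: "has_dim sA R N" and thin: "thin sA \<delta> \<epsilon>A R"
  shows "\<exists>y T d. thin_projection sH \<Delta>H \<epsilon>H S sA \<Delta>A \<epsilon>A \<sigma> \<pi> N y T d"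
proof -
  interpret C: subspace_coalgebra sA \<delta> \<epsilon>A R by (rule coinvariants_coalgebra)
  obtain e where e: "e \<in> R" "grouplike sA \<delta> \<epsilon>A e" "has_dim sA (primitives sA \<delta> R e) 1"
    and cor: "has_dim sA (coradical sA \<delta> R) 1"
    using thin by (auto simp: thin_def)
  have g1: "grouplike sA \<delta> \<epsilon>A 1"
    unfolding grouplike_def
  proof
    show "tensor_eq sA sA (\<delta> 1) {#(1, 1)#}"
    proof (rule tensor_eqI[OF vs(2) vs(2)])
      fix u v :: "'a \<Rightarrow> 'k" assume uv: "lin sA (*) u" "lin sA (*) v"
      have b: "bilin sA sA (*) (\<lambda>a b. u a * v b)" by (intro lin_rules bilinI uv)
      show "tsum (\<delta> 1) (\<lambda>a b. u a * v b) = tsum {#(1, 1)#} (\<lambda>a b. u a * v b)"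
        by (simp add: delta_one[OF b])
    qed
  qed (rule A.counit_one)
  have cor1: "coradical sA \<delta> R = A.span {1}"
    by (rule C.one_dimensional_coradical[OF cor g1 one_coinvariant])
  have "e \<in> A.span {1}"
    using C.one_dimensional_coradical[OF cor e(2,1)] cor1 A.span_base[of e "{e}"] by simp
  then obtain c where c: "e = sA c 1" by (auto simp: A.span_singleton)
  have "\<epsilon>A e = c" unfolding c by (simp add: lin_scale[OF C.lin_eps] A.counit_one)
  then have e1: "e = 1" using e(2) c by (simp add: grouplike_def)
  obtain bs where bs: "finite bs" "A.span bs = R"
    using dim by (auto simp: has_dim_def)
  interpret C: connected_coalgebra sA \<delta> \<epsilon>A R 1 bs
  proof
    show "finite bs" "R \<subseteq> A.span bs" using bs by auto
    show "1 \<in> R" "\<epsilon>A 1 = 1" by (rule one_coinvariant, rule A.counit_one)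
    show "lcontr sA \<delta> f 1 = sA (f 1) 1" "rcontr sA \<delta> f 1 = sA (f 1) 1" if "lin sA (*) f" for f
      by (rule A.lcontr_grouplike[OF g1 that])+
    fix D assume D: "C.biinvariant D" "D \<noteq> {0}"
    then obtain E where E: "simple_subcoalgebra sA \<delta> E" "E \<subseteq> D"
      using C.biinvariant_contains_simple[OF bs(1) equalityD2[OF bs(2)] D] by blast
    have "E \<subseteq> R" using E(2) D(1) by (auto simp: C.biinvariant_def)
    then have "E \<subseteq> coradical sA \<delta> R"
      unfolding coradical_def using E(1) by (intro subset_trans[OF _ A.span_superset]) auto
    then have E1: "E \<subseteq> A.span {1}" unfolding cor1 .
    have sE: "A.subspace E" "E \<noteq> {0}"
      using E(1) by (auto simp: simple_subcoalgebra_def subcoalgebra_def)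
    obtain v where v: "v \<in> E" "v \<noteq> 0" using sE(2) A.subspace_0[OF sE(1)] by blast
    obtain c where "v = sA c 1" using E1 v(1) by (auto simp: A.span_singleton)
    then have "1 = sA (1 / c) v" using v(2) by auto
    then have "1 \<in> E" using A.subspace_scale[OF sE(1) v(1), of "1 / c"] by simp
    then show "1 \<in> D" using E(2) by blast
  qed
  obtain bp where bp: "card bp = 1" "\<not> A.dependent bp" "A.span bp = primitives sA \<delta> R 1"
    using e(3) by (auto simp: has_dim_def e1)
  then obtain y where y: "bp = {y}" by (metis card_1_singletonE)
  have y0: "y \<noteq> 0" using bp(2) y by auto
  have "y \<in> primitives sA \<delta> R 1" using bp(3) y A.span_base[of y "{y}"] by simp
  then have yR: "y \<in> R" and yp: "tensor_eq sA sA (\<delta> y) {#(y, 1), (1, y)#}"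
    by (auto simp: primitives_def)
  have prim: "w \<in> A.span {y}" if "w \<in> R" "tensor_eq sA sA (\<delta> w) {#(w, 1), (1, w)#}" for w
    using that bp(3) y by (auto simp: primitives_def)
  have "bilin sA sA (*) (\<lambda>u v. \<epsilon>A u * \<epsilon>A v)" by (intro lin_rules bilinI)
  from tensor_eq_tsum[OF yp this] have "\<epsilon>A y = \<epsilon>A y + \<epsilon>A y"
    using C.pairing_left[OF C.lin_eps, of y \<epsilon>A] C.left_counit[OF yR] by (simp add: A.counit_one)
  then have ey: "\<epsilon>A y = 0" by (metis add_cancel_right_right)
  have "y \<notin> A.span {1}"
    using ey y0 by (auto simp: A.span_singleton lin_scale[OF C.lin_eps] A.counit_one)
  then obtain t where t: "lin sA (*) t" "t y = 1" "\<And>v. v \<in> A.span {1} \<Longrightarrow> t v = 0"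
    by (rule separating_functional[OF vs(2) A.subspace_span]) iprover
  have t1: "t 1 = 0" by (rule t(3)) (rule A.span_base, simp)
  interpret C: thin_coalgebra sA \<delta> \<epsilon>A R 1 bs y t
    by unfold_locales (use t t1 prim in auto)
  obtain E L where E: "E 0 = 1" "\<forall>i\<le>L. E i \<in> R"
    "\<forall>i<L. lcontr sA \<delta> t (E (Suc i)) = E i \<and> \<epsilon>A (E (Suc i)) = 0"
    "\<forall>c\<in>R. (lcontr sA \<delta> t ^^ Suc L) c = 0 \<and>
      c = (\<Sum>i\<le>L. sA (\<epsilon>A ((lcontr sA \<delta> t ^^ i) c)) (E i))"
    "\<forall>N. has_dim sA R N \<longrightarrow> N = Suc L"
    using C.divided_power_basis by (elim exE conjE) (rule that)
  have N: "N = Suc L" using E(5) dim by simp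
  define T where "T a = t (\<tau> a)" for a
  have LT: "lcontr sA \<Delta>A T = lcontr sA \<delta> t" unfolding lcontr_delta T_def ..
  have "thin_projection sH \<Delta>H \<epsilon>H S sA \<Delta>A \<epsilon>A \<sigma> \<pi> N y T E"
  proof unfold_locales
    show "lin sA (*) T" unfolding T_def by (rule lin_compose[OF t(1) lin_tau[OF lin_id]])
    show "T (a * \<sigma> h) = T a * \<epsilon>H h" for a h
      by (simp add: T_def tau_mult_sigma lin_scale[OF t(1)] mult.commute)
    show "T 1 = 0" "T y = 1" using t1 t(2) by (simp_all add: T_def tau_id one_coinvariant yR)
    show "\<exists>c. w = sA c y" if "w \<in> R" "tensor_eq sA sA (\<delta> w) {#(w, 1), (1, w)#}" for w
      using prim[OF that] by (auto simp: A.span_singleton)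
    show "r = (\<Sum>i<N. sA (\<epsilon>A ((lcontr sA \<Delta>A T ^^ i) r)) (E i))" if "r \<in> R" for r
      using bspec[OF E(4) that] unfolding N LT lessThan_Suc_atMost by (elim conjE)
    show "(lcontr sA \<Delta>A T ^^ N) r = 0" if "r \<in> R" for r
      using bspec[OF E(4) that] unfolding N LT by (elim conjE)
  qed (use E(1-3) yR yp in \<open>simp_all add: N LT\<close>)
  then show ?thesis by blast
qed

theorem theorem4p4:
  fixes sH :: "'k::field_char_0 \<Rightarrow> 'h::ring_1 \<Rightarrow> 'h"
    and \<Delta>H :: "'h \<Rightarrow> ('h \<times> 'h) multiset"
    and \<epsilon>H :: "'h \<Rightarrow> 'k"
    and S :: "'h \<Rightarrow> 'h"
    and sA :: "'k \<Rightarrow> 'a::ring_1 \<Rightarrow> 'a"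
    and \<Delta>A :: "'a \<Rightarrow> ('a \<times> 'a) multiset"
    and \<epsilon>A :: "'a \<Rightarrow> 'k"
    and \<sigma> :: "'h \<Rightarrow> 'a"
    and \<pi> :: "'a \<Rightarrow> 'h"
    and N :: nat
  assumes "hopf_algebra sH \<Delta>H \<epsilon>H S"
    and "bialgebra sA \<Delta>A \<epsilon>A"
    and "bialgebra_hom sH \<Delta>H \<epsilon>H sA \<Delta>A \<epsilon>A \<sigma>"
    and "inj \<sigma>"
    and "\<And>h. \<pi> (\<sigma> h) = h"
    and "coalgebra_hom sA \<Delta>A \<epsilon>A sH \<Delta>H \<epsilon>H \<pi>"
    and "\<And>h a. \<pi> (\<sigma> h * a) = h * \<pi> a"
    and "\<And>a h. \<pi> (a * \<sigma> h) = \<pi> a * h"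
    and "finite_dimensional sH \<or> cosemisimple sH \<Delta>H"
    and "has_dim sA (proj_R sA \<Delta>A sH \<pi>) N"
    and "thin sA (proj_delta \<Delta>A S \<sigma> \<pi>) \<epsilon>A (proj_R sA \<Delta>A sH \<pi>)"
  shows "\<exists>q g \<chi> l.
    primitive_root_of_unity N q \<and>
    compatible_datum sH \<Delta>H \<epsilon>H S N q g \<chi> l \<and>
    (\<exists>f. bialgebra_iso (O_bialgebra sH \<Delta>H \<epsilon>H N g \<chi> l) sA \<Delta>A \<epsilon>A f \<and>
         (\<forall>h. f (O_sigma sH \<Delta>H N g \<chi> l h) = \<sigma> h))"
proof -
  interpret P: bialgebra_projection sH \<Delta>H \<epsilon>H S sA \<Delta>A \<epsilon>A \<sigma> \<pi>
    using assms(1-3,5-8)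
    by (simp add: bialgebra_projection_def bialgebra_projection_axioms_def)
  obtain y T d where "thin_projection sH \<Delta>H \<epsilon>H S sA \<Delta>A \<epsilon>A \<sigma> \<pi> N y T d"
    using P.thin_projection_exists[OF assms(10,11)] by blast
  then interpret P: thin_projection sH \<Delta>H \<epsilon>H S sA \<Delta>A \<epsilon>A \<sigma> \<pi> N y T d .
  obtain l where "y ^ N = \<sigma> (sH l (1 - P.g ^ N))"
    "compatible_datum sH \<Delta>H \<epsilon>H S N P.q P.g P.\<chi> l"
    using P.compatible_datum_exists[OF assms(9)] by blast
  moreover have "primitive_root_of_unity N P.q"
    using P.primitive_root P.n_eq_N by simp
  ultimately show ?thesis using P.ore_eval_isomorphism by blast
qed

end
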